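(* Let $n\ge1$ and let $p_t(r,\eta)$ be the subelliptic heat kernel on $\mathbb{S}^{4n+3}$ issued from the north pole, written in the cylindric coordinates $(r,\eta)$. For $t>0$, $r\in[0,\frac{\pi}{2})$, $\eta\in[0,\pi]$, $$p_t(r,\eta)=\sum_{m=0}^{+\infty}\sum_{k=0}^{+\infty}\alpha_{k,m}\,e^{-4[k(k+2n+m+1)+nm]t}\,\frac{\sin (m+1)\eta}{\sin \eta}\,(\cos r)^m\,P_k^{2n-1,m+1}(\cos 2r),$$ where $$\alpha_{k,m}=\frac{\Gamma(2n)}{2\pi^{2n+2}}(2k+m+2n+1)(m+1)\binom{k+m+2n}{2n-1}$$ and $$P_k^{2n-1,m+1}(x)=\frac{(-1)^k}{2^kk!(1-x)^{2n-1}(1+x)^{m+1}}\frac{d^k}{dx^k}\left((1-x)^{2n-1+k}(1+x)^{m+1+k}\right)$$ is a Jacobi polynomial (at $\eta\in\{0,\pi\}$ the quotient $\sin(m+1)\eta/\sin\eta$ is understood by continuity).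
   Context: $\mathbb{H}$ denotes the quaternions, $\mathbb{S}^{4n+3}=\{q\in\mathbb{H}^{n+1}:\|q\|=1\}$ with its round metric and Laplace–Beltrami operator $\Delta$. The group $\mathbf{SU}(2)$ of unit quaternions acts isometrically by $g\cdot(q_1,\dots,q_{n+1})=(gq_1,\dots,gq_{n+1})$ with quotient $\mathbb{HP}^n$. The sub-Laplacian $L$ is the lift to $\mathbb{S}^{4n+3}$ of the Laplace–Beltrami operator of $\mathbb{HP}^n$ (horizontal Laplacian of this Riemannian submersion), i.e. $L=\Delta-T_1^2-T_2^2-T_3^2$ with $T_1,T_2,T_3$ the unit-length generators $f\mapsto\frac{d}{d\theta}|_{\theta=0}f(e^{S\theta}q)$, $S=I,J,K$. Cylindric coordinates: for $q_{n+1}\neq0$, $r\in[0,\pi/2)$ and $\eta\in[0,\pi]$ are defined by $|q_{n+1}|=\cos r$, $\mathrm{Re}(q_{n+1})=\cos r\cos\eta$ ($r$ is the Riemannian distance on $\mathbb{HP}^n$ from the image of the north pole $(0,\dots,0,1)$, and $\eta$ is the distance from the identity to $q_{n+1}/|q_{n+1}|$ in $\mathbf{SU}(2)\cong\mathbb{S}^3$). $p_t$ is the kernel of $e^{tL}$ from the north pole with respect to the Riemannian volume measure, which on cylindric functions reads $\frac{8\pi^{2n+1}}{\Gamma(2n)}(\sin r)^{4n-1}(\cos r)^3(\sin\eta)^2\,dr\,d\eta$; $p_t$ depends only on $(r,\eta)$. *)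

theory Defs
  imports "HOL-Analysis.Analysis" "HOL-Computational_Algebra.Polynomial"
begin

section \<open>Quaternions\<close>

text \<open>\<open>(a, b, c, d)\<close> stands for \<open>a + b I + c J + d K\<close>. The product type carries the
  Euclidean norm, which is the quaternionic absolute value.\<close>

type_synonym quat = "real \<times> real \<times> real \<times> real"

fun qmult :: "quat \<Rightarrow> quat \<Rightarrow> quat" where
  "qmult (a, b, c, d) (a', b', c', d') =
     (a * a' - b * b' - c * c' - d * d',
      a * b' + b * a' + c * d' - d * c',
      a * c' - b * d' + c * a' + d * b',
      a * d' + b * c' - c * b' + d * a')"

definition qone :: quat where "qone = (1, 0, 0, 0)"
definition qI :: quat where "qI = (0, 1, 0, 0)"
definition qJ :: quat where "qJ = (0, 0, 1, 0)"
definition qK :: quat where "qK = (0, 0, 0, 1)"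

definition qRe :: "quat \<Rightarrow> real" where "qRe q = fst q"

text \<open>The exponential \<open>e\<^bsup>S \<theta>\<^esup>\<close>; the closed form is valid because it is only used for the
  imaginary units, where \<open>S\<^sup>2 = -1\<close>.\<close>

definition qexp :: "quat \<Rightarrow> real \<Rightarrow> quat" where
  "qexp S \<theta> = cos \<theta> *\<^sub>R qone + sin \<theta> *\<^sub>R S"

text \<open>\<open>\<H>\<^bsup>n+1\<^esup>\<close> with \<open>n = CARD('n)\<close>, written as \<open>\<H>\<^sup>n \<times> \<H>\<close> so that \<open>q\<^bsub>n+1\<^esub>\<close> is the second
  component.\<close>

type_synonym 'n qspace = "(quat ^ 'n) \<times> quat"

definition qact :: "quat \<Rightarrow> 'n::finite qspace \<Rightarrow> 'n qspace" where
  "qact g q = ((\<chi> i. qmult g (fst q $ i)), qmult g (snd q))"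

definition north_pole :: "'n::finite qspace" where
  "north_pole = (0, qone)"

section \<open>Smooth functions, Laplace-Beltrami operator and volume of a round unit sphere\<close>

primrec Ck_on :: "nat \<Rightarrow> ('a::euclidean_space \<Rightarrow> real) \<Rightarrow> 'a set \<Rightarrow> bool" where
  "Ck_on 0 f U \<longleftrightarrow> continuous_on U f"
| "Ck_on (Suc k) f U \<longleftrightarrow>
     (\<forall>x\<in>U. f differentiable (at x)) \<and> (\<forall>v. Ck_on k (\<lambda>x. frechet_derivative f (at x) v) U)"

text \<open>Functions on the sphere are represented by functions on the ambient space; values off the
  sphere are irrelevant everywhere below.\<close>

definition smooth_on_sphere :: "('a::euclidean_space \<Rightarrow> real) \<Rightarrow> bool" where
  "smooth_on_sphere f \<longleftrightarrow>
     (\<exists>U F. open U \<and> sphere 0 1 \<subseteq> U \<and> (\<forall>k. Ck_on k F U) \<and> (\<forall>x\<in>sphere 0 1. F x = f x))"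

definition tangent_onb :: "'a::euclidean_space \<Rightarrow> 'a set" where
  "tangent_onb x = (SOME B. pairwise orthogonal B \<and> (\<forall>e\<in>B. norm e = 1) \<and> span B = {v. x \<bullet> v = 0})"

lemma tangent_onb:
  "pairwise orthogonal (tangent_onb x) \<and> (\<forall>e\<in>tangent_onb x. norm e = 1) \<and>
   span (tangent_onb x) = {v. x \<bullet> v = 0}"
proof -
  have "subspace {v. x \<bullet> v = 0}" by (rule subspace_hyperplane)
  then obtain B where "pairwise orthogonal B" "\<And>e. e \<in> B \<Longrightarrow> norm e = 1" "span B = {v. x \<bullet> v = 0}"
    by (rule orthonormal_basis_subspace) blast
  then have "\<exists>B. pairwise orthogonal B \<and> (\<forall>e\<in>B. norm e = 1) \<and> span B = {v. x \<bullet> v = 0}"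
    by blast
  then show ?thesis unfolding tangent_onb_def by (rule someI_ex)
qed

text \<open>The Laplace-Beltrami operator as the trace of the Riemannian Hessian:
  \<open>Hess f (e, e)\<close> is the second derivative of \<open>f\<close> along the geodesic with initial velocity \<open>e\<close>,
  which on the unit sphere is the great circle \<open>cos s x + sin s e\<close>. The trace does not depend on the
  orthonormal basis of the tangent space.\<close>

definition sphere_Laplacian :: "('a::euclidean_space \<Rightarrow> real) \<Rightarrow> 'a \<Rightarrow> real" where
  "sphere_Laplacian f x =
     (\<Sum>e\<in>tangent_onb x. (deriv ^^ 2) (\<lambda>s. f (cos s *\<^sub>R x + sin s *\<^sub>R e)) 0)"

text \<open>The Riemannian volume \<open>\<sigma>\<close> of the unit sphere in dimension \<open>d\<close>, obtained from
  \<open>dx = \<rho>\<^bsup>d-1\<^esup> d\<rho> d\<sigma>\<close>: the volume of \<open>A\<close> is \<open>d\<close> times the Lebesgue measure of the cone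
  \<open>{x. \<bar>x\<bar> < 1, x / \<bar>x\<bar> \<in> A}\<close>. It lives on the Borel sets of the ambient space and is concentrated
  on the sphere.\<close>

definition sphere_volume :: "'a::euclidean_space measure" where
  "sphere_volume =
     scale_measure (of_nat DIM('a)) (distr (restrict_space lborel (ball 0 1)) borel sgn)"

section \<open>The sub-Laplacian, its semigroup and its heat kernel\<close>

definition vertical :: "quat \<Rightarrow> ('n::finite qspace \<Rightarrow> real) \<Rightarrow> 'n qspace \<Rightarrow> real" where
  "vertical S f q = deriv (\<lambda>\<theta>. f (qact (qexp S \<theta>) q)) 0"

definition sub_Laplacian :: "('n::finite qspace \<Rightarrow> real) \<Rightarrow> 'n qspace \<Rightarrow> real" where
  "sub_Laplacian f q =
     sphere_Laplacian f q - vertical qI (vertical qI f) q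
       - vertical qJ (vertical qJ f) q - vertical qK (vertical qK f) q"

text \<open>\<open>P t = e\<^bsup>t L\<^esup>\<close> on the Banach space of continuous functions on the sphere with the supremum
  norm: a strongly continuous semigroup of bounded linear operators whose infinitesimal generator
  extends \<open>L\<close> on smooth functions. Smooth functions are a core of the generator, so this determines
  the semigroup.\<close>

definition heat_semigroup ::
    "(real \<Rightarrow> ('n::finite qspace \<Rightarrow> real) \<Rightarrow> 'n qspace \<Rightarrow> real) \<Rightarrow> bool" where
  "heat_semigroup P \<longleftrightarrow>
     (\<forall>t\<ge>0. \<forall>f. continuous_on (sphere 0 1) f \<longrightarrow> continuous_on (sphere 0 1) (P t f)) \<and>
     (\<forall>t\<ge>0. \<forall>f g a b. continuous_on (sphere 0 1) f \<longrightarrow> continuous_on (sphere 0 1) g \<longrightarrow>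
        (\<forall>q\<in>sphere 0 1. P t (\<lambda>x. a * f x + b * g x) q = a * P t f q + b * P t g q)) \<and>
     (\<forall>t\<ge>0. \<exists>M. \<forall>f c. continuous_on (sphere 0 1) f \<longrightarrow> (\<forall>q\<in>sphere 0 1. \<bar>f q\<bar> \<le> c) \<longrightarrow>
        (\<forall>q\<in>sphere 0 1. \<bar>P t f q\<bar> \<le> M * c)) \<and>
     (\<forall>f. continuous_on (sphere 0 1) f \<longrightarrow> (\<forall>q\<in>sphere 0 1. P 0 f q = f q)) \<and>
     (\<forall>s\<ge>0. \<forall>t\<ge>0. \<forall>f. continuous_on (sphere 0 1) f \<longrightarrow>
        (\<forall>q\<in>sphere 0 1. P (s + t) f q = P s (P t f) q)) \<and>
     (\<forall>f. continuous_on (sphere 0 1) f \<longrightarrow>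
        uniform_limit (sphere 0 1) (\<lambda>t. P t f) f (at_right 0)) \<and>
     (\<forall>f. smooth_on_sphere f \<longrightarrow>
        uniform_limit (sphere 0 1) (\<lambda>t q. (P t f q - f q) / t) (sub_Laplacian f) (at_right 0))"

text \<open>The heat kernel issued from the north pole; continuity selects the version that can be evaluated
  pointwise.\<close>

definition subelliptic_heat_kernel :: "(real \<Rightarrow> 'n::finite qspace \<Rightarrow> real) \<Rightarrow> bool" where
  "subelliptic_heat_kernel p \<longleftrightarrow>
     (\<exists>P. heat_semigroup P \<and>
       (\<forall>t>0. continuous_on (sphere 0 1) (p t) \<and>
         (\<forall>f. continuous_on (sphere 0 1) f \<longrightarrow>
            P t f north_pole = (LINT q:sphere 0 1|sphere_volume. p t q * f q))))"

text \<open>Coordinates of a point constrain only its last component \<open>q\<^bsub>n+1\<^esub>\<close>, which is nonzero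
  because \<open>r < pi / 2\<close>.\<close>

definition has_cylindric_coords :: "'n::finite qspace \<Rightarrow> real \<Rightarrow> real \<Rightarrow> bool" where
  "has_cylindric_coords q r \<eta> \<longleftrightarrow>
     q \<in> sphere 0 1 \<and> 0 \<le> r \<and> r < pi / 2 \<and> 0 \<le> \<eta> \<and> \<eta> \<le> pi \<and>
     norm (snd q) = cos r \<and> qRe (snd q) = cos r * cos \<eta>"

section \<open>The ingredients of the series\<close>

text \<open>The Jacobi polynomial given by Rodrigues' formula, as an exact quotient of polynomials so that
  it also makes sense at \<open>x = 1\<close> and \<open>x = -1\<close>; \<open>poly_jacobi\<close> is the formula itself.\<close>

definition jacobi :: "nat \<Rightarrow> nat \<Rightarrow> nat \<Rightarrow> real poly" where
  "jacobi a b k =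
     smult ((- 1) ^ k / (2 ^ k * fact k))
       ((pderiv ^^ k) ([:1, - 1:] ^ (a + k) * [:1, 1:] ^ (b + k)) div ([:1, - 1:] ^ a * [:1, 1:] ^ b))"

lemma pderiv_jacobi_weight:
  "\<exists>Q. (pderiv ^^ j) ([:1, - 1:] ^ (a + j) * [:1, 1::real:] ^ (b + j)) = [:1, - 1:] ^ a * [:1, 1:] ^ b * Q"
proof -
  have step: "\<exists>Q'. pderiv ([:1, - 1:] ^ Suc c * [:1, 1::real:] ^ Suc d * Q)
       = [:1, - 1:] ^ c * [:1, 1:] ^ d * Q'" for c d Q
  proof -
    let ?A = "[:1, - 1::real:]" and ?B = "[:1, 1::real:]"
    have A: "pderiv (?A ^ Suc c) = ?A ^ c * smult (of_nat (Suc c)) [:- 1:]"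
      by (subst pderiv_power_Suc) (simp add: pderiv_pCons)
    have B: "pderiv (?B ^ Suc d) = ?B ^ d * smult (of_nat (Suc d)) [:1:]"
      by (subst pderiv_power_Suc) (simp add: pderiv_pCons)
    have "pderiv (?A ^ Suc c * ?B ^ Suc d * Q) = ?A ^ c * ?B ^ d *
       (?A * ?B * pderiv Q + (?A * smult (of_nat (Suc d)) [:1:] + ?B * smult (of_nat (Suc c)) [:- 1:]) * Q)"
      unfolding pderiv_mult
      unfolding A B
      unfolding power_Suc
      by (simp only: ac_simps distrib_left distrib_right)
    then show ?thesis by blast
  qed
  have "i \<le> j \<Longrightarrow> \<exists>Q. (pderiv ^^ i) ([:1, - 1:] ^ (a + j) * [:1, 1::real:] ^ (b + j))
       = [:1, - 1:] ^ (a + (j - i)) * [:1, 1:] ^ (b + (j - i)) * Q" for i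
  proof (induction i)
    case 0
    show ?case by (rule exI[of _ 1]) simp
  next
    case (Suc i)
    then obtain Q where Q: "(pderiv ^^ i) ([:1, - 1:] ^ (a + j) * [:1, 1::real:] ^ (b + j))
       = [:1, - 1:] ^ (a + (j - i)) * [:1, 1:] ^ (b + (j - i)) * Q" by auto
    have "a + (j - i) = Suc (a + (j - Suc i))" "b + (j - i) = Suc (b + (j - Suc i))"
      using Suc.prems by auto
    with Q step[of "a + (j - Suc i)" "b + (j - Suc i)" Q] show ?case
      by (simp only: funpow.simps o_apply)
  qed
  from this[of j] show ?thesis by simp
qed

lemma deriv_funpow_poly: "(deriv ^^ k) (poly p) = poly ((pderiv ^^ k) p)" for p :: "real poly"
proof (induction k)
  case (Suc k)
  have "deriv (poly q) = poly (pderiv q)" for q :: "real poly"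
    by (rule ext) (simp add: DERIV_imp_deriv)
  then show ?case using Suc by simp
qed simp

lemma poly_jacobi:
  assumes "x \<noteq> 1" "x \<noteq> - 1"
  shows "poly (jacobi a b k) x =
    (- 1) ^ k / (2 ^ k * fact k * (1 - x) ^ a * (1 + x) ^ b) *
    (deriv ^^ k) (\<lambda>x. (1 - x) ^ (a + k) * (1 + x) ^ (b + k)) x"
proof -
  define D where "D = [:1, - 1:] ^ a * [:1, 1::real:] ^ b"
  define N where "N = (pderiv ^^ k) ([:1, - 1:] ^ (a + k) * [:1, 1::real:] ^ (b + k))"
  obtain Q where Q: "N = D * Q"
    using pderiv_jacobi_weight[of k a b] unfolding D_def N_def by blast
  have "D \<noteq> 0" unfolding D_def by simp
  then have "N div D = Q" using Q by simp
  then have j: "jacobi a b k = smult ((- 1) ^ k / (2 ^ k * fact k)) Q"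
    unfolding jacobi_def D_def N_def by simp
  have D: "poly D x = (1 - x) ^ a * (1 + x) ^ b" by (simp add: D_def poly_power)
  have "(\<lambda>x::real. (1 - x) ^ (a + k) * (1 + x) ^ (b + k))
      = poly ([:1, - 1:] ^ (a + k) * [:1, 1:] ^ (b + k))"
    by (rule ext) (simp add: poly_power)
  then have "(deriv ^^ k) (\<lambda>x. (1 - x) ^ (a + k) * (1 + x) ^ (b + k)) x = poly N x"
    by (simp only: deriv_funpow_poly N_def)
  also have "\<dots> = (1 - x) ^ a * (1 + x) ^ b * poly Q x" by (simp add: Q D)
  finally show ?thesis using assms by (simp add: j add_eq_0_iff)
qed

definition sin_quotient :: "nat \<Rightarrow> real \<Rightarrow> real" where
  "sin_quotient m \<eta> =
     (if sin \<eta> = 0 then Lim (at \<eta>) (\<lambda>x. sin (real (m + 1) * x) / sin x)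
      else sin (real (m + 1) * \<eta>) / sin \<eta>)"

definition alpha :: "nat \<Rightarrow> nat \<Rightarrow> nat \<Rightarrow> real" where
  "alpha n k m =
     Gamma (real (2 * n)) / (2 * pi ^ (2 * n + 2)) * real (2 * k + m + 2 * n + 1) * real (m + 1)
       * real ((k + m + 2 * n) choose (2 * n - 1))"

definition heat_term :: "nat \<Rightarrow> real \<Rightarrow> real \<Rightarrow> real \<Rightarrow> nat \<Rightarrow> nat \<Rightarrow> real" where
  "heat_term n t r \<eta> m k =
     alpha n k m * exp (- 4 * real (k * (k + 2 * n + m + 1) + n * m) * t) * sin_quotient m \<eta>
       * cos r ^ m * poly (jacobi (2 * n - 1) (m + 1) k) (cos (2 * r))"

end

theory Submission
  imports Defs "HOL-Probability.Distributions"
begin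

text \<open>The kernel is compared with the series through the eigenfunctions of \<open>L\<close> that are zonal about a
  point \<open>b\<close> of the sphere. Let \<open>u\<close> and \<open>v\<close> be the real part and the squared norm of the quaternionic
  Hermitian product of \<open>q\<close> and \<open>b\<close>. With the homogenised Chebyshev polynomials \<open>Z\<^sub>m(u, v)\<close>, for which
  \<open>Z\<^sub>m(c cos \<eta>, c\<^sup>2) = c\<^sup>m sin((m+1)\<eta>) / sin \<eta>\<close>, the function
  \<open>Z\<^sub>m(u, v) P\<^sub>k(2 v - 1)\<close> is an eigenfunction of \<open>L\<close> by the Jacobi differential equation. The semigroup
  multiplies it by the exponential of its eigenvalue, so its integral against \<open>p\<^sub>t\<close> is known.
  This value depends on \<open>b\<close> only through the coordinates of \<open>b\<close>, whence \<open>p\<^sub>t\<close> itself is a function of these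
  coordinates. The eigenfunctions that are zonal about the north pole are orthogonal and span all polynomials
  in \<open>(u, v)\<close>; their norms show that \<open>p\<^sub>t\<close> and the series have the same integrals against all of
  them, and hence coincide. Integrals over the sphere are reduced to Gaussian integrals.\<close>

text \<open>The axioms of the semigroup contain no invariance under isometries and the kernel is
  only assumed continuous, so it has to be proved that \<open>p t\<close> is a function of (r,
  \<eta>). Eigenfunctions zonal about the north pole cannot show this: their integrals see only
  averages of \<open>p t\<close> over the sets of constant (u, v). This forces the detour over an
  arbitrary point b, at which polynomials in u can concentrate, and over the symmetry of the zonal
  functions in q and b. The generator is described on smooth functions only and no bound uniform in
  time is given, so the exponential law for eigenfunctions rests on a uniform boundedness argument
  near time 0. The volume element in cylindric coordinates is bypassed: a Gaussian factorises over
  the two components of q, a sphere does not, and the ratio of two radial moments reproduces the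
  beta integral of the Jacobi weight. The number \<open>alpha n k m\<close> is the value of the
  eigenfunction at the north pole divided by its squared norm. In m the terms decay only
  exponentially, which is why the coefficient estimates have an adjustable rate.\<close>

abbreviation (input) continuous_sphere :: "('a::real_normed_vector \<Rightarrow> real) \<Rightarrow> bool" where
  "continuous_sphere \<equiv> continuous_on (sphere 0 1)"

section \<open>Jacobi polynomials\<close>

lemma higher_pderiv_mult:
  fixes p q :: "'a::idom poly"
  shows "(pderiv ^^ k) (p * q) =
    (\<Sum>i\<le>k. of_nat (k choose i) * ((pderiv ^^ i) p * (pderiv ^^ (k - i)) q))"
proof (induction k)
  case 0
  show ?case by simp
next
  case (Suc k)
  define P where "P i = (pderiv ^^ i) p" for i
  define Q where "Q i = (pderiv ^^ i) q" for i
  have P': "pderiv (P i) = P (Suc i)" for i by (simp add: P_def)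
  have Q': "pderiv (Q i) = Q (Suc i)" for i by (simp add: Q_def)
  have der: "pderiv (\<Sum>i\<in>A. f i) = (\<Sum>i\<in>A. pderiv (f i))" if "finite A" for f :: "nat \<Rightarrow> 'a poly" and A
    using higher_pderiv_sum[of 1 f A] by simp
  have cst: "pderiv (of_nat c * F) = of_nat c * pderiv F" for c and F :: "'a poly"
    by (simp add: pderiv_mult)
  have "(pderiv ^^ Suc k) (p * q) = pderiv (\<Sum>i\<le>k. of_nat (k choose i) * (P i * Q (k - i)))"
    using Suc by (simp add: P_def Q_def)
  also have "\<dots> = (\<Sum>i\<le>k. of_nat (k choose i) * (P (Suc i) * Q (k - i)))
      + (\<Sum>i\<le>k. of_nat (k choose i) * (P i * Q (Suc (k - i))))"
    by (simp add: der cst pderiv_mult P' Q' algebra_simps sum.distrib)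
  also have "(\<Sum>i\<le>k. of_nat (k choose i) * (P (Suc i) * Q (k - i)))
      = (\<Sum>i\<in>{1..Suc k}. of_nat (k choose (i - 1)) * (P i * Q (Suc k - i)))"
    by (rule sum.reindex_bij_witness[of _ "\<lambda>i. i - 1" Suc]) auto
  also have "\<dots> = (\<Sum>i\<le>Suc k. (if i = 0 then 0 else of_nat (k choose (i - 1))) * (P i * Q (Suc k - i)))"
    by (rule sum.mono_neutral_cong_left) auto
  also have "(\<Sum>i\<le>k. of_nat (k choose i) * (P i * Q (Suc (k - i))))
      = (\<Sum>i\<le>Suc k. of_nat (k choose i) * (P i * Q (Suc k - i)))"
    by (simp add: Suc_diff_le binomial_eq_0)
  also have "(\<Sum>i\<le>Suc k. (if i = 0 then 0 else of_nat (k choose (i - 1))) * (P i * Q (Suc k - i)))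
      + (\<Sum>i\<le>Suc k. of_nat (k choose i) * (P i * Q (Suc k - i)))
      = (\<Sum>i\<le>Suc k. of_nat (Suc k choose i) * (P i * Q (Suc k - i)))"
    unfolding sum.distrib[symmetric]
  proof (rule sum.cong[OF refl])
    fix i
    show "(if i = 0 then 0 else of_nat (k choose (i - 1))) * (P i * Q (Suc k - i)) +
       of_nat (k choose i) * (P i * Q (Suc k - i)) = of_nat (Suc k choose i) * (P i * Q (Suc k - i))"
      by (cases i) (simp_all add: algebra_simps)
  qed
  finally show ?case by (simp add: P_def Q_def)
qed

lemma pderiv_linear_power_Suc:
  fixes c d :: real
  shows "pderiv ([:c, d:] ^ Suc j) = smult (real (Suc j) * d) ([:c, d:] ^ j)"
proof -
  have "pderiv [:c, d:] = smult d 1" by (simp add: pderiv_pCons)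
  then show ?thesis unfolding pderiv_power_Suc by (simp add: mult.commute del: of_nat_Suc)
qed

lemma higher_pderiv_linear_power:
  fixes c d :: real
  assumes "i \<le> n"
  shows "(pderiv ^^ i) ([:c, d:] ^ n) = smult (d ^ i * fact n / fact (n - i)) ([:c, d:] ^ (n - i))"
  using assms
proof (induction i)
  case (Suc i)
  then obtain j where j: "n - i = Suc j" "n - Suc i = j" by (metis Suc_diff_Suc Suc_le_lessD)
  have "(pderiv ^^ Suc i) ([:c, d:] ^ n) = smult (d ^ i * fact n / fact (Suc j)) (pderiv ([:c, d:] ^ Suc j))"
    using Suc j by (simp add: pderiv_smult del: power_Suc fact_Suc)
  also have "\<dots> = smult (d ^ Suc i * fact n / fact j) ([:c, d:] ^ j)"
    unfolding pderiv_linear_power_Suc smult_smult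
    by (rule arg_cong[where f = "\<lambda>z. smult z _"]) (simp add: field_simps del: of_nat_Suc)
  finally show ?case unfolding j .
qed simp

abbreviation (input) "omx \<equiv> [:1, - 1::real:]"
abbreviation (input) "opx \<equiv> [:1, 1::real:]"

text \<open>Clears the division in the definition of \<open>jacobi\<close>. Later facts become
  identities of polynomials in which the nonzero weight is cancelled.\<close>

lemma jacobi_rodrigues:
  "(pderiv ^^ k) (omx ^ (a + k) * opx ^ (b + k)) = smult ((- 1) ^ k * 2 ^ k * fact k) (omx ^ a * opx ^ b * jacobi a b k)"
proof -
  obtain Q where Q: "(pderiv ^^ k) (omx ^ (a + k) * opx ^ (b + k)) = omx ^ a * opx ^ b * Q"
    using pderiv_jacobi_weight[of k a b] by blast
  then have "jacobi a b k = smult ((- 1) ^ k / (2 ^ k * fact k)) Q"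
    unfolding jacobi_def by simp
  then show ?thesis using Q by (simp flip: power_mult_distrib)
qed

abbreviation (input) jcoeff :: "nat \<Rightarrow> nat \<Rightarrow> nat \<Rightarrow> nat \<Rightarrow> real" where
  "jcoeff a b k s \<equiv> real ((a + k) choose s) * real ((b + k) choose (k - s))"

text \<open>Leibniz' rule for the two linear powers in Rodrigues' formula. The binomial coefficient
  of Leibniz' rule times the two quotients of factorials is k! times \<open>jcoeff\<close>, and k!
  is the normalising factor.\<close>

lemma jacobi_explicit:
  "jacobi a b k = (\<Sum>s\<le>k. smult ((- 1) ^ (k - s) / 2 ^ k * jcoeff a b k s)
      (omx ^ (k - s) * opx ^ s))" (is "_ = ?R")
proof -
  have "(pderiv ^^ k) (omx ^ (a + k) * opx ^ (b + k))
     = smult ((- 1) ^ k * 2 ^ k * fact k) (omx ^ a * opx ^ b * ?R)"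
  proof -
    have "of_nat (k choose i) * ((pderiv ^^ i) (omx ^ (a + k)) * (pderiv ^^ (k - i)) (opx ^ (b + k)))
       = smult ((- 1) ^ k * 2 ^ k * fact k) (omx ^ a * opx ^ b *
          smult ((- 1) ^ (k - i) / 2 ^ k * real ((a + k) choose i) * real ((b + k) choose (k - i)))
          (omx ^ (k - i) * opx ^ i))" if "i \<le> k" for i
    proof -
      have c1: "a + k - i = a + (k - i)" "b + k - (k - i) = b + i" using that by auto
      have b1: "real (k choose i) = fact k / (fact i * fact (k - i))"
        using that by (rule binomial_fact)
      have b2: "real ((a + k) choose i) = fact (a + k) / (fact i * fact (a + (k - i)))"
        using that c1 by (subst binomial_fact) auto
      have b3: "real ((b + k) choose (k - i)) = fact (b + k) / (fact (k - i) * fact (b + i))"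
        using that c1 by (subst binomial_fact) auto
      obtain d where d: "k = i + d" using \<open>i \<le> k\<close> by (metis le_Suc_ex)
      have sg: "(- 1::real) ^ k * (- 1) ^ (k - i) = (- 1) ^ i"
        unfolding d by (simp add: minus_one_power_iff)
      have of_nat_smult: "of_nat c * F = smult (real c) F" for c and F :: "real poly"
        by (simp add: of_nat_poly)
      have "of_nat (k choose i) * ((pderiv ^^ i) (omx ^ (a + k)) * (pderiv ^^ (k - i)) (opx ^ (b + k)))
        = smult (real (k choose i) * ((- 1) ^ i * fact (a + k) / fact (a + (k - i))) * (fact (b + k) / fact (b + i)))
           (omx ^ (a + (k - i)) * opx ^ (b + i))"
      proof -
        have i: "i \<le> a + k" "k - i \<le> b + k" using that by auto
        show ?thesis
          unfolding of_nat_smult higher_pderiv_linear_power[OF i(1)] higher_pderiv_linear_power[OF i(2)] c1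
            mult_smult_left mult_smult_right smult_smult
          by (rule arg_cong[where f = "\<lambda>z. smult z _"]) (simp add: mult_ac)
      qed
      also have "real (k choose i) * ((- 1) ^ i * fact (a + k) / fact (a + (k - i))) * (fact (b + k) / fact (b + i))
        = ((- 1) ^ k * 2 ^ k * fact k) * ((- 1) ^ (k - i) / 2 ^ k * real ((a + k) choose i) * real ((b + k) choose (k - i)))"
      proof -
        \<comment> \<open>Factorials and powers are replaced by real variables, so that only field
          arithmetic is left.\<close>
        have *: "fk / (fi * fd) * (s * fa / fa') * (fb / fb') = (t * p * fk) * (u / p * (fa / (fi * fa')) * (fb / (fd * fb')))"
          if "p \<noteq> 0" "s = t * u" for fk fi fd s fa fa' fb fb' t p u :: real
          using that by (simp add: mult_ac)
        show ?thesis unfolding b1 b2 b3 by (rule *) (use sg in simp_all)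
      qed
      finally show ?thesis by (simp add: power_add mult_ac)
    qed
    moreover have "smult c (sum f A) = (\<Sum>i\<in>A. smult c (f i))" for c :: real and f and A :: "nat set"
      by (induction A rule: infinite_finite_induct) (auto simp: smult_add_right)
    ultimately show ?thesis unfolding higher_pderiv_mult sum_distrib_left by simp
  qed
  with jacobi_rodrigues[of k a b] have "omx ^ a * opx ^ b * jacobi a b k = omx ^ a * opx ^ b * ?R"
    by (simp only: smult_cancel) (simp add: smult_eq_iff)
  then show ?thesis by (subst (asm) mult_cancel_left) simp
qed

text \<open>The argument 2 v - 1 is cos 2r for v = cos^2 r. In the variable v the powers of 2
  disappear and all coefficients are nonnegative integers.\<close>

lemma poly_jacobi_explicit:
  "poly (jacobi a b k) (2 * v - 1) = (\<Sum>s\<le>k. jcoeff a b k s * ((v - 1) ^ (k - s) * v ^ s))"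
proof -
  have *: "(- 1) ^ (k - s) / 2 ^ k * ((2 - 2 * v) ^ (k - s) * (2 * v) ^ s) = (v - 1) ^ (k - s) * v ^ s" if "s \<le> k" for s
  proof -
    have "(2 - 2 * v) ^ (k - s) = (2 * (-1) * (v - 1)) ^ (k - s)" by simp
    also have "\<dots> = 2 ^ (k - s) * (-1) ^ (k - s) * (v - 1) ^ (k - s)"
      unfolding power_mult_distrib ..
    finally have 1: "(2 - 2 * v) ^ (k - s) = 2 ^ (k - s) * (-1) ^ (k - s) * (v - 1) ^ (k - s)" .
    have 2: "(2::real) ^ k = 2 ^ (k - s) * 2 ^ s" using that by (simp flip: power_add)
    show ?thesis unfolding 1 2 by (simp add: power_mult_distrib)
  qed
  have "poly (smult ((- 1) ^ (k - s) / 2 ^ k * jcoeff a b k s)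
      (omx ^ (k - s) * opx ^ s)) (2 * v - 1) = jcoeff a b k s *
      ((- 1) ^ (k - s) / 2 ^ k * ((2 - 2 * v) ^ (k - s) * (2 * v) ^ s))" for s
    by (simp add: poly_power)
  then show ?thesis
    unfolding jacobi_explicit poly_sum by (intro sum.cong) (simp_all only: * atMost_iff)
qed

lemma vandermonde_jacobi: "(\<Sum>s\<le>k. ((a + k) choose s) * ((b + k) choose (k - s))) = (2 * k + a + b) choose k"
proof -
  have "a + k + (b + k) = 2 * k + a + b" by simp
  then show ?thesis using vandermonde[of "a + k" "b + k" k] by (simp only:)
qed

text \<open>Each product of powers is at most 1 in absolute value, and Vandermonde's identity sums
  the coefficients. The exponential growth in k is harmless against the factor exp(-4 k^2 t) of the
  series.\<close>

lemma abs_poly_jacobi_le: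
  assumes "0 \<le> v" "v \<le> 1"
  shows "\<bar>poly (jacobi a b k) (2 * v - 1)\<bar> \<le> real ((2 * k + a + b) choose k)"
proof -
  have "\<bar>poly (jacobi a b k) (2 * v - 1)\<bar> \<le> (\<Sum>s\<le>k. jcoeff a b k s)"
    unfolding poly_jacobi_explicit
  proof (rule order.trans[OF sum_abs], rule sum_mono)
    fix s
    have "\<bar>(v - 1) ^ (k - s) * v ^ s\<bar> \<le> 1"
      using assms by (simp add: abs_mult power_abs mult_le_one power_le_one)
    then show "\<bar>jcoeff a b k s * ((v - 1) ^ (k - s) * v ^ s)\<bar>
       \<le> jcoeff a b k s"
      by (simp add: abs_mult mult_left_le)
  qed
  also have "\<dots> = real ((2 * k + a + b) choose k)"
    unfolding vandermonde_jacobi[symmetric] by simp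
  finally show ?thesis .
qed

lemma poly_jacobi_one: "poly (jacobi a b k) 1 = real ((a + k) choose k)"
proof -
  have "poly (jacobi a b k) (2 * 1 - 1) = (\<Sum>s\<in>{k}. jcoeff a b k s * ((1 - 1) ^ (k - s) * 1 ^ s))"
    unfolding poly_jacobi_explicit by (rule sum.mono_neutral_right) auto
  then show ?thesis by simp
qed

lemma degree_omx_opx: "degree (omx ^ i * opx ^ j) = i + j"
  by (simp add: degree_mult_eq degree_power_eq)

lemma degree_jacobi_le: "degree (jacobi a b k) \<le> k"
  unfolding jacobi_explicit
  by (rule degree_sum_le) (auto simp: degree_omx_opx)

text \<open>The sign of the top coefficient of each product cancels the sign in front of it, so
  Vandermonde's sum appears again. That the value is nonzero makes these polynomials a basis; the
  value itself enters their norm.\<close>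

lemma coeff_jacobi: "coeff (jacobi a b k) k = real ((2 * k + a + b) choose k) / 2 ^ k"
proof -
  have lc: "coeff (omx ^ (k - s) * opx ^ s) k = (- 1) ^ (k - s)" if "s \<le> k" for s
    using that lead_coeff_mult[of "omx ^ (k - s)" "opx ^ s"] degree_omx_opx[of "k - s" s]
    by (simp add: lead_coeff_power)
  have "coeff (jacobi a b k) k = (\<Sum>s\<le>k. jcoeff a b k s / 2 ^ k)"
    unfolding jacobi_explicit coeff_sum
    by (intro sum.cong) (auto simp: lc simp flip: power_mult_distrib)
  also have "\<dots> = real ((2 * k + a + b) choose k) / 2 ^ k"
    unfolding vandermonde_jacobi[symmetric] by (simp add: sum_divide_distrib)
  finally show ?thesis .
qed

text \<open>The function W = (1 - x)^(a+k) (1 + x)^(b+k) satisfies a first-order equation with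
  coefficients of degree at most 2. Differentiating it k + 1 times gives a second-order equation for
  D, the k-th derivative of W. By Rodrigues' formula D is a constant times w y, and the first-order
  equation of w turns this into the equation of y.\<close>

lemma jacobi_ode:
  "omx * opx * pderiv (pderiv (jacobi a b k)) + [:real b - real a, - (real a + real b + 2):] * pderiv (jacobi a b k)
     + smult (real (k * (k + a + b + 1))) (jacobi a b k) = 0"
proof -
  define W where "W = omx ^ (a + k) * opx ^ (b + k)"
  define D where "D = (pderiv ^^ k) W"
  define w where "w = omx ^ a * opx ^ b"
  define y where "y = jacobi a b k"
  define X where "X = [:0, 1::real:]"
  \<comment> \<open>\<open>mu c d\<close> is 1 - x^2 times the logarithmic derivative of (1 - x)^c
    (1 + x)^d.\<close>
  define mu where "mu c d = smult d omx - smult c opx" for c d :: real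
  have weight: "omx * opx * pderiv (omx ^ c * opx ^ d) = mu (real c) (real d) * (omx ^ c * opx ^ d)" for c d
  proof -
    have 1: "omx * pderiv (omx ^ c) = smult (- real c) (omx ^ c)"
      by (cases c) (simp_all add: pderiv_linear_power_Suc del: power_Suc of_nat_Suc, simp_all)
    have 2: "opx * pderiv (opx ^ d) = smult (real d) (opx ^ d)"
      by (cases d) (simp_all add: pderiv_linear_power_Suc del: power_Suc of_nat_Suc, simp_all)
    have "omx * opx * pderiv (omx ^ c * opx ^ d)
      = omx * (omx ^ c) * (opx * pderiv (opx ^ d)) + opx * (opx ^ d) * (omx * pderiv (omx ^ c))"
      unfolding pderiv_mult by (simp only: distrib_left mult_ac)
    also have "\<dots> = smult (real d) (omx * (omx ^ c * opx ^ d)) - smult (real c) (opx * (omx ^ c * opx ^ d))"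
      unfolding 1 2 by (simp only: mult_smult_right mult_ac smult_minus_left mult_minus_right diff_conv_add_uminus)
    also have "\<dots> = mu (real c) (real d) * (omx ^ c * opx ^ d)"
      unfolding mu_def by (simp only: left_diff_distrib mult_smult_left)
    finally show ?thesis .
  qed
  have pm: "pderiv (mu c d) = [:- (c + d):]" for c d
    by (simp add: mu_def pderiv_diff pderiv_smult pderiv_pCons)
  \<comment> \<open>Leibniz' rule stops after two terms because \<open>mu c d\<close> is linear. At
    j = 0 the truncated index \<open>j - 1\<close> is harmless, its coefficient being 0.\<close>
  have L1: "(pderiv ^^ j) (mu c d * F) = mu c d * (pderiv ^^ j) F - smult (real j * (c + d)) ((pderiv ^^ (j - 1)) F)" for j c d F
  proof (induction j)
    case (Suc j)
    have 1: "smult (real j * (c + d)) (pderiv ((pderiv ^^ (j - 1)) F)) = smult (real j * (c + d)) ((pderiv ^^ j) F)"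
      by (cases j) simp_all
    have "(pderiv ^^ Suc j) (mu c d * F) = pderiv (mu c d * (pderiv ^^ j) F - smult (real j * (c + d)) ((pderiv ^^ (j - 1)) F))"
      using Suc by simp
    also have "\<dots> = mu c d * (pderiv ^^ Suc j) F + (pderiv ^^ j) F * [:- (c + d):] - smult (real j * (c + d)) ((pderiv ^^ j) F)"
      by (simp only: pderiv_diff pderiv_mult pderiv_smult pm 1 funpow.simps o_apply)
    also have "\<dots> = mu c d * (pderiv ^^ Suc j) F - smult (real (Suc j) * (c + d)) ((pderiv ^^ (Suc j - 1)) F)"
      by (rule iffD1[OF poly_eq_poly_eq_iff], rule ext) (simp add: algebra_simps)
    finally show ?case .
  qed simp
  have ab: "omx * opx = 1 - X * X" by (simp add: X_def one_pCons)
  have pX: "pderiv X = 1" by (simp add: X_def pderiv_pCons one_pCons)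
  have L2: "(pderiv ^^ Suc j) ((1 - X * X) * pderiv F) = (1 - X * X) * (pderiv ^^ (j + 2)) F
      - smult (2 * real (Suc j)) (X * (pderiv ^^ Suc j) F) - smult (real (Suc j * j)) ((pderiv ^^ j) F)" for j F
  proof (induction j)
    case 0
    show ?case
      by (rule iffD1[OF poly_eq_poly_eq_iff], rule ext) (simp add: pderiv_mult pderiv_diff pX algebra_simps)
  next
    case (Suc j)
    have E: "(pderiv ^^ Suc (Suc j)) ((1 - X * X) * pderiv F) = pderiv ((pderiv ^^ Suc j) ((1 - X * X) * pderiv F))"
      by simp
    show ?case unfolding E Suc
      by (intro iffD1[OF poly_eq_poly_eq_iff] ext)
         (simp add: pderiv_mult pderiv_diff pderiv_add pderiv_smult pX algebra_simps)
  qed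
  have DW: "D = smult ((- 1) ^ k * 2 ^ k * fact k) (w * y)"
    unfolding D_def W_def w_def y_def by (rule jacobi_rodrigues)
  define c where "c = ((- 1) ^ k * 2 ^ k * fact k :: real)"
  have c0: "c \<noteq> 0" by (simp add: c_def)
  have E: "(1 - X * X) * pderiv (pderiv D) - smult (2 * real (Suc k)) (X * pderiv D) - smult (real (Suc k * k)) D
     = mu (real (a + k)) (real (b + k)) * pderiv D - smult (real (Suc k) * (real (a + k) + real (b + k))) D"
    using arg_cong[OF weight[of "a + k" "b + k"], of "pderiv ^^ Suc k"]
    unfolding W_def[symmetric] ab L2 L1 by (simp add: D_def)
  have ww: "(1 - X * X) * pderiv w = mu (real a) (real b) * w"
    using weight[of a b] unfolding w_def ab .
  have DD: "D = smult c (w * y)" using DW c_def by simp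
  define w' where "w' = pderiv w"
  define w'' where "w'' = pderiv w'"
  have ww2: "(1 - X * X) * w'' - 2 * X * w' = mu (real a) (real b) * w' + smult (- (real a + real b)) w"
    using arg_cong[OF ww, of pderiv]
    by (simp add: pderiv_mult pderiv_diff pX pm w'_def w''_def algebra_simps)
  have w0: "w \<noteq> 0" unfolding w_def by simp
  have ab0: "1 - X * X \<noteq> 0" unfolding ab[symmetric] by simp
  define R where "R = (1 - X * X) * pderiv (pderiv y) + [:real b - real a, - (real a + real b + 2):] * pderiv y
     + smult (real (k * (k + a + b + 1))) y"
  \<comment> \<open>The extra factor (1 - x^2) w allows the derivatives of w to be eliminated
    without division. Both factors are nonzero polynomials and are cancelled afterwards.\<close>
  have E': "poly ((1 - X * X) * w * R) x = 0" for x
  proof -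
    define Y0 Y1 Y2 where "Y0 = poly y x" and "Y1 = poly (pderiv y) x" and "Y2 = poly (pderiv (pderiv y)) x"
    define V0 V1 V2 where "V0 = poly w x" and "V1 = poly w' x" and "V2 = poly w'' x"
    define A B K where "A = real a" and "B = real b" and "K = real k"
    have mu': "poly (mu c d) x = d * (1 - x) - c * (1 + x)" for c d by (simp add: mu_def algebra_simps)
    have e1: "(1 - x * x) * V1 = (B * (1 - x) - A * (1 + x)) * V0"
      using arg_cong[OF ww, of "\<lambda>p. poly p x"] by (simp add: mu' V0_def V1_def w'_def X_def A_def B_def)
    have e2: "(1 - x * x) * V2 - 2 * x * V1 = (B * (1 - x) - A * (1 + x)) * V1 - (A + B) * V0"
      using arg_cong[OF ww2, of "\<lambda>p. poly p x"] by (simp add: mu' V0_def V1_def V2_def X_def A_def B_def algebra_simps)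
    have d0: "poly D x = c * (V0 * Y0)" by (simp add: DD V0_def Y0_def)
    have d1: "poly (pderiv D) x = c * (V1 * Y0 + V0 * Y1)"
      by (simp add: DD pderiv_smult pderiv_mult V0_def V1_def Y0_def Y1_def w'_def algebra_simps)
    have d2: "poly (pderiv (pderiv D)) x = c * (V2 * Y0 + 2 * V1 * Y1 + V0 * Y2)"
      by (simp add: DD pderiv_smult pderiv_mult pderiv_add V0_def V1_def V2_def Y0_def Y1_def Y2_def w'_def w''_def algebra_simps)
    have "c * ((1 - x * x) * (V2 * Y0 + 2 * V1 * Y1 + V0 * Y2) - 2 * (K + 1) * x * (V1 * Y0 + V0 * Y1) - (K + 1) * K * (V0 * Y0))
       = c * (((B + K) * (1 - x) - (A + K) * (1 + x)) * (V1 * Y0 + V0 * Y1) - (K + 1) * (A + B + 2 * K) * (V0 * Y0))"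
      using arg_cong[OF E, of "\<lambda>p. poly p x"]
      by (simp add: d0 d1 d2 mu' X_def A_def B_def K_def algebra_simps)
    then have e3: "(1 - x * x) * (V2 * Y0 + 2 * V1 * Y1 + V0 * Y2) - 2 * (K + 1) * x * (V1 * Y0 + V0 * Y1) - (K + 1) * K * (V0 * Y0)
       = ((B + K) * (1 - x) - (A + K) * (1 + x)) * (V1 * Y0 + V0 * Y1) - (K + 1) * (A + B + 2 * K) * (V0 * Y0)"
      unfolding mult_left_cancel[OF c0] .
    have "(1 - x * x) * V0 * ((1 - x * x) * Y2 + (B - A - (A + B + 2) * x) * Y1 + K * (K + A + B + 1) * Y0) = 0"
      using e1 e2 e3 by algebra
    then show ?thesis
      by (simp add: R_def X_def V0_def Y0_def Y1_def Y2_def A_def B_def K_def algebra_simps)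
  qed
  then have "(1 - X * X) * w * R = 0"
    using poly_all_0_iff_0 by blast
  with w0 ab0 have "R = 0" by simp
  then show ?thesis unfolding R_def ab y_def .
qed

section \<open>Orthogonality and norms of the Jacobi polynomials\<close>

definition poly_integral :: "real poly \<Rightarrow> real" where
  "poly_integral p = integral {- 1..1} (poly p)"

lemma poly_integral_add: "poly_integral (p + q) = poly_integral p + poly_integral q"
proof -
  have "poly (p + q) = (\<lambda>x. poly p x + poly q x)" by auto
  then show ?thesis
    unfolding poly_integral_def by (simp add: integral_add integrable_continuous_real continuous_on_poly)
qed

lemma poly_integral_smult: "poly_integral (smult c p) = c * poly_integral p"
proof -
  have "poly (smult c p) = (\<lambda>x. c * poly p x)" by auto
  then show ?thesis unfolding poly_integral_def by simp
qed

lemma poly_integral_pderiv: "poly_integral (pderiv p) = poly p 1 - poly p (- 1)"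
  unfolding poly_integral_def
  by (rule integral_unique, rule fundamental_theorem_of_calculus)
     (auto intro!: has_real_derivative_iff_has_vector_derivative[THEN iffD1] DERIV_subset[OF poly_DERIV])

text \<open>Euler's beta integral: integration by parts moves one factor 1 - x to 1 + x, and the
  boundary terms vanish because both exponents are positive there.\<close>

lemma poly_integral_beta:
  "poly_integral (omx ^ a * opx ^ b) = 2 ^ (a + b + 1) * fact a * fact b / fact (a + b + 1)"
proof (induction a arbitrary: b)
  case 0
  have "pderiv (smult (1 / real (Suc b)) (opx ^ Suc b)) = opx ^ b"
    by (simp add: pderiv_smult pderiv_power_Suc pderiv_pCons del: power_Suc)
  from poly_integral_pderiv[of "smult (1 / real (Suc b)) (opx ^ Suc b)", unfolded this]
  have "poly_integral (opx ^ b) = 2 ^ (b + 1) / real (Suc b)" by (simp add: poly_power)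
  then show ?case by (simp del: of_nat_Suc)
next
  case (Suc a)
  have "pderiv (omx ^ Suc a * opx ^ Suc b) =
     smult (real (Suc b)) (omx ^ Suc a * opx ^ b) + smult (- real (Suc a)) (omx ^ a * opx ^ Suc b)"
    unfolding pderiv_mult by (simp add: pderiv_power_Suc pderiv_pCons mult_ac del: power_Suc of_nat_Suc)
  from arg_cong[OF this, of poly_integral]
  have "real (Suc b) * poly_integral (omx ^ Suc a * opx ^ b) = real (Suc a) * poly_integral (omx ^ a * opx ^ Suc b)"
    unfolding poly_integral_pderiv poly_integral_add poly_integral_smult
    by (simp add: poly_power algebra_simps del: power_Suc of_nat_Suc)
  then have "poly_integral (omx ^ Suc a * opx ^ b) = real (Suc a) * poly_integral (omx ^ a * opx ^ Suc b) / real (Suc b)"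
    by (simp add: eq_divide_eq mult.commute del: power_Suc of_nat_Suc)
  also have "\<dots> = 2 ^ (Suc a + b + 1) * fact (Suc a) * fact b / fact (Suc a + b + 1)"
    unfolding Suc add_Suc add_Suc_right fact_Suc[of a] fact_Suc[of b]
    by (simp del: power_Suc of_nat_Suc fact_Suc)
  finally show ?case .
qed

text \<open>Rodrigues' formula and k integrations by parts. The derivatives of order below k keep a
  factor (1 - x) (1 + x), so no boundary terms arise. Orthogonality and norm are both read off from
  the right-hand side.\<close>

lemma jacobi_inner:
  "poly_integral (omx ^ a * opx ^ b * jacobi a b k * p)
     = poly_integral (omx ^ (a + k) * opx ^ (b + k) * (pderiv ^^ k) p) / (2 ^ k * fact k)"
proof -
  define W where "W = omx ^ (a + k) * opx ^ (b + k)"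
  have bdry: "poly ((pderiv ^^ j) W) x = 0" if "j < k" "x = 1 \<or> x = - 1" for j x
  proof -
    obtain Q where "(pderiv ^^ j) W = omx ^ (a + (k - j)) * opx ^ (b + (k - j)) * Q"
      using pderiv_jacobi_weight[of j "a + (k - j)" "b + (k - j)"] \<open>j < k\<close> unfolding W_def by auto
    then show ?thesis using that by (auto simp: poly_power power_0_left)
  qed
  have step: "poly_integral ((pderiv ^^ Suc j) W * q) = - poly_integral ((pderiv ^^ j) W * pderiv q)" if "j < k" for j q
  proof -
    have "poly_integral (pderiv ((pderiv ^^ j) W * q)) = 0"
      using that by (simp add: poly_integral_pderiv bdry)
    then show ?thesis by (simp add: pderiv_mult poly_integral_add mult.commute)
  qed
  have "j \<le> k \<Longrightarrow> poly_integral ((pderiv ^^ j) W * q) = (- 1) ^ j * poly_integral (W * (pderiv ^^ j) q)" for j q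
  proof (induction j arbitrary: q)
    case (Suc j)
    then show ?case using step[of j q] by (simp add: funpow_swap1)
  qed simp
  from this[of k p] have "poly_integral ((pderiv ^^ k) W * p) = (- 1) ^ k * poly_integral (W * (pderiv ^^ k) p)" by simp
  moreover have "(pderiv ^^ k) W * p = smult ((- 1) ^ k * 2 ^ k * fact k) (omx ^ a * opx ^ b * jacobi a b k * p)"
    unfolding W_def jacobi_rodrigues by simp
  ultimately show ?thesis by (simp add: poly_integral_smult W_def field_simps)
qed

lemma jacobi_orthogonal_lower:
  assumes "degree p < k"
  shows "poly_integral (omx ^ a * opx ^ b * jacobi a b k * p) = 0"
proof -
  have "(pderiv ^^ k) p = 0"
    by (rule poly_eqI) (use assms in \<open>simp add: coeff_higher_pderiv coeff_eq_0\<close>)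
  then show ?thesis unfolding jacobi_inner using poly_integral_smult[of 0 0] by simp
qed

lemma jacobi_orthogonal:
  assumes "k \<noteq> l"
  shows "poly_integral (omx ^ a * opx ^ b * jacobi a b k * jacobi a b l) = 0"
proof (cases "l < k")
  case True
  with degree_jacobi_le[of a b l] show ?thesis by (intro jacobi_orthogonal_lower) linarith
next
  case False
  with degree_jacobi_le[of a b k] assms jacobi_orthogonal_lower[of "jacobi a b k" l a b]
  show ?thesis by (simp add: mult_ac)
qed

text \<open>The k-th derivative of the polynomial is k! times its top coefficient, so a beta
  integral is all that remains.\<close>

lemma jacobi_norm:
  "poly_integral (omx ^ a * opx ^ b * jacobi a b k * jacobi a b k)
     = 2 ^ (a + b + 1) * fact (a + k) * fact (b + k) / (fact k * fact (k + a + b) * real (2 * k + a + b + 1))"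
proof -
  have "(pderiv ^^ k) (jacobi a b k) = [:fact k * (real ((2 * k + a + b) choose k) / 2 ^ k):]"
  proof (rule poly_eqI)
    fix i
    have "degree (jacobi a b k) < i + k" if "i \<noteq> 0" using degree_jacobi_le[of a b k] that by linarith
    then show "coeff ((pderiv ^^ k) (jacobi a b k)) i = coeff [:fact k * (real ((2 * k + a + b) choose k) / 2 ^ k):] i"
      by (cases i) (simp_all add: coeff_higher_pderiv coeff_jacobi coeff_eq_0 pochhammer_fact)
  qed
  moreover have "real ((2 * k + a + b) choose k) = fact (2 * k + a + b) / (fact k * fact (k + a + b))"
    by (subst binomial_fact) (auto simp: algebra_simps)
  moreover define S where "S = real (Suc (2 * k + a + b))"
  moreover have "(2::real) ^ Suc (2 * k + a + b) = 2 ^ (a + b + 1) * 2 ^ k * 2 ^ k"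
    unfolding power_add[symmetric] by (rule arg_cong[where f = "\<lambda>z. 2 ^ z"]) simp
  moreover have "X * [:c:] = smult c X" for X and c :: real by (simp add: mult.commute)
  moreover have "a + k + (b + k) + 1 = Suc (2 * k + a + b)" "real (2 * k + a + b + 1) = real (Suc (2 * k + a + b))" by simp_all
  moreover have "fk * (F / (fk * G) / p2) * (P * p2 * p2 * fa * fb / (S * F)) / (p2 * fk) = P * fa * fb / (fk * G * S)"
    if "fk \<noteq> 0" "F \<noteq> 0" "p2 \<noteq> 0" for fk F G p2 P fa fb S :: real
    using that by (simp add: mult_ac)
  moreover have "fact (Suc (2 * k + a + b)) = S * fact (2 * k + a + b)" by (simp add: S_def)
  ultimately show ?thesis
    unfolding jacobi_inner by (simp only: poly_integral_smult poly_integral_beta S_def[symmetric]) (simp add: mult_ac)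
qed

section \<open>Homogenised Chebyshev polynomials\<close>

text \<open>The recursion of the Chebyshev polynomials of the second kind, made homogeneous with u
  of weight 1 and v of weight 2. Being polynomial in u and v, it stays smooth where v = 0 and the
  angle is undefined.\<close>

fun hcheb :: "nat \<Rightarrow> real \<Rightarrow> real \<Rightarrow> real" where
  "hcheb 0 u v = 1"
| "hcheb (Suc 0) u v = 2 * u"
| "hcheb (Suc (Suc m)) u v = 2 * u * hcheb (Suc m) u v - v * hcheb m u v"

text \<open>This and the next four functions are the first and second partial derivatives, obtained
  by differentiating the recursion. Differential identities thereby become inductions on m followed
  by algebra.\<close>

fun hcheb_u :: "nat \<Rightarrow> real \<Rightarrow> real \<Rightarrow> real" where
  "hcheb_u 0 u v = 0"
| "hcheb_u (Suc 0) u v = 2"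
| "hcheb_u (Suc (Suc m)) u v = 2 * hcheb (Suc m) u v + 2 * u * hcheb_u (Suc m) u v - v * hcheb_u m u v"

fun hcheb_v :: "nat \<Rightarrow> real \<Rightarrow> real \<Rightarrow> real" where
  "hcheb_v 0 u v = 0"
| "hcheb_v (Suc 0) u v = 0"
| "hcheb_v (Suc (Suc m)) u v = 2 * u * hcheb_v (Suc m) u v - hcheb m u v - v * hcheb_v m u v"

fun hcheb_uu :: "nat \<Rightarrow> real \<Rightarrow> real \<Rightarrow> real" where
  "hcheb_uu 0 u v = 0"
| "hcheb_uu (Suc 0) u v = 0"
| "hcheb_uu (Suc (Suc m)) u v = 4 * hcheb_u (Suc m) u v + 2 * u * hcheb_uu (Suc m) u v - v * hcheb_uu m u v"

fun hcheb_uv :: "nat \<Rightarrow> real \<Rightarrow> real \<Rightarrow> real" where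
  "hcheb_uv 0 u v = 0"
| "hcheb_uv (Suc 0) u v = 0"
| "hcheb_uv (Suc (Suc m)) u v =
     2 * hcheb_v (Suc m) u v + 2 * u * hcheb_uv (Suc m) u v - hcheb_u m u v - v * hcheb_uv m u v"

fun hcheb_vv :: "nat \<Rightarrow> real \<Rightarrow> real \<Rightarrow> real" where
  "hcheb_vv 0 u v = 0"
| "hcheb_vv (Suc 0) u v = 0"
| "hcheb_vv (Suc (Suc m)) u v = 2 * u * hcheb_vv (Suc m) u v - 2 * hcheb_v m u v - v * hcheb_vv m u v"

text \<open>The chain rule is stated along curves because all operators below differentiate along
  great circles and orbits.\<close>

lemma
  assumes [derivative_intros]: "(U has_real_derivative U') (at s)" "(V has_real_derivative V') (at s)"
  shows DERIV_hcheb: "((\<lambda>s. hcheb m (U s) (V s)) has_real_derivative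
      hcheb_u m (U s) (V s) * U' + hcheb_v m (U s) (V s) * V') (at s)" (is "?P m")
    and DERIV_hcheb_u: "((\<lambda>s. hcheb_u m (U s) (V s)) has_real_derivative
      hcheb_uu m (U s) (V s) * U' + hcheb_uv m (U s) (V s) * V') (at s)" (is "?Q m")
    and DERIV_hcheb_v: "((\<lambda>s. hcheb_v m (U s) (V s)) has_real_derivative
      hcheb_uv m (U s) (V s) * U' + hcheb_vv m (U s) (V s) * V') (at s)" (is "?R m")
proof -
  have "?P m \<and> ?Q m \<and> ?R m"
  proof (induction m rule: induct_nat_012)
    case (ge2 m)
    note [derivative_intros] = ge2[THEN conjunct1] ge2[THEN conjunct2, THEN conjunct1] ge2[THEN conjunct2, THEN conjunct2]
    show ?case by (auto intro!: derivative_eq_intros) (simp_all add: algebra_simps)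
  qed (auto intro!: derivative_eq_intros)
  then show "?P m" "?Q m" "?R m" by auto
qed

text \<open>Euler's identity for weighted homogeneity of degree m. The next two lemmas are the same
  identity for the partial derivatives, of degrees m - 1 and m - 2.\<close>

lemma hcheb_euler: "u * hcheb_u m u v + 2 * v * hcheb_v m u v = real m * hcheb m u v"
proof (induction m rule: induct_nat_012)
  case (ge2 m)
  show ?case using ge2 by (simp add: algebra_simps) algebra
qed auto

lemma hcheb_euler_u: "u * hcheb_uu m u v + 2 * v * hcheb_uv m u v = (real m - 1) * hcheb_u m u v"
proof (induction m rule: induct_nat_012)
  case (ge2 m)
  show ?case using ge2 hcheb_euler[of u "Suc m" v] by (simp add: algebra_simps) algebra
qed auto

lemma hcheb_euler_v: "u * hcheb_uv m u v + 2 * v * hcheb_vv m u v = (real m - 2) * hcheb_v m u v"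
proof (induction m rule: induct_nat_012)
  case (ge2 m)
  show ?case using ge2 hcheb_euler[of u m v] by (simp add: algebra_simps) algebra
qed auto

text \<open>Four times the left side is the commutator of the operator in
  \<open>hcheb_harmonic\<close> with multiplication by 2 u. In the induction there it cancels the
  commutator with v, which Euler's identity evaluates to 4 (m + 2).\<close>

lemma hcheb_recursion_deriv:
  "hcheb_u (Suc m) u v + 2 * u * hcheb_v (Suc m) u v = real (m + 2) * hcheb m u v"
proof (induction m rule: induct_nat_012)
  case (ge2 m)
  show ?case using ge2 by (simp add: algebra_simps) algebra
qed (auto simp: algebra_simps)

text \<open>The left side is the Laplacian of R^4 applied to \<open>hcheb m\<close> at u = Re w and
  v = |w|^2: these polynomials are the zonal harmonics of the quaternions.\<close>

lemma hcheb_harmonic: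
  "hcheb_uu m u v + 4 * u * hcheb_uv m u v + 4 * v * hcheb_vv m u v + 8 * hcheb_v m u v = 0"
proof (induction m rule: induct_nat_012)
  case (ge2 m)
  show ?case
    using ge2 hcheb_euler[of u m v] hcheb_recursion_deriv[of m u v] by (simp add: algebra_simps) algebra
qed auto

text \<open>The left side is the sum of the squares of the three vertical fields on functions of (u,
  v), and -m (m + 2) is the eigenvalue of degree m on the 3-sphere. At v = 1 this is Chebyshev's
  equation.\<close>

lemma hcheb_casimir:
  "(v - u\<^sup>2) * hcheb_uu m u v - 3 * u * hcheb_u m u v = - real (m * (m + 2)) * hcheb m u v"
  using hcheb_harmonic[of m u v] hcheb_euler[of u m v] hcheb_euler_u[of u m v] hcheb_euler_v[of u m v]
  by simp algebra

lemma hcheb_trig: "hcheb m (c * cos \<eta>) (c\<^sup>2) * sin \<eta> = c ^ m * sin (real (m + 1) * \<eta>)"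
proof (induction m rule: induct_nat_012)
  case 1
  show ?case using sin_double[of \<eta>] by (simp add: algebra_simps)
next
  case (ge2 m)
  define x where "x = real (Suc m + 1) * \<eta>"
  have e: "real (Suc (Suc m) + 1) * \<eta> = x + \<eta>" "real (m + 1) * \<eta> = x - \<eta>"
    by (simp_all add: x_def algebra_simps)
  have "hcheb (Suc (Suc m)) (c * cos \<eta>) (c\<^sup>2) * sin \<eta> = 2 * (c * cos \<eta>) * (hcheb (Suc m) (c * cos \<eta>) (c\<^sup>2) * sin \<eta>)
     - c\<^sup>2 * (hcheb m (c * cos \<eta>) (c\<^sup>2) * sin \<eta>)"
    by (simp add: algebra_simps)
  also have "\<dots> = c ^ Suc (Suc m) * (2 * cos \<eta> * sin x - sin (x - \<eta>))"
    unfolding ge2 e x_def[symmetric] by (simp add: algebra_simps power2_eq_square)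
  also have "2 * cos \<eta> * sin x - sin (x - \<eta>) = sin (x + \<eta>)"
    by (simp add: sin_add sin_diff algebra_simps)
  finally show ?case unfolding e .
qed simp

text \<open>The addition formula for sin((m+2) \<eta>) divided by sin \<eta>, proved from the
  recursion so that it holds also at the zeros of the sine. Each step adds at most 1 in absolute
  value when |c| is at most 1, whence the bound m + 1 and the value at the pole.\<close>

lemma hcheb_Suc_trig:
  "hcheb (Suc m) (c * cos \<eta>) (c\<^sup>2) = c * cos \<eta> * hcheb m (c * cos \<eta>) (c\<^sup>2) + c ^ Suc m * cos (real (Suc m) * \<eta>)"
proof (induction m rule: induct_nat_012)
  case 1
  show ?case using arg_cong[OF cos_double_cos[of \<eta>], of "\<lambda>z. c * c * z"] by (simp add: algebra_simps power2_eq_square)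
next
  case (ge2 m)
  define x where "x = real (Suc (Suc m)) * \<eta>"
  have e: "real (Suc (Suc (Suc m))) * \<eta> = x + \<eta>" "real (Suc m) * \<eta> = x - \<eta>"
    by (simp_all add: x_def algebra_simps)
  have "cos (x + \<eta>) = 2 * cos \<eta> * cos x - cos (x - \<eta>)" by (simp add: cos_add cos_diff)
  moreover have "c ^ Suc (Suc (Suc m)) = c * c * c ^ Suc m" "c ^ Suc (Suc m) = c * c ^ Suc m" by simp_all
  ultimately show ?case using ge2 unfolding e x_def[symmetric] hcheb.simps(3)[of "Suc m"]
    by (simp only: power2_eq_square) (simp add: algebra_simps)
qed simp

lemma polar_coordinates_le:
  assumes "u\<^sup>2 \<le> v"
  obtains \<eta> where "u = sqrt v * cos \<eta>" "v = (sqrt v)\<^sup>2"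
proof (cases "v = 0")
  case True
  with assms show ?thesis using that[of 0] by simp
next
  case False
  have "0 \<le> v" using assms by (meson order.trans zero_le_power2)
  with False have "0 < sqrt v" by simp
  moreover have "\<bar>u\<bar> \<le> sqrt v" using assms by (metis real_sqrt_abs real_sqrt_le_iff)
  ultimately have "- 1 \<le> u / sqrt v" "u / sqrt v \<le> 1" by (simp_all add: field_simps)
  then have "sqrt v * cos (arccos (u / sqrt v)) = u" using \<open>0 < sqrt v\<close> by simp
  with that[of "arccos (u / sqrt v)"] \<open>0 \<le> v\<close> show ?thesis by simp
qed

lemma abs_hcheb_le:
  assumes "u\<^sup>2 \<le> v" "v \<le> 1"
  shows "\<bar>hcheb m u v\<bar> \<le> real (m + 1)"
proof -
  obtain \<eta> where e: "u = sqrt v * cos \<eta>" "v = (sqrt v)\<^sup>2" using polar_coordinates_le assms(1) by blast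
  define c where "c = sqrt v"
  have c: "0 \<le> c" "c \<le> 1" using assms order.trans[OF zero_le_power2 assms(1)] by (auto simp: c_def)
  have ec: "u = c * cos \<eta>" "v = c\<^sup>2" using e by (auto simp: c_def)
  show ?thesis unfolding ec
  proof (induction m)
    case (Suc m)
    have "\<bar>c * cos \<eta> * hcheb m (c * cos \<eta>) (c\<^sup>2)\<bar> \<le> 1 * \<bar>hcheb m (c * cos \<eta>) (c\<^sup>2)\<bar>"
      unfolding abs_mult[of "c * cos \<eta>"] using c
      by (intro mult_right_mono) (auto simp: abs_mult intro!: mult_le_one)
    moreover have "\<bar>c ^ Suc m * cos (real (Suc m) * \<eta>)\<bar> \<le> 1"
      unfolding abs_mult using c by (intro mult_le_one) (auto simp: power_abs[symmetric] power_le_one simp del: power_Suc)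
    ultimately show ?case using Suc unfolding hcheb_Suc_trig by linarith
  qed simp
qed

lemma hcheb_north: "hcheb m 1 1 = real (m + 1)"
  using hcheb_Suc_trig[of _ 1 0] by (induction m) simp_all

lemma continuous_on_hcheb [continuous_intros]:
  assumes [continuous_intros]: "continuous_on S f" "continuous_on S g"
  shows "continuous_on S (\<lambda>x. hcheb m (f x) (g x))"
proof (induction m rule: induct_nat_012)
  case (ge2 m)
  note [continuous_intros] = ge2
  show ?case by (auto intro!: continuous_intros)
qed (auto intro!: continuous_intros)

text \<open>Zeros of the sine are at distance at least \<pi> from each other, so near such a zero
  the quotient coincides with a continuous function, whose value is the limit.\<close>

lemma sin_quotient_hcheb: "sin_quotient m \<eta> = hcheb m (cos \<eta>) 1"
proof -
  have eq: "sin (real (m + 1) * x) / sin x = hcheb m (cos x) 1" if "sin x \<noteq> 0" for x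
    using hcheb_trig[of m 1 x] that by (simp add: field_simps)
  show ?thesis
  proof (cases "sin \<eta> = 0")
    case False
    then show ?thesis unfolding sin_quotient_def using eq[of \<eta>] by simp
  next
    case True
    have "sin x \<noteq> 0" if "x \<noteq> \<eta>" "dist x \<eta> < pi" for x
    proof -
      have c: "cos \<eta> \<noteq> 0" using True sin_cos_squared_add[of \<eta>] by auto
      have "sin (x - \<eta>) \<noteq> 0"
      proof (cases "\<eta> < x")
        case True
        then show ?thesis using that sin_gt_zero[of "x - \<eta>"] by (auto simp: dist_real_def)
      next
        case False
        then have "sin (\<eta> - x) > 0" using that by (intro sin_gt_zero) (auto simp: dist_real_def)
        moreover have "sin (x - \<eta>) = - sin (\<eta> - x)" by (metis minus_diff_eq sin_minus)
        ultimately show ?thesis by simp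
      qed
      then show ?thesis using True by (simp add: sin_diff)
    qed
    then have "\<forall>\<^sub>F x in at \<eta>. hcheb m (cos x) 1 = sin (real (m + 1) * x) / sin x"
      unfolding eventually_at using eq pi_gt_zero by (intro exI[of _ pi]) auto
    moreover have "((\<lambda>x. hcheb m (cos x) 1) \<longlongrightarrow> hcheb m (cos \<eta>) 1) (at \<eta>)"
    proof -
      have "continuous_on UNIV (\<lambda>x. hcheb m (cos x) 1)" by (intro continuous_intros)
      then show ?thesis by (simp add: continuous_on_eq_continuous_at isCont_def)
    qed
    ultimately have "((\<lambda>x. sin (real (m + 1) * x) / sin x) \<longlongrightarrow> hcheb m (cos \<eta>) 1) (at \<eta>)"
      by (rule Lim_transform_eventually[rotated])
    then have "Lim (at \<eta>) (\<lambda>x. sin (real (m + 1) * x) / sin x) = hcheb m (cos \<eta>) 1"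
      by (intro tendsto_Lim) auto
    with True show ?thesis unfolding sin_quotient_def by simp
  qed
qed

text \<open>The restriction of \<open>hcheb\<close> to v = 1 as a formal polynomial, to which linear
  functionals can be applied.\<close>

fun chebU :: "nat \<Rightarrow> real poly" where
  "chebU 0 = 1"
| "chebU (Suc 0) = [:0, 2:]"
| "chebU (Suc (Suc m)) = [:0, 2:] * chebU (Suc m) - chebU m"

lemma poly_chebU: "poly (chebU m) x = hcheb m x 1"
  by (induction m rule: induct_nat_012) (auto simp: algebra_simps)

lemma poly_pderiv_chebU: "poly (pderiv (chebU m)) x = hcheb_u m x 1"
  by (induction m rule: induct_nat_012) (auto simp: algebra_simps pderiv_mult pderiv_diff pderiv_smult pderiv_pCons poly_chebU)

lemma poly_pderiv2_chebU: "poly (pderiv (pderiv (chebU m))) x = hcheb_uu m x 1"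
  by (induction m rule: induct_nat_012)
     (auto simp: algebra_simps pderiv_mult pderiv_diff pderiv_add pderiv_smult pderiv_pCons poly_chebU poly_pderiv_chebU)

lemma chebU_ode:
  "[:1, 0, - 1:] * pderiv (pderiv (chebU m)) - [:0, 3:] * pderiv (chebU m) = smult (- real (m * (m + 2))) (chebU m)"
  by (rule iffD1[OF poly_eq_poly_eq_iff], rule ext)
     (use hcheb_casimir[of 1 _ m] in \<open>simp add: poly_chebU poly_pderiv_chebU poly_pderiv2_chebU algebra_simps power2_eq_square\<close>)

text \<open>The functional \<open>K\<close> stands for integration against the semicircle weight \<open>\<surd>(1 - x\<^sup>2)\<close>, for which
  \<open>(1 - x\<^sup>2) r' - 3 x r\<close> is an exact derivative divided by the weight.\<close>

lemma chebU_orthogonal: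
  assumes add: "\<And>p q. K (p + q) = K p + K q" and smult: "\<And>c p. K (smult c p) = c * K p"
    and exact: "\<And>r. K ([:1, 0, - 1:] * pderiv r - [:0, 3:] * r) = 0"
  shows "K (chebU m * chebU n) = (if m = n then K 1 else (0::real))"
proof -
  have minus: "K (p - q) = K p - K q" for p q
    using add[of p "smult (- 1) q"] smult[of "- 1" q] by simp
  \<comment> \<open>Exactness for r = q p' is an integration by parts. The right side is symmetric
    in p and q, so the Chebyshev operator is self-adjoint and distinct eigenvalues give
    orthogonality.\<close>
  have sym: "K (q * ([:1, 0, - 1:] * pderiv (pderiv p) - [:0, 3:] * pderiv p)) = - K ([:1, 0, - 1:] * pderiv p * pderiv q)" for p q
  proof -
    have "[:1, 0, - 1:] * pderiv (q * pderiv p) - [:0, 3:] * (q * pderiv p)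
      = q * ([:1, 0, - 1:] * pderiv (pderiv p) - [:0, 3:] * pderiv p) + [:1, 0, - 1:] * pderiv p * pderiv q"
      unfolding pderiv_mult by (simp only: distrib_left right_diff_distrib mult_ac)
    with exact[of "q * pderiv p"] show ?thesis by (simp only: add)
  qed
  have orth: "K (chebU m * chebU n) = 0" if "m \<noteq> n" for m n
  proof -
    have "- real (m * (m + 2)) * K (chebU n * chebU m) = - real (n * (n + 2)) * K (chebU m * chebU n)"
      using sym[of "chebU n" "chebU m"] sym[of "chebU m" "chebU n"]
      unfolding chebU_ode by (simp only: mult_smult_right smult mult_ac)
    then have "(real (m * (m + 2)) - real (n * (n + 2))) * K (chebU m * chebU n) = 0"
      by (simp only: mult.commute[of "chebU n"]) (simp add: algebra_simps)
    moreover have "real (m * (m + 2)) - real (n * (n + 2)) \<noteq> 0"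
    proof -
      have "real (m * (m + 2)) - real (n * (n + 2)) = (real m - real n) * (real m + real n + 2)"
        by (simp add: algebra_simps)
      then show ?thesis using that by simp
    qed
    ultimately show ?thesis by simp
  qed
  have rec: "[:0, 2:] * chebU (Suc m) = chebU (Suc (Suc m)) + chebU m" for m by simp
  have "K (chebU m * chebU m) = K 1" for m
  proof (induction m)
    case (Suc m)
    show ?case
    proof (cases m)
      case 0
      \<comment> \<open>Exactness for r = x says that K vanishes on 1 - 4 x^2. This settles the norm
        for m = 1; from then on the recursion moves the factor 2 x from one polynomial to the
        other.\<close>
      have "K ([:1, 0, - 1:] * pderiv [:0, 1:] - [:0, 3:] * [:0, 1:]) = 0" by (rule exact)
      also have "[:1, 0, - 1:] * pderiv [:0, 1:] - [:0, 3:] * [:0, 1::real:] = 1 - chebU 1 * chebU 1"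
        by (simp add: pderiv_pCons one_pCons)
      finally show ?thesis using 0 by (simp add: minus)
    next
      case (Suc l)
      have "K (chebU (Suc m) * chebU (Suc m)) = K (chebU (Suc m) * ([:0, 2:] * chebU m))"
        using orth[of "Suc m" l] unfolding Suc rec distrib_left add by simp
      also have "\<dots> = K (chebU m * ([:0, 2:] * chebU (Suc m)))" by (simp only: mult_ac)
      also have "\<dots> = K (chebU m * chebU m)"
        using orth[of m "Suc (Suc m)"] unfolding rec distrib_left add by simp
      finally show ?thesis using \<open>K (chebU m * chebU m) = K 1\<close> by simp
    qed
  qed simp
  with orth show ?thesis by auto
qed

section \<open>Eigenfunctions under the heat semigroup\<close>

lemma smooth_on_sphere_imp_continuous_on:
  assumes "smooth_on_sphere f"
  shows "continuous_sphere f"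
proof -
  obtain U F where "open U" "sphere 0 1 \<subseteq> U" "Ck_on 0 F U" "\<forall>x\<in>sphere 0 1. F x = f x"
    using assms unfolding smooth_on_sphere_def by blast
  then have "continuous_sphere F" by (auto intro: continuous_on_subset)
  then show ?thesis using \<open>\<forall>x\<in>sphere 0 1. F x = f x\<close> by (subst continuous_on_cong[OF refl, symmetric]) auto
qed

context
  fixes P :: "real \<Rightarrow> ('n::finite qspace \<Rightarrow> real) \<Rightarrow> 'n qspace \<Rightarrow> real"
  assumes P: "heat_semigroup P"
begin

lemma semigroup_continuous: "t \<ge> 0 \<Longrightarrow> continuous_sphere f \<Longrightarrow> continuous_sphere (P t f)"
  using P[unfolded heat_semigroup_def, THEN conjunct1] by blast

lemma semigroup_linear:
  "t \<ge> 0 \<Longrightarrow> continuous_sphere f \<Longrightarrow> continuous_sphere g \<Longrightarrow> q \<in> sphere 0 1 \<Longrightarrow>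
     P t (\<lambda>x. a * f x + b * g x) q = a * P t f q + b * P t g q"
  using P[unfolded heat_semigroup_def, THEN conjunct2, THEN conjunct1] by blast

lemma semigroup_bounded:
  "t \<ge> 0 \<Longrightarrow> \<exists>M. \<forall>f c. continuous_sphere f \<longrightarrow> (\<forall>q\<in>sphere 0 1. \<bar>f q\<bar> \<le> c) \<longrightarrow>
     (\<forall>q\<in>sphere 0 1. \<bar>P t f q\<bar> \<le> M * c)"
  using P[unfolded heat_semigroup_def, THEN conjunct2, THEN conjunct2, THEN conjunct1] by blast

text \<open>Boundedness with the constant 0. It shows that values of f off the sphere do not
  influence \<open>P t f\<close> on the sphere.\<close>

lemma semigroup_null:
  assumes "t \<ge> 0" "continuous_sphere f" "\<forall>q\<in>sphere 0 1. f q = 0" "q \<in> sphere 0 1"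
  shows "P t f q = 0"
proof -
  obtain M where "\<forall>f c. continuous_sphere f \<longrightarrow> (\<forall>q\<in>sphere 0 1. \<bar>f q\<bar> \<le> c) \<longrightarrow>
     (\<forall>q\<in>sphere 0 1. \<bar>P t f q\<bar> \<le> M * c)" using semigroup_bounded[OF assms(1)] by blast
  from this[rule_format, of f 0 q] assms show ?thesis by simp
qed

lemma semigroup_cong:
  assumes "t \<ge> 0" "continuous_sphere f" "continuous_sphere g"
    "\<And>q. q \<in> sphere 0 1 \<Longrightarrow> f q = g q" "q \<in> sphere 0 1"
  shows "P t f q = P t g q"
proof -
  have "P t (\<lambda>x. 1 * f x + (- 1) * g x) q = 0"
    using assms by (intro semigroup_null) (auto intro!: continuous_intros)
  then show ?thesis using semigroup_linear[OF assms(1,2,3,5), of 1 "- 1"] by simp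
qed

lemma semigroup_zero: "continuous_sphere f \<Longrightarrow> q \<in> sphere 0 1 \<Longrightarrow> P 0 f q = f q"
  using P unfolding heat_semigroup_def by blast

lemma semigroup_add:
  "s \<ge> 0 \<Longrightarrow> t \<ge> 0 \<Longrightarrow> continuous_sphere f \<Longrightarrow> q \<in> sphere 0 1 \<Longrightarrow> P (s + t) f q = P s (P t f) q"
  using P unfolding heat_semigroup_def by blast

lemma semigroup_strongly_continuous:
  "continuous_sphere f \<Longrightarrow> uniform_limit (sphere 0 1) (\<lambda>t. P t f) f (at_right 0)"
  using P unfolding heat_semigroup_def by blast

text \<open>The uniform boundedness principle for the operators \<open>P s\<close> near \<open>s = 0\<close>, by Sokal's argument:
  in the series \<open>\<Sum> \<plusminus>3\<^bsup>-n\<^esup> f\<^sub>n\<close> of almost norming functions the signs can be chosen such that the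
  partial sums are not cancelled.\<close>

lemma semigroup_bounded_near_zero:
  "\<exists>\<delta>>0. \<exists>M\<ge>0. \<forall>s\<in>{0..\<delta>}. \<forall>f c. continuous_sphere f \<longrightarrow> (\<forall>q\<in>sphere 0 1. \<bar>f q\<bar> \<le> c) \<longrightarrow>
     (\<forall>q\<in>sphere 0 1. \<bar>P s f q\<bar> \<le> M * c)"
proof (rule ccontr)
  define S where "S = (sphere 0 1 :: 'n qspace set)"
  define V where "V s = {\<bar>P s f q\<bar> |f q. continuous_on S f \<and> (\<forall>q\<in>S. \<bar>f q\<bar> \<le> 1) \<and> q \<in> S}" for s
  \<comment> \<open>\<open>N s\<close> is the operator norm of \<open>P s\<close>.\<close>
  define N where "N s = Sup (V s)" for s
  assume "\<not> ?thesis"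
  then have neg: "\<exists>s\<in>{0..\<delta>}. \<exists>f c. continuous_on S f \<and> (\<forall>q\<in>S. \<bar>f q\<bar> \<le> c) \<and> (\<exists>q\<in>S. \<bar>P s f q\<bar> > M * c)"
    if "\<delta> > 0" "M \<ge> 0" for \<delta> M
    unfolding S_def using that by (meson not_le)
  have bdd: "bdd_above (V s)" if "s \<ge> 0" for s
  proof -
    obtain M where "\<forall>x\<in>V s. x \<le> M * 1"
      using semigroup_bounded[OF \<open>s \<ge> 0\<close>] unfolding V_def S_def by blast
    then show ?thesis by (auto simp: bdd_above_def)
  qed
  have N: "\<bar>P s f q\<bar> \<le> N s * c" if "s \<ge> 0" "continuous_on S f" "\<forall>q\<in>S. \<bar>f q\<bar> \<le> c" "q \<in> S" "c > 0" for s f c q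
  proof -
    have c1: "continuous_on S (\<lambda>x. (1 / c) * f x + 0 * f x)" using that by (auto intro!: continuous_intros)
    have "\<forall>q\<in>S. \<bar>(1 / c) * f q + 0 * f q\<bar> \<le> 1" using that by (auto simp: abs_mult field_simps)
    with c1 that have "\<bar>P s (\<lambda>x. (1 / c) * f x + 0 * f x) q\<bar> \<in> V s" unfolding V_def by blast
    then have "\<bar>P s (\<lambda>x. (1 / c) * f x + 0 * f x) q\<bar> \<le> N s" unfolding N_def by (intro cSup_upper bdd that)
    also have "P s (\<lambda>x. (1 / c) * f x + 0 * f x) q = (1 / c) * P s f q + 0 * P s f q"
      using that unfolding S_def by (intro semigroup_linear) auto
    finally show ?thesis using that by (simp add: abs_mult field_simps)
  qed
  \<comment> \<open>The n-th function will enter the series with factor 3^-n, which 4^n outgrows.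
    The gain 2/3 exceeds the tail, at most 1/2 after the same scaling, and 1/6 is left.\<close>
  have ex: "\<exists>s f q. 0 \<le> s \<and> s \<le> 1 / real (Suc n) \<and> 4 ^ n < N s \<and> continuous_on S f \<and> (\<forall>q\<in>S. \<bar>f q\<bar> \<le> 1) \<and> q \<in> S \<and>
      2 / 3 * N s \<le> \<bar>P s f q\<bar>" for n
  proof -
    obtain s f c q where s: "0 \<le> s" "s \<le> 1 / real (Suc n)" "continuous_on S f" "\<forall>q\<in>S. \<bar>f q\<bar> \<le> c" "q \<in> S" "\<bar>P s f q\<bar> > 4 ^ n * c"
      using neg[of "1 / real (Suc n)" "4 ^ n"] by auto
    have c0: "c \<ge> 0" using s(4,5) by (meson abs_ge_zero order.trans)
    have "c > 0"
    proof (rule ccontr)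
      assume "\<not> c > 0"
      then have "c = 0" using c0 by simp
      then have "P s f q = 0" using s by (intro semigroup_null) (auto simp: S_def)
      with s(6) \<open>c = 0\<close> show False by simp
    qed
    with N[OF s(1,3,4,5)] s(6) have "4 ^ n * c < N s * c" by linarith
    with \<open>c > 0\<close> have N4: "4 ^ n < N s" by simp
    then have "N s > 0" by (meson less_trans zero_less_numeral zero_less_power)
    then have "2 / 3 * N s < Sup (V s)" unfolding N_def by simp
    moreover have "\<bar>P s (\<lambda>_. 0) q\<bar> \<in> V s"
      unfolding V_def mem_Collect_eq by (intro exI[of _ "\<lambda>_. 0"] exI[of _ q]) (use s(5) in auto)
    then have "V s \<noteq> {}" by blast
    ultimately obtain y where "y \<in> V s" "2 / 3 * N s < y" using less_cSup_iff[OF _ bdd[OF s(1)]] by metis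
    then obtain g p where "continuous_on S g" "\<forall>q\<in>S. \<bar>g q\<bar> \<le> 1" "p \<in> S" "2 / 3 * N s \<le> \<bar>P s g p\<bar>"
      unfolding V_def by auto
    then show ?thesis using s N4 by blast
  qed
  then obtain s f z where sfz: "\<And>n. 0 \<le> s n" "\<And>n. s n \<le> 1 / real (Suc n)" "\<And>n. 4 ^ n < N (s n)" "\<And>n. continuous_on S (f n)"
    "\<And>n. \<forall>q\<in>S. \<bar>f n q\<bar> \<le> 1" "\<And>n. z n \<in> S" "\<And>n. 2 / 3 * N (s n) \<le> \<bar>P (s n) (f n) (z n)\<bar>"
    by metis
  define step where "step n x \<sigma> = (\<lambda>q. 1 * x q + (\<sigma> * (1 / 3) ^ n) * f n q)" for n x and \<sigma> :: real
  define good where "good n x \<sigma> \<longleftrightarrow> (1 / 3) ^ n * (2 / 3 * N (s n)) \<le> \<bar>P (s n) (step n x \<sigma>) (z n)\<bar>" for n x \<sigma>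
  \<comment> \<open>The images for the two signs differ by twice the image of the new term, so one
    of them is at least as large as that image.\<close>
  have good: "good n x 1 \<or> good n x (- 1)" if "continuous_on S x" for n x
  proof -
    have "P (s n) (step n x \<sigma>) (z n) = 1 * P (s n) x (z n) + (\<sigma> * (1 / 3) ^ n) * P (s n) (f n) (z n)" for \<sigma>
      unfolding step_def using sfz that unfolding S_def by (intro semigroup_linear) auto
    from this[of 1] this[of "- 1"]
    have "P (s n) (step n x 1) (z n) - P (s n) (step n x (- 1)) (z n) = 2 * ((1 / 3) ^ n * P (s n) (f n) (z n))"
      by simp
    moreover have "(1 / 3) ^ n * (2 / 3 * N (s n)) \<le> \<bar>(1 / 3) ^ n * P (s n) (f n) (z n)\<bar>"
      unfolding abs_mult using mult_left_mono[OF sfz(7)[of n], of "(1 / 3) ^ n"] by simp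
    ultimately show ?thesis unfolding good_def by linarith
  qed
  define sgn' where "sgn' n x = (if good n x 1 then 1 else - 1 :: real)" for n x
  define x where "x = rec_nat (\<lambda>_. 0) (\<lambda>n y. step n y (sgn' n y))"
  have x0: "x 0 = (\<lambda>_. 0)" and xS: "x (Suc n) = step n (x n) (sgn' n (x n))" for n by (simp_all add: x_def)
  have cx: "continuous_on S (x n)" for n
    by (induction n) (auto simp: x0 xS step_def intro!: continuous_intros sfz)
  have gx: "(1 / 3) ^ n * (2 / 3 * N (s n)) \<le> \<bar>P (s n) (x (Suc n)) (z n)\<bar>" for n
    using good[OF cx, of n n] unfolding xS sgn'_def good_def by auto
  define d where "d n q = sgn' n (x n) * (1 / 3) ^ n * f n q" for n q
  have xd: "x n q = (\<Sum>i<n. d i q)" for n q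
    by (induction n) (simp_all add: x0 xS step_def d_def)
  have db: "\<bar>d n q\<bar> \<le> (1 / 3) ^ n" if "q \<in> S" for n q
    using sfz(5)[of n] that by (auto simp: d_def abs_mult sgn'_def mult_left_le)
  have g: "summable (\<lambda>n. (1 / 3 :: real) ^ n)" by simp
  define X where "X q = (\<Sum>n. d n q)" for q
  have dsum: "summable (\<lambda>n. d n q)" if "q \<in> S" for q
    using db[OF that] by (intro summable_comparison_test[OF _ g]) auto
  have unif: "uniform_limit S (\<lambda>n q. \<Sum>i<n. d i q) X sequentially"
    unfolding X_def by (rule Weierstrass_m_test[OF _ g]) (use db in auto)
  have cX: "continuous_on S X"
    by (rule uniform_limit_theorem[OF _ unif]) (use cx in \<open>auto simp: xd[abs_def]\<close>)
  have tail: "\<bar>X q - x (Suc n) q\<bar> \<le> 1 / 2 * (1 / 3) ^ n" if "q \<in> S" for n q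
  proof -
    have "X q - x (Suc n) q = (\<Sum>i. d (i + Suc n) q)"
      unfolding X_def xd using suminf_split_initial_segment[OF dsum[OF that], of "Suc n"] by simp
    also have "\<bar>\<dots>\<bar> \<le> (\<Sum>i. (1 / 3) ^ (i + Suc n))"
    proof -
      have "norm (\<Sum>i. d (i + Suc n) q) \<le> (\<Sum>i. (1 / 3) ^ (i + Suc n))"
        by (intro norm_suminf_le summable_ignore_initial_segment g) (simp only: real_norm_def db[OF that])
      then show ?thesis by simp
    qed
    also have "\<dots> = (1 / 3) ^ Suc n * (\<Sum>i. (1 / 3) ^ i)"
      unfolding power_add by (subst suminf_mult2[OF g, symmetric]) simp
    also have "\<dots> = 1 / 2 * (1 / 3) ^ n" by (simp add: suminf_geometric)
    finally show ?thesis .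
  qed
  have low: "(4 / 3) ^ n / 6 \<le> \<bar>P (s n) X (z n)\<bar>" for n
  proof -
    have "\<bar>P (s n) (\<lambda>q. 1 * X q + (- 1) * x (Suc n) q) (z n)\<bar> \<le> N (s n) * (1 / 2 * (1 / 3) ^ n)"
      using cX cx tail by (intro N sfz) (auto intro!: continuous_intros)
    also have "P (s n) (\<lambda>q. 1 * X q + (- 1) * x (Suc n) q) (z n) = 1 * P (s n) X (z n) + (- 1) * P (s n) (x (Suc n)) (z n)"
      using sfz cX cx unfolding S_def by (intro semigroup_linear) auto
    finally have "\<bar>1 * P (s n) X (z n) + (- 1) * P (s n) (x (Suc n)) (z n)\<bar> \<le> (1 / 3) ^ n * N (s n) / 2"
      by (simp add: mult_ac)
    moreover have "2 / 3 * ((1 / 3) ^ n * N (s n)) \<le> \<bar>P (s n) (x (Suc n)) (z n)\<bar>"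
      using gx[of n] by (simp add: mult_ac)
    ultimately have "(1 / 3) ^ n * N (s n) / 6 \<le> \<bar>P (s n) X (z n)\<bar>" by linarith
    moreover have "(1 / 3) ^ n * 4 ^ n \<le> (1 / 3) ^ n * N (s n)" using sfz(3)[of n] by (intro mult_left_mono) auto
    moreover have "(4 / 3 :: real) ^ n = (1 / 3) ^ n * 4 ^ n" by (simp flip: power_mult_distrib)
    ultimately show ?thesis by linarith
  qed
  \<comment> \<open>Strong continuity is a limit from the right, so the time 0 must be excluded.
    There the operator norm is at most 1, which contradicts 4^n < \<open>N (s n)\<close>.\<close>
  have spos: "s n > 0" for n
  proof (rule ccontr)
    assume "\<not> s n > 0"
    then have s0: "s n = 0" using sfz(1)[of n] by simp
    have "\<bar>P 0 (\<lambda>_. 0) (z n)\<bar> \<in> V 0"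
      unfolding V_def mem_Collect_eq by (intro exI[of _ "\<lambda>_. 0"] exI[of _ "z n"]) (use sfz(6) in auto)
    then have "V 0 \<noteq> {}" by blast
    moreover have "y \<le> 1" if "y \<in> V 0" for y
      using that semigroup_zero unfolding V_def S_def by auto
    ultimately have "N 0 \<le> 1" unfolding N_def by (rule cSup_least)
    moreover have "(1::real) \<le> 4 ^ n" by simp
    moreover have "4 ^ n < N 0" using sfz(3)[of n] s0 by simp
    ultimately show False by linarith
  qed
  obtain B where B: "\<And>q. q \<in> S \<Longrightarrow> \<bar>X q\<bar> \<le> B"
  proof -
    have "compact (X ` S)" by (intro compact_continuous_image cX) (simp add: S_def)
    then have "bounded (X ` S)" by (rule compact_imp_bounded)
    then show ?thesis using that unfolding bounded_iff by auto
  qed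
  \<comment> \<open>Strong continuity at the single function \<open>X\<close> keeps
    \<open>P (s n) X\<close> bounded along s n, whereas the lower bound \<open>low\<close> tends to
    infinity.\<close>
  have "\<forall>\<^sub>F t in at_right 0. \<forall>q\<in>S. dist (P t X q) (X q) < 1"
    using uniform_limitD[OF semigroup_strongly_continuous[of X], of 1] cX unfolding S_def by simp
  moreover have "filterlim s (at_right 0) sequentially"
  proof (rule tendsto_imp_filterlim_at_right)
    have "(\<lambda>n. 1 / real (Suc n)) \<longlonglongrightarrow> 0" using LIMSEQ_inverse_real_of_nat by (simp add: inverse_eq_divide)
    then show "s \<longlonglongrightarrow> 0" by (rule real_tendsto_sandwich[OF _ _ tendsto_const, rotated 2]) (use sfz in auto)
  qed (use spos in auto)
  ultimately have "\<forall>\<^sub>F n in sequentially. \<forall>q\<in>S. dist (P (s n) X q) (X q) < 1"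
    by (rule eventually_compose_filterlim)
  then have "\<forall>\<^sub>F n in sequentially. (4 / 3) ^ n / 6 < B + 1"
  proof eventually_elim
    case (elim n)
    with low[of n] B[OF sfz(6)[of n]] sfz(6)[of n] show ?case by (force simp: dist_real_def)
  qed
  moreover have "filterlim (\<lambda>n. norm ((4 / 3 :: real) ^ n)) at_top sequentially"
    by (intro filterlim_at_infinity_imp_norm_at_top filterlim_realpow_sequentially_gt1) simp
  then have "\<forall>\<^sub>F n in sequentially. norm ((4 / 3 :: real) ^ n) > 6 * (B + 1)"
    unfolding filterlim_at_top_dense by blast

  ultimately have "\<forall>\<^sub>F n in sequentially. False" by eventually_elim simp
  then show False by simp
qed

text \<open>The error \<open>G h\<close> of the expected evolution is o(h) uniformly on the sphere.
  Over a subdivision of [0, T] the semigroup law propagates about T/h such errors, and their sum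
  tends to 0 once the operators \<open>P s\<close> are uniformly bounded on [0, T]. Such a bound is
  available on [0, \<delta>] only; longer times are composed of short steps, for which the evolution
  is already exact.\<close>

lemma semigroup_eigenfunction:
  assumes smooth: "smooth_on_sphere \<phi>"
    and eigen: "\<And>q. q \<in> sphere 0 1 \<Longrightarrow> sub_Laplacian \<phi> q = - \<mu> * \<phi> q"
    and "t \<ge> 0" "q \<in> sphere 0 1"
  shows "P t \<phi> q = exp (- \<mu> * t) * \<phi> q"
proof -
  define S where "S = (sphere 0 1 :: 'n qspace set)"
  have c\<phi>: "continuous_on S \<phi>" using smooth_on_sphere_imp_continuous_on[OF smooth] by (simp add: S_def)
  obtain \<delta> M where \<delta>: "\<delta> > 0" "M \<ge> 0" and M: "\<And>s f c q. 0 \<le> s \<Longrightarrow> s \<le> \<delta> \<Longrightarrow> continuous_on S f \<Longrightarrow> (\<And>q. q \<in> S \<Longrightarrow> \<bar>f q\<bar> \<le> c) \<Longrightarrow>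
     q \<in> S \<Longrightarrow> \<bar>P s f q\<bar> \<le> M * c"
    using semigroup_bounded_near_zero unfolding S_def by (metis atLeastAtMost_iff)
  obtain B where B: "\<And>q. q \<in> S \<Longrightarrow> \<bar>\<phi> q\<bar> \<le> B" "B > 0"
  proof -
    have "compact (\<phi> ` S)" by (intro compact_continuous_image c\<phi>) (simp add: S_def)
    then have "bounded (\<phi> ` S)" by (rule compact_imp_bounded)
    then show ?thesis using that unfolding bounded_pos by auto
  qed
  define e where "e s = exp (- \<mu> * s)" for s
  define G where "G s q = P s \<phi> q - e s * \<phi> q" for s q
  have cG: "continuous_on S (G s)" if "s \<ge> 0" for s
    unfolding G_def using semigroup_continuous[OF that] c\<phi> by (auto simp: S_def intro!: continuous_intros)
  have small: "\<exists>h0>0. \<forall>h. 0 < h \<and> h < h0 \<longrightarrow> (\<forall>q\<in>S. \<bar>G h q\<bar> \<le> \<epsilon> * h)" if "\<epsilon> > 0" for \<epsilon>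
  proof -
    have "uniform_limit S (\<lambda>t q. (P t \<phi> q - \<phi> q) / t) (sub_Laplacian \<phi>) (at_right 0)"
      using P smooth unfolding heat_semigroup_def S_def by blast
    then have "\<forall>\<^sub>F h in at_right 0. \<forall>q\<in>S. dist ((P h \<phi> q - \<phi> q) / h) (sub_Laplacian \<phi> q) < \<epsilon> / 2"
      by (rule uniform_limitD) (use that in simp)
    moreover have "((\<lambda>h. (e h - e 0) / h) \<longlongrightarrow> - \<mu>) (at_right 0)"
    proof -
      have "(e has_real_derivative - \<mu>) (at 0)"
        unfolding e_def by (auto intro!: derivative_eq_intros)
      then have "(e has_real_derivative - \<mu>) (at 0 within {0<..})" by (rule DERIV_subset) simp
      then show ?thesis unfolding has_field_derivative_iff by simp
    qed
    then have "\<forall>\<^sub>F h in at_right 0. dist ((e h - e 0) / h) (- \<mu>) < \<epsilon> / (2 * B)"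
      by (rule tendstoD) (use that B in simp)
    moreover have "\<forall>\<^sub>F h in at_right (0::real). h > 0" by (simp add: eventually_at_right_less)
    ultimately have "\<forall>\<^sub>F h in at_right 0. \<forall>q\<in>S. \<bar>G h q\<bar> \<le> \<epsilon> * h"
    proof eventually_elim
      case (elim h)
      show ?case
      proof
        fix q assume q: "q \<in> S"
        define a where "a = (P h \<phi> q - \<phi> q) / h + \<mu> * \<phi> q"
        define b where "b = (e h - e 0) / h + \<mu>"
        have "dist ((P h \<phi> q - \<phi> q) / h) (sub_Laplacian \<phi> q) < \<epsilon> / 2" using elim(1) q by blast
        then have a: "\<bar>a\<bar> < \<epsilon> / 2" using q eigen[of q] by (simp add: a_def dist_real_def S_def)
        have b: "\<bar>b\<bar> < \<epsilon> / (2 * B)" using elim(2) by (auto simp: b_def dist_real_def)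
        have "G h q = h * (a - b * \<phi> q)"
          using elim(3) by (simp add: G_def a_def b_def e_def field_simps)
        moreover have "\<bar>b * \<phi> q\<bar> \<le> \<epsilon> / (2 * B) * B"
          unfolding abs_mult using b B(1)[OF q] B(2) by (intro mult_mono) auto
        then have "\<bar>a - b * \<phi> q\<bar> \<le> \<epsilon>" using a B(2) by (simp add: field_simps)
        ultimately show "\<bar>G h q\<bar> \<le> \<epsilon> * h" using elim(3) by (simp add: abs_mult mult.commute)
      qed
    qed
    then show ?thesis unfolding eventually_at_right_field by auto
  qed
  have semi: "P (s + h) \<phi> q = e h * P s \<phi> q + P s (G h) q" if "s \<ge> 0" "h \<ge> 0" "q \<in> S" for s h q
  proof -
    have "P (s + h) \<phi> q = P s (P h \<phi>) q" using that c\<phi> unfolding S_def by (intro semigroup_add) auto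
    also have "\<dots> = P s (\<lambda>q. e h * \<phi> q + 1 * G h q) q"
      using that c\<phi> cG semigroup_continuous unfolding S_def
      by (intro semigroup_cong) (auto simp: G_def intro!: continuous_intros)
    also have "\<dots> = e h * P s \<phi> q + 1 * P s (G h) q"
      using that c\<phi> cG unfolding S_def by (intro semigroup_linear) auto
    finally show ?thesis by simp
  qed
  have e_add: "e (s + h) = e h * e s" for s h by (simp add: e_def exp_add[symmetric] algebra_simps)
  have e0: "e 0 = 1" by (simp add: e_def)
  have short: "P T \<phi> q = e T * \<phi> q" if T: "0 \<le> T" "T \<le> \<delta>" and q: "q \<in> S" for T q
  proof (cases "T = 0")
    case True
    then show ?thesis using semigroup_zero c\<phi> q e0 unfolding S_def by simp
  next
    case False
    then have "T > 0" using T by simp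
    define R where "R = exp (\<bar>\<mu>\<bar> * T)"
    have "\<bar>G T q\<bar> \<le> 0 + \<epsilon>'" if "\<epsilon>' > 0" for \<epsilon>'
    proof -
      \<comment> \<open>The accumulated error will be at most T M R \<epsilon>. Taking M + 1 keeps
        the denominator positive when M = 0.\<close>
      define \<epsilon> where "\<epsilon> = \<epsilon>' / (T * (M + 1) * R)"
      have TMR: "T * (M + 1) * R > 0" using \<open>T > 0\<close> \<delta> by (simp add: R_def)
      have "\<epsilon> > 0" using that TMR by (simp add: \<epsilon>_def)
      then obtain h0 where "h0 > 0" and h0': "\<forall>h. 0 < h \<and> h < h0 \<longrightarrow> (\<forall>q\<in>S. \<bar>G h q\<bar> \<le> \<epsilon> * h)"
        using small[OF \<open>\<epsilon> > 0\<close>] by metis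
      then have h0: "h0 > 0" "\<And>h q. 0 < h \<Longrightarrow> h < h0 \<Longrightarrow> q \<in> S \<Longrightarrow> \<bar>G h q\<bar> \<le> \<epsilon> * h" by auto
      obtain n where "T / h0 < real n" using reals_Archimedean2 by blast
      then have n: "real (Suc n) > T / h0" by simp
      define h where "h = T / real (Suc n)"
      have h: "h > 0" "h < h0" using \<open>T > 0\<close> n h0(1) by (simp_all add: h_def field_simps)
      define r where "r = exp (\<bar>\<mu>\<bar> * h)"
      have r1: "r \<ge> 1" using h by (simp add: r_def)
      have eh: "\<bar>e h\<bar> \<le> r" using h(1) unfolding e_def r_def by (simp add: abs_if mult_right_mono)
      \<comment> \<open>A discrete Gronwall estimate: a step multiplies the old error by at most r
        and adds at most M \<epsilon> h.\<close>
      have "j \<le> Suc n \<Longrightarrow> \<forall>q\<in>S. \<bar>G (real j * h) q\<bar> \<le> real j * (M * (\<epsilon> * h)) * r ^ j" for j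
      proof (induction j)
        case 0
        then show ?case using semigroup_zero c\<phi> e0 unfolding S_def G_def by simp
      next
        case (Suc j)
        show ?case
        proof
          fix q assume q: "q \<in> S"
          have jh: "0 \<le> real j * h" "real j * h \<le> \<delta>"
          proof -
            show "0 \<le> real j * h" using h by simp
            have "real j * h \<le> real (Suc n) * h" using Suc.prems h by (intro mult_right_mono) auto
            also have "\<dots> = T" by (simp add: h_def del: of_nat_Suc)
            finally show "real j * h \<le> \<delta>" using T by simp
          qed
          have sj: "real (Suc j) * h = real j * h + h" by (simp add: algebra_simps)
          have "G (real (Suc j) * h) q = e h * G (real j * h) q + P (real j * h) (G h) q"
            unfolding sj G_def[of "real j * h + h"] G_def[of "real j * h"]
              semi[OF jh(1) less_imp_le[OF h(1)] q] e_add
            by (simp add: algebra_simps)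
          moreover have "\<bar>P (real j * h) (G h) q\<bar> \<le> M * (\<epsilon> * h)"
            using jh q h h0 by (intro M cG) auto
          moreover have "\<bar>e h * G (real j * h) q\<bar> \<le> r * (real j * (M * (\<epsilon> * h)) * r ^ j)"
            unfolding abs_mult using eh Suc q r1 by (intro mult_mono) auto
          moreover have "M * (\<epsilon> * h) \<le> (M * (\<epsilon> * h)) * r ^ Suc j"
            using mult_left_mono[OF one_le_power[OF r1, of "Suc j"], of "M * (\<epsilon> * h)"] \<delta> \<open>\<epsilon> > 0\<close> h by simp
          ultimately have "\<bar>G (real (Suc j) * h) q\<bar> \<le> r * (real j * (M * (\<epsilon> * h)) * r ^ j) + (M * (\<epsilon> * h)) * r ^ Suc j"
            by linarith
          also have "\<dots> = real (Suc j) * (M * (\<epsilon> * h)) * r ^ Suc j" by (simp add: algebra_simps)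
          finally show "\<bar>G (real (Suc j) * h) q\<bar> \<le> real (Suc j) * (M * (\<epsilon> * h)) * r ^ Suc j" .
        qed
      qed
      from this[of "Suc n"] q have "\<bar>G T q\<bar> \<le> real (Suc n) * (M * (\<epsilon> * h)) * r ^ Suc n"
        by (simp add: h_def del: of_nat_Suc power_Suc)
      also have "r ^ Suc n = R"
        unfolding r_def R_def h_def exp_of_nat_mult[symmetric] by (simp del: of_nat_Suc)
      also have "real (Suc n) * (M * (\<epsilon> * h)) * R = M / (M + 1) * \<epsilon>'"
        using TMR \<delta> \<open>T > 0\<close> unfolding h_def \<epsilon>_def R_def by (simp add: divide_simps del: of_nat_Suc)
      also have "\<dots> \<le> 1 * \<epsilon>'" using \<delta> that by (intro mult_right_mono) auto
      finally show ?thesis by simp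
    qed
    then have "\<bar>G T q\<bar> \<le> 0" by (rule field_le_epsilon)
    then show ?thesis by (simp add: G_def)
  qed
  obtain n where "t / \<delta> < real n" using reals_Archimedean2 by blast
  then have n: "real (Suc n) > t / \<delta>" by simp
  define h where "h = t / real (Suc n)"
  have h: "0 \<le> h" "h \<le> \<delta>" using \<open>t \<ge> 0\<close> n \<delta>(1) by (simp_all add: h_def field_simps)
  have "\<forall>q\<in>S. P (real j * h) \<phi> q = e (real j * h) * \<phi> q" for j
  proof (induction j)
    case 0
    then show ?case using semigroup_zero c\<phi> e0 unfolding S_def by simp
  next
    case (Suc j)
    show ?case
    proof
      fix q assume q: "q \<in> S"
      have jh: "0 \<le> real j * h" using h by simp
      \<comment> \<open>By the short-time case \<open>G h\<close> vanishes on the sphere, hence so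
        does its image.\<close>
      have "P (real j * h) (G h) q = 0"
        using jh h q short cG unfolding S_def by (intro semigroup_null) (auto simp: G_def)
      moreover have "real (Suc j) * h = real j * h + h" by (simp add: algebra_simps)
      ultimately show "P (real (Suc j) * h) \<phi> q = e (real (Suc j) * h) * \<phi> q"
        using semi[OF jh h(1) q] Suc q by (simp add: e_add)
    qed
  qed
  from this[of "Suc n"] assms(4) show ?thesis
    by (simp add: h_def e_def S_def del: of_nat_Suc)
qed

end

section \<open>The sub-Laplacian of zonal functions\<close>

lemma qmult_assoc: "qmult (qmult x y) z = qmult x (qmult y z)"
  by (cases x; cases y; cases z) (simp add: algebra_simps)

lemma qact_qact: "qact g (qact h x) = qact (qmult g h) x"
  by (simp add: qact_def qmult_assoc)

lemma qact_qone: "qact qone x = x"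
proof -
  have "qmult qone y = y" for y by (cases y) (simp add: qone_def)
  then show ?thesis by (simp add: qact_def)
qed

lemma qact_minus: "qact (- g) x = - qact g x"
proof -
  have "qmult (- g) y = - qmult g y" for y by (cases g; cases y) simp
  then show ?thesis by (simp add: qact_def vec_eq_iff)
qed

lemma qunit_mult:
  "qmult qI qI = - qone" "qmult qJ qJ = - qone" "qmult qK qK = - qone"
  "qmult qI qJ = qK" "qmult qJ qK = qI" "qmult qK qI = qJ"
  "qmult qJ qI = - qK" "qmult qK qJ = - qI" "qmult qI qK = - qJ"
  by (simp_all add: qone_def qI_def qJ_def qK_def)

lemma qact_qexp: "qact (qexp S \<theta>) x = cos \<theta> *\<^sub>R x + sin \<theta> *\<^sub>R qact S x"
proof -
  have "qmult (c *\<^sub>R qone + s *\<^sub>R S) y = c *\<^sub>R y + s *\<^sub>R qmult S y" for c s y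
    by (cases S; cases y) (simp add: qone_def algebra_simps)
  then show ?thesis by (simp add: qact_def qexp_def vec_eq_iff prod_eq_iff)
qed

lemma inner_qspace: "x \<bullet> y = (\<Sum>i\<in>UNIV. fst x $ i \<bullet> fst y $ i) + snd x \<bullet> snd y" for x y :: "'n::finite qspace"
  by (cases x, cases y) (simp add: inner_vec_def)

lemma qact_inner:
  assumes "S \<in> {qI, qJ, qK}"
  shows "qact S x \<bullet> y = - (x \<bullet> qact S y)"
proof -
  have "qmult S a \<bullet> b = - (a \<bullet> qmult S b)" for a b
    using assms by (cases a; cases b) (auto simp: qI_def qJ_def qK_def algebra_simps)
  then show ?thesis by (simp add: inner_qspace qact_def sum_negf)
qed

lemma qact_inner_self:
  assumes "S \<in> {qI, qJ, qK}"
  shows "x \<bullet> qact S x = 0" "qact S x \<bullet> x = 0" "qact S x \<bullet> qact S y = x \<bullet> y"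
proof -
  show 0: "x \<bullet> qact S x = 0" using qact_inner[OF assms, of x x] by (simp add: inner_commute)
  then show "qact S x \<bullet> x = 0" by (simp add: inner_commute)
  have "qmult S S = - qone" using assms qunit_mult by auto
  then show "qact S x \<bullet> qact S y = x \<bullet> y"
    using qact_inner[OF assms, of x "qact S y"] by (simp add: qact_qact qact_minus qact_qone)
qed

lemma qact_inner_mixed:
  "qact qI x \<bullet> qact qJ x = 0" "qact qI x \<bullet> qact qK x = 0" "qact qJ x \<bullet> qact qK x = 0"
  by (simp_all add: qact_inner qact_qact qunit_mult qact_minus qact_inner_self)

text \<open>\<open>ucoord b q\<close> and \<open>vcoord b q\<close> are the real part and the squared norm of the quaternionic
  Hermitian product of \<open>q\<close> and \<open>b\<close>.\<close>

definition ucoord :: "'n::finite qspace \<Rightarrow> 'n qspace \<Rightarrow> real" where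
  "ucoord b q = q \<bullet> b"

definition vcoord :: "'n::finite qspace \<Rightarrow> 'n qspace \<Rightarrow> real" where
  "vcoord b q = (q \<bullet> b)\<^sup>2 + (q \<bullet> qact qI b)\<^sup>2 + (q \<bullet> qact qJ b)\<^sup>2 + (q \<bullet> qact qK b)\<^sup>2"

lemma ucoord_commute: "ucoord b q = ucoord q b"
  by (simp add: ucoord_def inner_commute)

lemma vcoord_commute: "vcoord b q = vcoord q b"
proof -
  have "(q \<bullet> qact S b)\<^sup>2 = (b \<bullet> qact S q)\<^sup>2" if "S \<in> {qI, qJ, qK}" for S
    using qact_inner[OF that, of q b] by (simp add: inner_commute)
  then show ?thesis by (simp add: vcoord_def inner_commute)
qed

lemma ucoord_north_pole: "ucoord north_pole q = qRe (snd q)"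
  by (cases q) (auto simp: ucoord_def north_pole_def qRe_def qone_def)

lemma vcoord_north_pole: "vcoord north_pole q = (norm (snd q))\<^sup>2"
proof -
  obtain a b c d where "snd q = (a, b, c, d)" by (metis prod_cases4)
  moreover have "q \<bullet> qact S north_pole = snd q \<bullet> qmult S qone" for S
  proof -
    have "qmult S 0 = 0" by (cases S) (simp add: zero_prod_def)
    then show ?thesis by (simp add: inner_qspace qact_def north_pole_def)
  qed
  moreover have "q \<bullet> north_pole = snd q \<bullet> qone" by (simp add: inner_qspace north_pole_def)
  ultimately show ?thesis
    by (simp add: vcoord_def qone_def qI_def qJ_def qK_def norm_prod_def power2_norm_eq_inner power2_eq_square)
qed

lemma norm_north_pole: "norm north_pole = 1"
  by (simp add: north_pole_def norm_prod_def qone_def)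

text \<open>For a unit vector b this is the orthogonal projection onto the quaternionic line through
  b. It is also half the ambient gradient of \<open>vcoord b\<close> at x, which is how it enters
  the Laplacian.\<close>

definition hproj :: "'n::finite qspace \<Rightarrow> 'n qspace \<Rightarrow> 'n qspace" where
  "hproj b x = (x \<bullet> b) *\<^sub>R b + (x \<bullet> qact qI b) *\<^sub>R qact qI b + (x \<bullet> qact qJ b) *\<^sub>R qact qJ b + (x \<bullet> qact qK b) *\<^sub>R qact qK b"

lemma hproj_inner:
  fixes b x :: "'n::finite qspace"
  assumes b: "norm b = 1"
  shows "x \<bullet> hproj b x = vcoord b x" "hproj b x \<bullet> b = x \<bullet> b" "hproj b x \<bullet> hproj b x = vcoord b x"
proof -
  have bb: "b \<bullet> b = 1" using b by (simp add: dot_square_norm)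
  note orth = qact_inner_self qact_inner_mixed qact_inner_mixed[simplified inner_commute[of "qact _ _" "qact _ _"]]
  show "x \<bullet> hproj b x = vcoord b x" by (simp add: hproj_def vcoord_def inner_add_right power2_eq_square)
  show "hproj b x \<bullet> b = x \<bullet> b" by (simp add: hproj_def inner_add_left orth bb)
  have i: "qact S b \<bullet> qact S' b = (if S = S' then 1 else 0)" if "S \<in> {qI, qJ, qK}" "S' \<in> {qI, qJ, qK}" for S S'
    using that qact_inner_mixed[of b] qact_inner_self(3)[of S b b] bb inner_commute[of "qact S b" "qact S' b"] by auto
  have ne: "qI \<noteq> qJ" "qI \<noteq> qK" "qJ \<noteq> qK" by (auto simp: qI_def qJ_def qK_def)
  show "hproj b x \<bullet> hproj b x = vcoord b x"
    using ne ne[symmetric] by (simp add: hproj_def vcoord_def inner_add_left inner_add_right i bb qact_inner_self power2_eq_square)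
qed

lemma vcoord_le:
  assumes "norm b = 1"
  shows "vcoord b x \<le> (norm x)\<^sup>2"
proof -
  have "0 \<le> (x - hproj b x) \<bullet> (x - hproj b x)" by simp
  then show ?thesis using hproj_inner[OF assms, of x]
    by (simp add: inner_diff_left inner_diff_right inner_commute power2_norm_eq_inner)
qed

lemma ucoord_sq_le: "(ucoord b x)\<^sup>2 \<le> vcoord b x"
  by (simp add: ucoord_def vcoord_def)

text \<open>The four inner products undergo rotations by \<theta> in two coordinate planes. So v is
  constant along the orbits, and the vertical fields see only u.\<close>

lemma vcoord_qact:
  assumes "S \<in> {qI, qJ, qK}"
  shows "vcoord b (cos \<theta> *\<^sub>R q + sin \<theta> *\<^sub>R qact S q) = vcoord b q"
proof -
  define y0 y1 y2 y3 where "y0 = q \<bullet> b" and "y1 = q \<bullet> qact qI b" and "y2 = q \<bullet> qact qJ b" and "y3 = q \<bullet> qact qK b"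
  have rot: "(cos \<theta> * y - sin \<theta> * z)\<^sup>2 + (cos \<theta> * z + sin \<theta> * y)\<^sup>2 = y\<^sup>2 + z\<^sup>2" for y z
  proof -
    have "(cos \<theta> * y - sin \<theta> * z)\<^sup>2 + (cos \<theta> * z + sin \<theta> * y)\<^sup>2 = ((sin \<theta>)\<^sup>2 + (cos \<theta>)\<^sup>2) * (y\<^sup>2 + z\<^sup>2)"
      by algebra
    then show ?thesis by simp
  qed
  show ?thesis
    using assms
    by (auto simp: vcoord_def inner_add_left qact_inner qact_qact qunit_mult qact_minus qact_qone
        simp flip: y0_def y1_def y2_def y3_def)
      (use rot[of y0 y1] rot[of y2 y3] rot[of y0 y2] rot[of y3 y1] rot[of y0 y3] rot[of y1 y2] in linarith)+
qed

text \<open>Parseval's identity for the tangential part of a. It removes the arbitrary choice of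
  basis from every trace.\<close>

lemma tangent_onb_parseval:
  fixes x :: "'a::euclidean_space"
  assumes "norm x = 1"
  shows "(\<Sum>e\<in>tangent_onb x. (e \<bullet> a) * (e \<bullet> c)) = a \<bullet> c - (x \<bullet> a) * (x \<bullet> c)"
    and "finite (tangent_onb x)" "card (tangent_onb x) = DIM('a) - 1"
proof -
  let ?B = "tangent_onb x"
  have B: "pairwise orthogonal ?B" "\<forall>e\<in>?B. norm e = 1" "span ?B = {v. x \<bullet> v = 0}"
    using tangent_onb[of x] by auto
  have ind: "independent ?B" using B(1,2) by (intro pairwise_orthogonal_independent) auto
  then show fin: "finite ?B" by (rule independent_imp_finite)
  have "x \<noteq> 0" using assms by auto
  have "card ?B = dim (span ?B)" using ind by (simp add: dim_eq_card_independent)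
  also have "\<dots> = DIM('a) - 1" unfolding B(3) using dim_hyperplane[OF \<open>x \<noteq> 0\<close>] by simp
  finally show "card ?B = DIM('a) - 1" .
  define a' where "a' = a - (x \<bullet> a) *\<^sub>R x"
  have xx: "x \<bullet> x = 1" using assms by (simp add: dot_square_norm)
  have xe: "x \<bullet> e = 0" if "e \<in> ?B" for e using that B(3) span_base by blast
  have "a' \<in> span ?B" unfolding B(3) by (simp add: a'_def inner_diff_right xx)
  then have a': "(\<Sum>e\<in>?B. (a' \<bullet> e) *\<^sub>R e) = a'" using B fin by (intro orthonormal_basis_expand) auto
  have "e \<bullet> a = a' \<bullet> e" if "e \<in> ?B" for e
    using xe[OF that] by (simp add: a'_def inner_diff_left inner_commute[of e a])
  then have "(\<Sum>e\<in>?B. (e \<bullet> a) * (e \<bullet> c)) = (\<Sum>e\<in>?B. (a' \<bullet> e) * (e \<bullet> c))"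
    by simp
  also have "\<dots> = a' \<bullet> c" by (subst a'[symmetric]) (simp add: inner_sum_left)
  also have "\<dots> = a \<bullet> c - (x \<bullet> a) * (x \<bullet> c)" by (simp add: a'_def inner_diff_left)
  finally show "(\<Sum>e\<in>?B. (e \<bullet> a) * (e \<bullet> c)) = a \<bullet> c - (x \<bullet> a) * (x \<bullet> c)" .
qed

text \<open>A function of two variables together with its partial derivatives up to order two, given
  by chain rules along curves. Equality of the mixed derivatives is built in, as \<open>Guv\<close>
  serves both first derivatives.\<close>

locale jet =
  fixes G Gu Gv Guu Guv Gvv :: "real \<Rightarrow> real \<Rightarrow> real"
  assumes DERIV_G: "\<And>U V U' V' s. (U has_real_derivative U') (at s) \<Longrightarrow> (V has_real_derivative V') (at s) \<Longrightarrow>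
      ((\<lambda>s. G (U s) (V s)) has_real_derivative Gu (U s) (V s) * U' + Gv (U s) (V s) * V') (at s)"
    and DERIV_Gu: "\<And>U V U' V' s. (U has_real_derivative U') (at s) \<Longrightarrow> (V has_real_derivative V') (at s) \<Longrightarrow>
      ((\<lambda>s. Gu (U s) (V s)) has_real_derivative Guu (U s) (V s) * U' + Guv (U s) (V s) * V') (at s)"
    and DERIV_Gv: "\<And>U V U' V' s. (U has_real_derivative U') (at s) \<Longrightarrow> (V has_real_derivative V') (at s) \<Longrightarrow>
      ((\<lambda>s. Gv (U s) (V s)) has_real_derivative Guv (U s) (V s) * U' + Gvv (U s) (V s) * V') (at s)"
begin

lemma deriv2:
  assumes U: "\<And>s. (U has_real_derivative U' s) (at s)" "(U' has_real_derivative U2) (at 0)"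
    and V: "\<And>s. (V has_real_derivative V' s) (at s)" "(V' has_real_derivative V2) (at 0)"
  shows "(deriv ^^ 2) (\<lambda>s. G (U s) (V s)) 0 =
     Guu (U 0) (V 0) * (U' 0)\<^sup>2 + 2 * Guv (U 0) (V 0) * U' 0 * V' 0 + Gvv (U 0) (V 0) * (V' 0)\<^sup>2
     + Gu (U 0) (V 0) * U2 + Gv (U 0) (V 0) * V2"
proof -
  have "deriv (\<lambda>s. G (U s) (V s)) = (\<lambda>s. Gu (U s) (V s) * U' s + Gv (U s) (V s) * V' s)"
    by (rule ext, rule DERIV_imp_deriv, rule DERIV_G) (rule U V)+
  moreover have "((\<lambda>s. Gu (U s) (V s) * U' s + Gv (U s) (V s) * V' s) has_real_derivative
      Guu (U 0) (V 0) * (U' 0)\<^sup>2 + 2 * Guv (U 0) (V 0) * U' 0 * V' 0 + Gvv (U 0) (V 0) * (V' 0)\<^sup>2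
     + Gu (U 0) (V 0) * U2 + Gv (U 0) (V 0) * V2) (at 0)"
    by (rule DERIV_cong[OF DERIV_add[OF DERIV_mult[OF DERIV_Gu[OF U(1) V(1)] U(2)] DERIV_mult[OF DERIV_Gv[OF U(1) V(1)] V(2)]]])
       (simp add: algebra_simps power2_eq_square)
  ultimately show ?thesis by (simp add: numeral_2_eq_2 DERIV_imp_deriv)
qed

text \<open>Along a great circle the inner product with a fixed vector satisfies A'' = -A. The
  second derivative is therefore quadratic in inner products of e with b, its three multiples and
  \<open>w\<close>, up to terms free of e, and Parseval gives the trace. The number 4 n + 3 counts
  the tangent directions.\<close>

lemma sphere_Laplacian_zonal:
  fixes b q :: "'n::finite qspace"
  assumes b: "norm b = 1" and q: "norm q = 1"
  defines "u \<equiv> ucoord b q" and "v \<equiv> vcoord b q"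
  shows "sphere_Laplacian (\<lambda>q. G (ucoord b q) (vcoord b q)) q =
     Guu u v * (1 - u\<^sup>2) + 4 * Guv u v * (u - u * v) + 4 * Gvv u v * (v - v\<^sup>2)
     - (4 * real CARD('n) + 3) * u * Gu u v + Gv u v * (8 - 8 * (real CARD('n) + 1) * v)"
proof -
  define w where "w = hproj b q"
  let ?B = "tangent_onb q"
  define g where "g e = (\<lambda>s. G (ucoord b (cos s *\<^sub>R q + sin s *\<^sub>R e)) (vcoord b (cos s *\<^sub>R q + sin s *\<^sub>R e)))" for e
  have "(deriv ^^ 2) (g e) 0
     = Guu u v * ((e \<bullet> b) * (e \<bullet> b)) + 4 * Guv u v * ((e \<bullet> b) * (e \<bullet> w)) + 4 * Gvv u v * ((e \<bullet> w) * (e \<bullet> w))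
       - u * Gu u v + 2 * Gv u v * ((e \<bullet> b) * (e \<bullet> b) + (e \<bullet> qact qI b) * (e \<bullet> qact qI b)
        + (e \<bullet> qact qJ b) * (e \<bullet> qact qJ b) + (e \<bullet> qact qK b) * (e \<bullet> qact qK b) - v)" for e
  proof -
    define y where "y a = q \<bullet> a" for a
    define z where "z a = e \<bullet> a" for a
    define A where "A a s = cos s * y a + sin s * z a" for a s
    define A' where "A' a s = cos s * z a - sin s * y a" for a s
    have A: "(A a has_real_derivative A' a s) (at s)" for a s
      unfolding A_def A'_def by (auto intro!: derivative_eq_intros)
    have A': "(A' a has_real_derivative - A a s) (at s)" for a s
      unfolding A_def A'_def by (auto intro!: derivative_eq_intros)
    define V where "V s = (A b s)\<^sup>2 + (A (qact qI b) s)\<^sup>2 + (A (qact qJ b) s)\<^sup>2 + (A (qact qK b) s)\<^sup>2" for s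
    define V' where "V' s = 2 * (A b s * A' b s + A (qact qI b) s * A' (qact qI b) s + A (qact qJ b) s * A' (qact qJ b) s
       + A (qact qK b) s * A' (qact qK b) s)" for s
    define Q where "Q a = (A' a 0)\<^sup>2 - (A a 0)\<^sup>2" for a
    have V: "(V has_real_derivative V' s) (at s)" for s
      unfolding V_def V'_def by (auto intro!: derivative_eq_intros A) 
    have V': "(V' has_real_derivative 2 * (Q b + Q (qact qI b) + Q (qact qJ b) + Q (qact qK b))) (at 0)"
      unfolding V'_def Q_def by (auto intro!: derivative_eq_intros A A' simp: power2_eq_square algebra_simps)
    have "g e = (\<lambda>s. G (A b s) (V s))"
      by (simp add: g_def ucoord_def vcoord_def V_def A_def y_def z_def inner_add_left)
    then have "(deriv ^^ 2) (g e) 0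
      = Guu (A b 0) (V 0) * (A' b 0)\<^sup>2 + 2 * Guv (A b 0) (V 0) * A' b 0 * V' 0 + Gvv (A b 0) (V 0) * (V' 0)\<^sup>2
     + Gu (A b 0) (V 0) * (- A b 0) + Gv (A b 0) (V 0) * (2 * (Q b + Q (qact qI b) + Q (qact qJ b) + Q (qact qK b)))"
      using deriv2[OF A A' V V'] by simp
    moreover have "A b 0 = u" "V 0 = v" "A' a 0 = e \<bullet> a" "A a 0 = q \<bullet> a" for a
      by (simp_all add: A_def A'_def V_def u_def v_def ucoord_def vcoord_def y_def z_def)
    moreover have "V' 0 = 2 * (e \<bullet> w)"
      by (simp add: V'_def A_def A'_def y_def z_def w_def hproj_def inner_add_right)
    moreover have "v = (q \<bullet> b)\<^sup>2 + (q \<bullet> qact qI b)\<^sup>2 + (q \<bullet> qact qJ b)\<^sup>2 + (q \<bullet> qact qK b)\<^sup>2"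
      by (simp add: v_def vcoord_def)
    ultimately show ?thesis unfolding Q_def by (simp add: algebra_simps power2_eq_square)
  qed
  then have "sphere_Laplacian (\<lambda>q. G (ucoord b q) (vcoord b q)) q
     = Guu u v * (\<Sum>e\<in>?B. (e \<bullet> b) * (e \<bullet> b)) + 4 * Guv u v * (\<Sum>e\<in>?B. (e \<bullet> b) * (e \<bullet> w))
     + 4 * Gvv u v * (\<Sum>e\<in>?B. (e \<bullet> w) * (e \<bullet> w)) - real (card ?B) * (u * Gu u v)
     + 2 * Gv u v * ((\<Sum>e\<in>?B. (e \<bullet> b) * (e \<bullet> b)) + (\<Sum>e\<in>?B. (e \<bullet> qact qI b) * (e \<bullet> qact qI b))
        + (\<Sum>e\<in>?B. (e \<bullet> qact qJ b) * (e \<bullet> qact qJ b)) + (\<Sum>e\<in>?B. (e \<bullet> qact qK b) * (e \<bullet> qact qK b)) - real (card ?B) * v)"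
    by (simp add: sphere_Laplacian_def g_def sum.distrib sum_subtractf sum_distrib_left[symmetric])
  also have "\<dots> = Guu u v * (1 - u\<^sup>2) + 4 * Guv u v * (u - u * v) + 4 * Gvv u v * (v - v\<^sup>2)
     - (4 * real CARD('n) + 3) * u * Gu u v + Gv u v * (8 - 8 * (real CARD('n) + 1) * v)"
  proof -
    have bb: "b \<bullet> b = 1" using b by (simp add: dot_square_norm)
    have card: "real (card ?B) = 4 * real CARD('n) + 3"
      using tangent_onb_parseval(3)[OF q] by simp
    have w: "b \<bullet> w = u" "w \<bullet> w = v" "q \<bullet> w = v" "q \<bullet> b = u"
      using hproj_inner[OF b, of q] by (simp_all add: w_def u_def v_def ucoord_def inner_commute)
    have v: "v = u\<^sup>2 + (q \<bullet> qact qI b)\<^sup>2 + (q \<bullet> qact qJ b)\<^sup>2 + (q \<bullet> qact qK b)\<^sup>2"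
      by (simp add: v_def vcoord_def u_def ucoord_def)
    have "2 * Gv u v * (1 - u * u + (1 - (q \<bullet> qact qI b) * (q \<bullet> qact qI b)) + (1 - (q \<bullet> qact qJ b) * (q \<bullet> qact qJ b))
        + (1 - (q \<bullet> qact qK b) * (q \<bullet> qact qK b)) - (4 * real CARD('n) + 3) * v) = Gv u v * (8 - 8 * (real CARD('n) + 1) * v)"
      using v by algebra
    then show ?thesis
      unfolding tangent_onb_parseval(1)[OF q] card
      by (simp add: bb w qact_inner_self power2_eq_square algebra_simps)
  qed
  finally show ?thesis .
qed

text \<open>Along the orbit only u varies, with derivative -(q . S b). Since S acts orthogonally,
  the derivative of this quantity is -u.\<close>

lemma vertical_zonal:
  fixes b q :: "'n::finite qspace"
  assumes S: "S \<in> {qI, qJ, qK}"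
  shows "vertical S (vertical S (\<lambda>q. G (ucoord b q) (vcoord b q))) q =
     Guu (ucoord b q) (vcoord b q) * (q \<bullet> qact S b)\<^sup>2 - ucoord b q * Gu (ucoord b q) (vcoord b q)"
proof -
  define A where "A q \<theta> = cos \<theta> * (q \<bullet> b) - sin \<theta> * (q \<bullet> qact S b)" for q \<theta>
  have A: "(A q has_real_derivative - (q \<bullet> qact S b)) (at 0)" for q
    unfolding A_def by (auto intro!: derivative_eq_intros)
  have u: "ucoord b (cos \<theta> *\<^sub>R q + sin \<theta> *\<^sub>R qact S q) = A q \<theta>" for q \<theta>
    by (simp add: ucoord_def A_def inner_add_left qact_inner[OF S])
  have SS: "qact S q \<bullet> qact S b = q \<bullet> b" for q by (rule qact_inner_self(3)[OF S])
  have A0: "A q 0 = ucoord b q" for q by (simp add: A_def ucoord_def)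
  have v1: "vertical S (\<lambda>q. G (ucoord b q) (vcoord b q)) = (\<lambda>q. Gu (ucoord b q) (vcoord b q) * - (q \<bullet> qact S b))"
  proof
    fix q
    show "vertical S (\<lambda>q. G (ucoord b q) (vcoord b q)) q = Gu (ucoord b q) (vcoord b q) * - (q \<bullet> qact S b)"
      unfolding vertical_def qact_qexp u vcoord_qact[OF S]
      by (rule DERIV_imp_deriv, rule DERIV_cong[OF DERIV_G[OF A DERIV_const]]) (simp add: A0)
  qed
  have B: "((\<lambda>\<theta>. - ((cos \<theta> *\<^sub>R q + sin \<theta> *\<^sub>R qact S q) \<bullet> qact S b)) has_real_derivative - (q \<bullet> b)) (at 0)"
    unfolding inner_add_left inner_scaleR_left SS by (auto intro!: derivative_eq_intros)
  show ?thesis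
    unfolding v1 unfolding vertical_def qact_qexp u vcoord_qact[OF S]
    by (rule DERIV_imp_deriv, rule DERIV_cong[OF DERIV_mult[OF DERIV_Gu[OF A DERIV_const] B]])
       (simp add: A0 ucoord_def power2_eq_square)
qed

text \<open>Subtracting the vertical part turns the coefficient 1 - u^2 into 1 - v and 4 n + 3 into
  4 n, so that all second-order coefficients contain the factor 1 - v.\<close>

lemma sub_Laplacian_zonal:
  fixes b q :: "'n::finite qspace"
  assumes b: "norm b = 1" and q: "norm q = 1"
  defines "u \<equiv> ucoord b q" and "v \<equiv> vcoord b q"
  shows "sub_Laplacian (\<lambda>q. G (ucoord b q) (vcoord b q)) q =
     Guu u v * (1 - v) + 4 * u * (1 - v) * Guv u v + 4 * v * (1 - v) * Gvv u v
     - 4 * real CARD('n) * u * Gu u v + Gv u v * (8 - 8 * (real CARD('n) + 1) * v)"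
proof -
  have v: "(q \<bullet> qact qI b)\<^sup>2 + (q \<bullet> qact qJ b)\<^sup>2 + (q \<bullet> qact qK b)\<^sup>2 = v - u\<^sup>2"
    by (simp add: v_def u_def vcoord_def ucoord_def)
  have "sub_Laplacian (\<lambda>q. G (ucoord b q) (vcoord b q)) q = 
    Guu u v * (1 - u\<^sup>2) + 4 * Guv u v * (u - u * v) + 4 * Gvv u v * (v - v\<^sup>2)
     - (4 * real CARD('n) + 3) * u * Gu u v + Gv u v * (8 - 8 * (real CARD('n) + 1) * v)
    - Guu u v * ((q \<bullet> qact qI b)\<^sup>2 + (q \<bullet> qact qJ b)\<^sup>2 + (q \<bullet> qact qK b)\<^sup>2) + 3 * (u * Gu u v)"
    unfolding sub_Laplacian_def sphere_Laplacian_zonal[OF b q]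
    by (simp add: vertical_zonal u_def v_def algebra_simps)
  then show ?thesis unfolding v by (simp add: algebra_simps power2_eq_square)
qed

end

section \<open>Polynomial functions are smooth on the sphere\<close>

lemma polynomial_has_derivative:
  fixes F :: "'a::euclidean_space \<Rightarrow> real"
  assumes "real_polynomial_function F"
  shows "\<exists>F'. (\<forall>x. (F has_derivative F' x) (at x)) \<and> (\<forall>v. real_polynomial_function (\<lambda>x. F' x v))"
  using assms
proof (induction rule: real_polynomial_function.induct)
  case (linear f)
  then show ?case by (intro exI[of _ "\<lambda>_. f"]) (auto intro: bounded_linear_imp_has_derivative real_polynomial_function.intros)
next
  case (const c)
  show ?case by (intro exI[of _ "\<lambda>_ _. 0"]) (auto intro: real_polynomial_function.intros)
next
  case (add f g)
  then obtain f' g' where "\<And>x. (f has_derivative f' x) (at x)" "\<And>v. real_polynomial_function (\<lambda>x. f' x v)"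
    "\<And>x. (g has_derivative g' x) (at x)" "\<And>v. real_polynomial_function (\<lambda>x. g' x v)" by metis
  then show ?case
    by (intro exI[of _ "\<lambda>x v. f' x v + g' x v"]) (auto intro!: has_derivative_add real_polynomial_function.intros(3))
next
  case (mult f g)
  then obtain f' g' where "\<And>x. (f has_derivative f' x) (at x)" "\<And>v. real_polynomial_function (\<lambda>x. f' x v)"
    "\<And>x. (g has_derivative g' x) (at x)" "\<And>v. real_polynomial_function (\<lambda>x. g' x v)" by metis
  with mult show ?case
    by (intro exI[of _ "\<lambda>x v. f x * g' x v + f' x v * g x"]) (auto intro!: has_derivative_mult real_polynomial_function.intros(3,4))
qed

lemma polynomial_Ck_on:
  fixes F :: "'a::euclidean_space \<Rightarrow> real"
  assumes "real_polynomial_function F"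
  shows "Ck_on k F U"
  using assms
proof (induction k arbitrary: F)
  case 0
  then show ?case by (auto intro: continuous_on_polymonial_function simp: real_polynomial_function_eq)
next
  case (Suc k)
  obtain F' where F': "\<And>x. (F has_derivative F' x) (at x)" "\<And>v. real_polynomial_function (\<lambda>x. F' x v)"
    using polynomial_has_derivative[OF Suc.prems] by blast
  have "frechet_derivative F (at x) = F' x" for x
    using frechet_derivative_at[OF F'(1)[of x]] by simp
  then show ?case using Suc.IH F' by (auto simp: differentiable_def)
qed

lemma polynomial_smooth_on_sphere: "real_polynomial_function F \<Longrightarrow> smooth_on_sphere F"
  unfolding smooth_on_sphere_def
  by (intro exI[of _ UNIV] exI[of _ F]) (auto intro: polynomial_Ck_on)

lemma polynomial_coords:
  "real_polynomial_function (ucoord b)" "real_polynomial_function (vcoord b)"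
proof -
  have "real_polynomial_function (\<lambda>q. q \<bullet> a)" for a
    by (intro real_polynomial_function.intros(1) bounded_linear_inner_left)
  then show "real_polynomial_function (ucoord b)" "real_polynomial_function (vcoord b)"
    unfolding ucoord_def[abs_def] vcoord_def[abs_def]
    by (auto intro!: real_polynomial_function.intros(3) real_polynomial_function_power)
qed

section \<open>Integration over the sphere\<close>

lemma sets_sphere_volume [simp, measurable_cong]: "sets sphere_volume = sets borel"
  by (simp add: sphere_volume_def)

lemma space_sphere_volume [simp]: "space sphere_volume = UNIV"
  by (simp add: sphere_volume_def space_scale_measure)

lemma emeasure_sphere_volume:
  assumes [measurable]: "A \<in> sets borel"
  shows "emeasure (sphere_volume :: 'a::euclidean_space measure) A =
     of_nat DIM('a) * emeasure lborel {x. sgn x \<in> A \<and> norm x < 1}"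
proof -
  have "sgn -` A \<inter> space (restrict_space lborel (ball (0::'a) 1)) = {x. sgn x \<in> A \<and> norm x < 1}"
    by (auto simp: space_restrict_space)
  moreover have "(sgn :: 'a \<Rightarrow> 'a) \<in> measurable (restrict_space lborel (ball 0 1)) borel"
    by (intro measurable_restrict_space1) simp
  moreover have "emeasure (restrict_space lborel (ball (0::'a) 1)) {x. sgn x \<in> A \<and> norm x < 1}
     = emeasure lborel {x. sgn x \<in> A \<and> norm x < 1}"
    by (intro emeasure_restrict_space) auto
  ultimately show ?thesis
    unfolding sphere_volume_def by (simp add: emeasure_distr)
qed

lemma emeasure_cone:
  assumes [measurable]: "A \<in> sets borel" and "R > 0"
  shows "emeasure lborel {x::'a::euclidean_space. sgn x \<in> A \<and> norm x < R}
     = ennreal (R ^ DIM('a)) * emeasure lborel {x::'a. sgn x \<in> A \<and> norm x < 1}"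
proof -
  have "(\<lambda>x::'a. 0 + R *\<^sub>R x) -` {x. sgn x \<in> A \<and> norm x < R} = {x. sgn x \<in> A \<and> norm x < 1}"
    using \<open>R > 0\<close> by (auto simp: sgn_scaleR)
  then show ?thesis
    using \<open>R > 0\<close> by (subst lborel_affine[of R "0::'a"]) (auto simp: emeasure_density_const emeasure_distr)
qed

section \<open>Polar coordinates for Lebesgue measure\<close>

definition radial_measure :: "nat \<Rightarrow> real measure" where
  "radial_measure d = density lborel (\<lambda>r. ennreal (r ^ (d - 1) * indicator {0..} r))"

lemma sets_radial_measure [simp, measurable_cong]: "sets (radial_measure d) = sets borel"
  by (simp add: radial_measure_def)

lemma space_radial_measure [simp]: "space (radial_measure d) = UNIV"
  by (simp add: radial_measure_def)

lemma emeasure_radial_lessThan: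
  assumes "d > 0"
  shows "emeasure (radial_measure d) {..<R} = ennreal (if R > 0 then R ^ d / d else 0)"
proof -
  have eq: "emeasure (radial_measure d) {..<R} = (\<integral>\<^sup>+r. ennreal (r ^ (d - 1) * indicator {0..} r) * indicator {..<R} r \<partial>lborel)"
    unfolding radial_measure_def by (subst emeasure_density) auto
  show ?thesis
  proof (cases "R > 0")
    case True
    have "emeasure (radial_measure d) {..<R} = (\<integral>\<^sup>+r. ennreal (r ^ (d - 1)) * indicator {0..R} r \<partial>lborel)"
      unfolding eq
      by (rule nn_integral_cong_AE, use AE_lborel_singleton[of R] in eventually_elim) (auto simp: indicator_def)
    also have "\<dots> = ennreal (R ^ d / d - 0 ^ d / d)"
      by (rule nn_integral_FTC_Icc) (use True assms in \<open>auto intro!: derivative_eq_intros\<close>)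
    finally show ?thesis using True assms by (simp add: zero_power)
  next
    case False
    then have "emeasure (radial_measure d) {..<R} = (\<integral>\<^sup>+(r::real). 0 \<partial>lborel)"
      unfolding eq by (intro nn_integral_cong) (auto simp: indicator_def)
    then show ?thesis using False by simp
  qed
qed

interpretation sphere_volume: finite_measure "sphere_volume :: 'a::euclidean_space measure"
proof
  have "emeasure (sphere_volume :: 'a measure) UNIV = of_nat DIM('a) * emeasure lborel (ball (0::'a) 1)"
    by (subst emeasure_sphere_volume) (auto simp: ball_def dist_norm)
  also have "\<dots> \<noteq> \<infinity>"
    using emeasure_lborel_ball_finite[of "0::'a" 1] by (simp add: ennreal_mult_eq_top_iff)
  finally show "emeasure (sphere_volume :: 'a measure) (space sphere_volume) \<noteq> \<infinity>" by simp
qed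

lemma sigma_finite_radial_measure: "sigma_finite_measure (radial_measure d)"
  unfolding radial_measure_def
  by (subst sigma_finite_measure.sigma_finite_iff_density_finite[OF sigma_finite_lborel]) auto

text \<open>It suffices to compare rectangles. For fixed A both sides are measures in the radius,
  determined by the intervals below R, where the claim is the scaling of a cone by R^d. The factor d
  in \<open>sphere_volume\<close> cancels the denominator of R^d / d.\<close>

theorem lborel_polar:
  "distr lborel (borel \<Otimes>\<^sub>M borel) (\<lambda>x::'a::euclidean_space. (sgn x, norm x)) =
     sphere_volume \<Otimes>\<^sub>M radial_measure DIM('a)"
proof (rule pair_measure_eqI[symmetric])
  show "sigma_finite_measure (sphere_volume :: 'a measure)" by (rule sphere_volume.sigma_finite_measure_axioms)
  show "sigma_finite_measure (radial_measure DIM('a))" by (rule sigma_finite_radial_measure)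
  show "sets (sphere_volume \<Otimes>\<^sub>M radial_measure DIM('a)) = sets (distr lborel (borel \<Otimes>\<^sub>M borel) (\<lambda>x::'a. (sgn x, norm x)))"
    unfolding sets_distr by (rule sets_pair_measure_cong) auto
  fix A :: "'a set" and B :: "real set"
  assume "A \<in> sets sphere_volume" "B \<in> sets (radial_measure DIM('a))"
  then have [measurable]: "A \<in> sets borel" "B \<in> sets borel" by auto
  define M where "M = distr (density lborel (indicator {x. sgn x \<in> A})) borel (norm :: 'a \<Rightarrow> real)"
  define N where "N = scale_measure (emeasure sphere_volume A) (radial_measure DIM('a))"
  have M: "emeasure M B = emeasure lborel {x. sgn x \<in> A \<and> norm x \<in> B}" if [measurable]: "B \<in> sets borel" for B
  proof -
    have [measurable]: "(norm :: 'a \<Rightarrow> real) -` B \<in> sets borel" by (rule measurable_sets_borel[where M = borel]) auto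
    have "emeasure M B = (\<integral>\<^sup>+x. indicator {x. sgn x \<in> A} x * indicator (norm -` B) x \<partial>lborel)"
      unfolding M_def by (subst emeasure_distr) (auto simp: emeasure_density)
    also have "\<dots> = (\<integral>\<^sup>+x. indicator {x. sgn x \<in> A \<and> norm x \<in> B} x \<partial>lborel)"
      by (intro nn_integral_cong) (auto simp: indicator_def)
    finally show ?thesis by simp
  qed
  have "M = N"
  proof (rule measure_eqI_generator_eq[where E = "range lessThan" and \<Omega> = UNIV and A = "\<lambda>i. {..<real i}"])
    have "{..<a} \<inter> {..<b} = {..<min a b}" for a b :: real by auto
    then show "Int_stable (range (lessThan :: real \<Rightarrow> _))"
      by (auto simp: Int_stable_def)
    have "sets borel = sigma_sets UNIV (range (lessThan :: real \<Rightarrow> _))"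
      unfolding borel_Iio by (rule sets_measure_of) auto
    then show "sets M = sigma_sets UNIV (range lessThan)" "sets N = sigma_sets UNIV (range lessThan)"
      by (simp_all add: M_def N_def)
    show "(\<Union>i. {..<real i}) = UNIV" using reals_Archimedean2 by auto
    show eq: "emeasure M X = emeasure N X" if "X \<in> range lessThan" for X
    proof -
      obtain R where X: "X = {..<R}" using \<open>X \<in> range lessThan\<close> by auto
      show ?thesis
      proof (cases "R > 0")
        case True
        have "emeasure N X = of_nat DIM('a) * emeasure lborel {x::'a. sgn x \<in> A \<and> norm x < 1} * ennreal (R ^ DIM('a) / DIM('a))"
          using True by (simp add: N_def X emeasure_sphere_volume emeasure_radial_lessThan)
        also have "\<dots> = (of_nat DIM('a) * ennreal (R ^ DIM('a) / DIM('a))) * emeasure lborel {x::'a. sgn x \<in> A \<and> norm x < 1}"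
          by (simp only: mult_ac)
        also have "of_nat DIM('a) * ennreal (R ^ DIM('a) / DIM('a)) = ennreal (R ^ DIM('a))"
          using True by (simp add: ennreal_of_nat_eq_real_of_nat ennreal_mult[symmetric])
        finally have "emeasure N X = ennreal (R ^ DIM('a)) * emeasure lborel {x::'a. sgn x \<in> A \<and> norm x < 1}" .
        moreover have "emeasure M X = emeasure lborel {x. sgn x \<in> A \<and> norm x < R}"
          using M[of X] by (simp add: X)
        ultimately show ?thesis using emeasure_cone[OF \<open>A \<in> sets borel\<close> True] by (simp only:)
      next
        case False
        then have "\<not> norm x < R" for x :: 'a using norm_ge_zero[of x] by linarith
        then have "{x. sgn x \<in> A \<and> norm x < R} = {}" by blast
        moreover have "emeasure M X = emeasure lborel {x. sgn x \<in> A \<and> norm x < R}"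
          using M[of X] by (simp add: X)
        ultimately have "emeasure M X = 0" by (simp only: emeasure_empty)
        then show ?thesis using False by (simp add: X N_def emeasure_radial_lessThan)
      qed
    qed
    fix i :: nat
    have "emeasure sphere_volume A < top" by (simp add: top.not_eq_extremum[symmetric])
    then have "emeasure N {..<real i} < \<infinity>"
      by (simp add: N_def emeasure_radial_lessThan ennreal_mult_less_top top.not_eq_extremum)
    then show "emeasure M {..<real i} \<noteq> \<infinity>" using eq[of "{..<real i}"] by simp
  qed auto
  then have "emeasure N B = emeasure lborel {x. sgn x \<in> A \<and> norm x \<in> B}" using M[of B] by simp
  moreover have "emeasure (distr lborel (borel \<Otimes>\<^sub>M borel) (\<lambda>x::'a. (sgn x, norm x))) (A \<times> B)
      = emeasure lborel {x. sgn x \<in> A \<and> norm x \<in> B}"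
    by (subst emeasure_distr) (auto intro!: arg_cong[where f = "emeasure lborel"])
  ultimately show "emeasure sphere_volume A * emeasure (radial_measure DIM('a)) B =
     emeasure (distr lborel (borel \<Otimes>\<^sub>M borel) (\<lambda>x::'a. (sgn x, norm x))) (A \<times> B)"
    by (simp add: N_def)
qed

lemma integral_pair_mult:
  fixes f :: "'a \<Rightarrow> real" and g :: "'b \<Rightarrow> real"
  assumes "sigma_finite_measure M" "sigma_finite_measure N" and f: "integrable M f" and g: "integrable N g"
  shows "integrable (M \<Otimes>\<^sub>M N) (\<lambda>(x, y). f x * g y)"
    and "integral\<^sup>L (M \<Otimes>\<^sub>M N) (\<lambda>(x, y). f x * g y) = integral\<^sup>L M f * integral\<^sup>L N g"
proof -
  interpret M: sigma_finite_measure M by fact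
  interpret N: sigma_finite_measure N by fact
  interpret P: pair_sigma_finite M N ..
  have [measurable]: "f \<in> borel_measurable M" "g \<in> borel_measurable N" using f g by auto
  show int: "integrable (M \<Otimes>\<^sub>M N) (\<lambda>(x, y). f x * g y)"
    using f g by (intro P.Fubini_integrable) (auto simp: abs_mult)
  from P.integral_fst[OF int] show "integral\<^sup>L (M \<Otimes>\<^sub>M N) (\<lambda>(x, y). f x * g y) = integral\<^sup>L M f * integral\<^sup>L N g"
    by simp
qed

lemma polar_integral:
  fixes f :: "'a::euclidean_space \<Rightarrow> real"
  assumes f: "integrable sphere_volume f" and g: "integrable (radial_measure DIM('a)) g"
  shows "integrable lborel (\<lambda>x. f (sgn x) * g (norm x))"
    and "(LINT x|lborel. f (sgn x) * g (norm x)) = integral\<^sup>L sphere_volume f * integral\<^sup>L (radial_measure DIM('a)) g"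
proof -
  have S: "sigma_finite_measure (sphere_volume :: 'a measure)" by (rule sphere_volume.sigma_finite_measure_axioms)
  have [measurable]: "f \<in> borel_measurable borel" "g \<in> borel_measurable borel"
    using f g by (auto dest!: borel_measurable_integrable cong: measurable_cong_sets)
  note int = integral_pair_mult[OF S sigma_finite_radial_measure f g]
  have m: "(\<lambda>(x, y). f x * g y) \<in> borel_measurable (borel \<Otimes>\<^sub>M borel)" by measurable
  show "integrable lborel (\<lambda>x. f (sgn x) * g (norm x))"
    using int(1) unfolding lborel_polar[symmetric] by (subst (asm) integrable_distr_eq) (use m in auto)
  show "(LINT x|lborel. f (sgn x) * g (norm x)) = integral\<^sup>L sphere_volume f * integral\<^sup>L (radial_measure DIM('a)) g"
    using int(2) unfolding lborel_polar[symmetric] by (subst (asm) integral_distr) (use m in auto)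
qed

definition radial_moment :: "nat \<Rightarrow> nat \<Rightarrow> real" where
  "radial_moment d N = (LINT r|radial_measure d. r ^ N * exp (- r\<^sup>2))"

text \<open>With the weight r^(d-1) the integrand has the power j = N + d - 1 of r. Odd j give
  factorials; for even j a factor sqrt \<pi> appears and only positivity is recorded.\<close>

lemma radial_moment:
  assumes "d > 0"
  shows integrable_radial: "integrable (radial_measure d) (\<lambda>r. r ^ N * exp (- r\<^sup>2))"
    and radial_moment_pos: "radial_moment d N > 0"
    and radial_moment_even: "N + d = 2 * k + 2 \<Longrightarrow> radial_moment d N = fact k / 2"
proof -
  define j where "j = N + (d - 1)"
  define I where "I = (if even j then (sqrt pi / 2) * (fact j / (2 ^ j * fact (j div 2))) else fact (j div 2) / 2)"
  have "has_bochner_integral lborel (\<lambda>x::real. indicator {0..} x *\<^sub>R (exp (- x\<^sup>2) * x ^ j)) I"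
  proof (cases "even j")
    case True
    then obtain i where "j = 2 * i" by auto
    then show ?thesis using gaussian_moment_even_pos[of i] by (simp add: I_def)
  next
    case False
    then obtain i where "j = 2 * i + 1" by (auto elim: oddE)
    then show ?thesis using gaussian_moment_odd_pos[of i] by (simp add: I_def)
  qed
  moreover have "indicator {0..} x *\<^sub>R (exp (- x\<^sup>2) * x ^ j) = (x ^ (d - 1) * indicator {0..} x) *\<^sub>R (x ^ N * exp (- x\<^sup>2))" for x :: real
    by (simp add: j_def power_add)
  ultimately have I: "has_bochner_integral lborel (\<lambda>x. (x ^ (d - 1) * indicator {0..} x) *\<^sub>R (x ^ N * exp (- x\<^sup>2))) I"
    by (simp only:)
  have nn: "AE x in lborel. 0 \<le> x ^ (d - 1) * indicator {0..} (x::real)" by (auto simp: indicator_def)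
  show "integrable (radial_measure d) (\<lambda>r. r ^ N * exp (- r\<^sup>2))"
    unfolding radial_measure_def using I nn by (subst integrable_density) (auto simp: has_bochner_integral_iff)
  have eq: "radial_moment d N = I"
    unfolding radial_moment_def radial_measure_def
    using I nn by (subst integral_density) (auto simp: has_bochner_integral_iff)
  then show "radial_moment d N > 0" by (simp add: I_def)
  assume "N + d = 2 * k + 2"
  then have "j = 2 * k + 1" using assms by (simp add: j_def)
  then show "radial_moment d N = fact k / 2" unfolding eq I_def by simp
qed

definition sphere_int :: "('a::euclidean_space \<Rightarrow> real) \<Rightarrow> real" where
  "sphere_int f = (LINT q:sphere 0 1|sphere_volume. f q)"

lemma set_integrable_sphere:
  fixes f :: "'a::euclidean_space \<Rightarrow> real"
  assumes "continuous_sphere f"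
  shows "set_integrable sphere_volume (sphere 0 1) f"
proof -
  have "compact (f ` sphere 0 1)" by (intro compact_continuous_image assms) simp
  then have "bounded (f ` sphere 0 1)" by (rule compact_imp_bounded)
  then obtain B where "\<forall>y\<in>f ` sphere 0 1. norm y \<le> B" unfolding bounded_iff by blast
  then have B: "\<bar>f x\<bar> \<le> B" if "x \<in> sphere 0 1" for x using that by auto
  have "(\<lambda>x. indicator (sphere 0 1) x *\<^sub>R f x) \<in> borel_measurable borel"
    by (rule borel_measurable_continuous_on_indicator) (auto intro: assms)
  moreover have "norm (indicator (sphere 0 1) x *\<^sub>R f x) \<le> \<bar>B\<bar>" for x
    using B[of x] by (auto simp: indicator_def)
  ultimately show ?thesis unfolding set_integrable_def
    by (intro sphere_volume.integrable_const_bound[of _ "\<bar>B\<bar>"]) (auto cong: measurable_cong_sets)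
qed

lemma sphere_int_add:
  assumes "continuous_sphere f" "continuous_sphere g"
  shows "sphere_int (\<lambda>x. f x + g x) = sphere_int f + sphere_int g"
  unfolding sphere_int_def using set_integral_add(2)[OF assms[THEN set_integrable_sphere]] .

lemma sphere_int_diff:
  assumes "continuous_sphere f" "continuous_sphere g"
  shows "sphere_int (\<lambda>x. f x - g x) = sphere_int f - sphere_int g"
  unfolding sphere_int_def using set_integral_diff(2)[OF assms[THEN set_integrable_sphere]] .

lemma sphere_int_cmult: "sphere_int (\<lambda>x. c * f x) = c * sphere_int f"
  unfolding sphere_int_def by simp

lemma sphere_int_cong: "(\<And>x. x \<in> sphere 0 1 \<Longrightarrow> f x = g x) \<Longrightarrow> sphere_int f = sphere_int g"
  unfolding sphere_int_def by (intro set_lebesgue_integral_cong) auto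

lemma sphere_int_mono:
  assumes "continuous_sphere f" "continuous_sphere g" "\<And>x. x \<in> sphere 0 1 \<Longrightarrow> f x \<le> g x"
  shows "sphere_int f \<le> sphere_int g"
  unfolding sphere_int_def
  by (rule set_integral_mono[OF assms(1,2)[THEN set_integrable_sphere]]) (use assms(3) in auto)

lemma sphere_int_one:
  "sphere_int (\<lambda>_::'a::euclidean_space. 1) = DIM('a) * unit_ball_vol DIM('a)"
proof -
  have "{x::'a. sgn x \<in> sphere 0 1 \<and> norm x < 1} = ball 0 1 - {0}"
    by (auto simp: norm_sgn ball_def dist_norm)
  then have "emeasure (sphere_volume :: 'a measure) (sphere 0 1) = of_nat DIM('a) * emeasure lborel (ball (0::'a) 1 - {0})"
    by (subst emeasure_sphere_volume) auto
  also have "emeasure lborel (ball (0::'a) 1 - {0}) = emeasure lborel (ball (0::'a) 1)"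
    by (subst emeasure_Diff) auto
  also have "of_nat DIM('a) * \<dots> = ennreal (DIM('a) * unit_ball_vol DIM('a))"
    by (simp add: emeasure_ball ennreal_of_nat_eq_real_of_nat ennreal_mult)
  finally show ?thesis
    unfolding sphere_int_def set_lebesgue_integral_def by (simp add: measure_def)
qed

text \<open>On a cap around a the function is at least f(a) / 2, and the cap has positive volume
  because the part of its cone in the punctured ball is open and nonempty.\<close>

lemma sphere_int_pos:
  fixes f :: "'a::euclidean_space \<Rightarrow> real"
  assumes "continuous_sphere f" "\<And>x. x \<in> sphere 0 1 \<Longrightarrow> 0 \<le> f x" "a \<in> sphere 0 1" "f a > 0"
  shows "sphere_int f > 0"
proof -
  define c where "c = f a / 2"
  have c: "c > 0" "c < f a" using assms by (simp_all add: c_def)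
  obtain \<delta> where \<delta>: "\<delta> > 0" "\<And>x. x \<in> sphere 0 1 \<Longrightarrow> dist x a < \<delta> \<Longrightarrow> dist (f x) (f a) < c"
    using assms(1,3) c unfolding continuous_on_iff by metis
  define A where "A = sphere 0 1 \<inter> ball a \<delta>"
  have A [measurable]: "A \<in> sets borel" unfolding A_def by auto
  have fA: "c \<le> f x" if "x \<in> A" for x
  proof -
    have "dist (f x) (f a) < c" using \<delta>(2)[of x] that by (auto simp: A_def dist_commute)
    then show ?thesis unfolding c_def dist_real_def by linarith
  qed
  have "open ((\<lambda>x::'a. sgn x) -` ball a \<delta> \<inter> (ball 0 1 - {0}))"
    by (subst Int_commute, rule continuous_open_preimage) (auto intro!: continuous_intros simp: sgn_div_norm)
  moreover have "(1 / 2) *\<^sub>R a \<in> (\<lambda>x. sgn x) -` ball a \<delta> \<inter> (ball 0 1 - {0})"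
    using assms(3) \<delta>(1) by (auto simp: sgn_scaleR) (simp add: sgn_div_norm)
  ultimately have "\<not> negligible ((\<lambda>x::'a. sgn x) -` ball a \<delta> \<inter> (ball 0 1 - {0}))"
    by (intro open_not_negligible) auto
  moreover have eq: "(\<lambda>x::'a. sgn x) -` ball a \<delta> \<inter> (ball 0 1 - {0}) = {x. sgn x \<in> A \<and> norm x < 1}"
    by (auto simp: A_def norm_sgn split: if_splits)
  ultimately have "\<not> negligible {x. sgn x \<in> A \<and> norm x < 1}" by simp
  moreover have "{x. sgn x \<in> A \<and> norm x < 1} \<in> sets lborel" by simp
  ultimately have "emeasure lborel {x. sgn x \<in> A \<and> norm x < 1} \<noteq> 0"
    by (auto simp: negligible_iff_null_sets null_sets_def)
  then have "emeasure (sphere_volume :: 'a measure) A \<noteq> 0"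
    by (simp add: emeasure_sphere_volume)
  then have "measure sphere_volume A > 0"
    by (simp add: sphere_volume.emeasure_eq_measure zero_less_measure_iff)
  then have "0 < c * measure sphere_volume A" using c by simp
  also have "\<dots> = (LINT x|sphere_volume. c * indicator A x)" by simp
  also have "\<dots> \<le> (LINT x|sphere_volume. indicator (sphere 0 1) x *\<^sub>R f x)"
  proof (rule integral_mono)
    show "integrable sphere_volume (\<lambda>x. c * indicator A x)"
      by (intro integrable_mult_right integrable_real_indicator) (auto simp: sphere_volume.emeasure_eq_measure)
    show "integrable sphere_volume (\<lambda>x. indicator (sphere 0 1) x *\<^sub>R f x)"
      using set_integrable_sphere[OF assms(1)] by (simp add: set_integrable_def)
    show "c * indicator A x \<le> indicator (sphere 0 1) x *\<^sub>R f x" for x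
      using fA[of x] assms(2)[of x] by (auto simp: indicator_def A_def)
  qed
  finally show ?thesis by (simp add: sphere_int_def set_lebesgue_integral_def)
qed

section \<open>Gaussian integrals and moments on the sphere\<close>

abbreviation (input) gauss :: "'a::real_normed_vector \<Rightarrow> real" where
  "gauss x \<equiv> exp (- (norm x)\<^sup>2)"

text \<open>A homogeneous function separates in polar coordinates. Integrals over spheres of
  different dimensions can thus be compared through Gaussian integrals, which factorise over
  products.\<close>

lemma gaussian_homogeneous:
  fixes F :: "'a::euclidean_space \<Rightarrow> real"
  assumes "continuous_on UNIV F" and hom: "\<And>x. F x = norm x ^ N * F (sgn x)"
  shows "integrable lborel (\<lambda>x. F x * gauss x)"
    and "(LINT x|lborel. F x * gauss x) = sphere_int F * radial_moment DIM('a) N"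
proof -
  define f where "f x = indicator (sphere 0 1) x *\<^sub>R F x" for x
  have f: "integrable sphere_volume f"
    using set_integrable_sphere[of F] continuous_on_subset[OF assms(1)] by (simp add: f_def[abs_def] set_integrable_def)
  note p = polar_integral[OF f integrable_radial[OF DIM_positive, of N]]
  have ae: "AE x in lborel. f (sgn x) * (norm x ^ N * gauss x) = F x * gauss x"
    using AE_lborel_singleton[of "0::'a"]
  proof eventually_elim
    case (elim x)
    then show ?case using hom[of x] by (simp add: f_def norm_sgn)
  qed
  have [measurable]: "F \<in> borel_measurable borel" "f \<in> borel_measurable borel"
    using assms(1) f by (auto intro: borel_measurable_continuous_onI dest!: borel_measurable_integrable cong: measurable_cong_sets)
  show "integrable lborel (\<lambda>x. F x * gauss x)"
    using p(1) by (rule integrable_cong_AE_imp) (use ae in auto)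
  have "(LINT x|lborel. F x * gauss x) = (LINT x|lborel. f (sgn x) * (norm x ^ N * gauss x))"
    by (rule integral_cong_AE) (use ae in auto)
  then show "(LINT x|lborel. F x * gauss x) = sphere_int F * radial_moment DIM('a) N"
    unfolding p(2) by (simp add: sphere_int_def set_lebesgue_integral_def f_def[abs_def] radial_moment_def)
qed

abbreviation (input) gauss_moment :: "'a::euclidean_space \<Rightarrow> nat \<Rightarrow> real" where
  "gauss_moment b j \<equiv> (LINT x|lborel. (x \<bullet> b) ^ j * gauss x)"

lemma gaussian_ridge_homogeneous:
  fixes b :: "'a::euclidean_space"
  shows "integrable lborel (\<lambda>x. (x \<bullet> b) ^ j * gauss x)"
    and "gauss_moment b j = sphere_int (\<lambda>x. (x \<bullet> b) ^ j) * radial_moment DIM('a) j"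
proof -
  have hom: "(x \<bullet> b) ^ j = norm x ^ j * (sgn x \<bullet> b) ^ j" for x
    by (cases "x = 0") (simp_all add: sgn_div_norm power_mult_distrib[symmetric] mult.assoc[symmetric])
  have "continuous_on UNIV (\<lambda>x. (x \<bullet> b) ^ j)" by (intro continuous_intros)
  from gaussian_homogeneous[OF this hom]
  show "integrable lborel (\<lambda>x. (x \<bullet> b) ^ j * gauss x)"
    "gauss_moment b j = sphere_int (\<lambda>x. (x \<bullet> b) ^ j) * radial_moment DIM('a) j"
    by auto
qed

text \<open>Kept as an unevaluated constant; \<open>sphere_int_hcheb\<close> eliminates it by means
  of the volume of the sphere.\<close>

definition gaussian_mass :: "'a::euclidean_space itself \<Rightarrow> real" where
  "gaussian_mass _ = (LINT x|lborel. gauss (x::'a))"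

lemma gaussian_mass: "integrable lborel (\<lambda>x::'a::euclidean_space. gauss x)" "gaussian_mass TYPE('a) > 0"
proof -
  show "integrable lborel (\<lambda>x::'a. gauss x)" using gaussian_ridge_homogeneous(1)[of 0 0] by simp
  have "gaussian_mass TYPE('a) = sphere_int (\<lambda>_::'a. 1) * radial_moment DIM('a) 0"
    using gaussian_ridge_homogeneous(2)[of "0::'a" 0] by (simp add: gaussian_mass_def)
  then show "gaussian_mass TYPE('a) > 0"
    by (simp add: sphere_int_one radial_moment_pos)
qed

text \<open>Completing the square and translating identifies the moment generating function of
  \<open>x \<bullet> b\<close> under the Gaussian measure, without appeal to its rotation invariance.\<close>

lemma gaussian_mgf:
  fixes b :: "'a::euclidean_space"
  assumes "norm b = 1"
  shows "integrable lborel (\<lambda>x. exp (s * (x \<bullet> b)) * gauss x)"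
    and "(LINT x|lborel. exp (s * (x \<bullet> b)) * gauss x) = exp (s\<^sup>2 / 4) * gaussian_mass TYPE('a)"
proof -
  define c where "c = - (s / 2) *\<^sub>R b"
  have eq: "exp (s * (x \<bullet> b)) * gauss x = exp (s\<^sup>2 / 4) * gauss (c + x)" for x
  proof -
    have "b \<bullet> b = 1" using assms by (simp add: dot_square_norm)
    then have "s * (x \<bullet> b) - (norm x)\<^sup>2 = s\<^sup>2 / 4 - (norm (c + x))\<^sup>2"
      unfolding power2_norm_eq_inner c_def
      by (simp add: inner_add_left inner_add_right inner_commute power2_eq_square algebra_simps)
    then show ?thesis by (simp flip: exp_add)
  qed
  have "integrable (distr lborel borel ((+) c)) (\<lambda>x::'a. gauss x)"
    unfolding lborel_distr_plus by (rule gaussian_mass)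
  then have i: "integrable lborel (\<lambda>x. gauss (c + x))"
    by (subst (asm) integrable_distr_eq) auto
  then show "integrable lborel (\<lambda>x. exp (s * (x \<bullet> b)) * gauss x)" unfolding eq by simp
  have "gaussian_mass TYPE('a) = (LINT x|distr lborel borel ((+) c). gauss (x::'a))"
    unfolding lborel_distr_plus gaussian_mass_def ..
  also have "\<dots> = (LINT x|lborel. gauss (c + x))" by (subst integral_distr) auto
  finally show "(LINT x|lborel. exp (s * (x \<bullet> b)) * gauss x) = exp (s\<^sup>2 / 4) * gaussian_mass TYPE('a)"
    unfolding eq by simp
qed

text \<open>The exponential series is integrated term by term. The partial sums are dominated by exp
  |y|, hence by exp y + exp (- y), both integrable against the Gaussian.\<close>

lemma gaussian_ridge_sums:
  fixes b :: "'a::euclidean_space"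
  assumes "norm b = 1"
  shows "(\<lambda>j. gauss_moment b j / fact j * s ^ j) sums (exp (s\<^sup>2 / 4) * gaussian_mass TYPE('a))"
proof -
  define f where "f n x = (\<Sum>j<n. (s * (x \<bullet> b)) ^ j / fact j) * gauss x" for n and x :: 'a
  have "(\<lambda>n. LINT x|lborel. f n x) \<longlonglongrightarrow> (LINT x|lborel. exp (s * (x \<bullet> b)) * gauss x)"
  proof (rule integral_dominated_convergence)
    show "integrable lborel (\<lambda>x. exp (s * (x \<bullet> b)) * gauss x + exp (- s * (x \<bullet> b)) * gauss x)"
      by (intro Bochner_Integration.integrable_add gaussian_mgf assms)
    show "AE x in lborel. (\<lambda>n. f n x) \<longlonglongrightarrow> exp (s * (x \<bullet> b)) * gauss x"
    proof (rule AE_I2)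
      fix x
      have "(\<lambda>j. (s * (x \<bullet> b)) ^ j / fact j) sums exp (s * (x \<bullet> b))"
        using exp_converges[of "s * (x \<bullet> b)"] by (simp add: field_simps)
      then show "(\<lambda>n. f n x) \<longlonglongrightarrow> exp (s * (x \<bullet> b)) * gauss x"
        unfolding f_def sums_def by (intro tendsto_mult tendsto_const)
    qed
    fix n
    have "norm (f n x) \<le> exp (s * (x \<bullet> b)) * gauss x + exp (- s * (x \<bullet> b)) * gauss x" for x
    proof -
      define y where "y = s * (x \<bullet> b)"
      have "\<bar>\<Sum>j<n. y ^ j / fact j\<bar> \<le> (\<Sum>j<n. \<bar>y\<bar> ^ j / fact j)"
        by (rule order.trans[OF sum_abs]) (simp add: abs_mult power_abs)
      also have "\<dots> \<le> exp \<bar>y\<bar>"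
        using sum_le_suminf[OF summable_exp[of "\<bar>y\<bar>"], of "{..<n}"] by (simp add: exp_def field_simps scaleR_conv_of_real)
      also have "\<dots> \<le> exp y + exp (- y)" by (cases "y \<ge> 0") auto
      finally show ?thesis unfolding f_def y_def[symmetric] abs_mult
        by (simp add: abs_mult y_def distrib_right[symmetric])
    qed
    then show "AE x in lborel. norm (f n x) \<le> exp (s * (x \<bullet> b)) * gauss x + exp (- s * (x \<bullet> b)) * gauss x"
      by simp
  qed (auto simp: f_def[abs_def])
  moreover have "(LINT x|lborel. f n x) = (\<Sum>j<n. gauss_moment b j / fact j * s ^ j)" for n
  proof -
    have "f n x = (\<Sum>j<n. (s ^ j / fact j) * ((x \<bullet> b) ^ j * gauss x))" for x
      by (simp add: f_def sum_distrib_right sum_distrib_left power_mult_distrib mult_ac)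
    then show ?thesis
      using gaussian_ridge_homogeneous(1)[of b]
      by (simp add: Bochner_Integration.integral_sum integrable_mult_right mult_ac)
  qed
  ultimately show ?thesis unfolding sums_def gaussian_mgf(2)[OF assms] by simp
qed

text \<open>Uniqueness of power series: the limit at 0 gives the leading coefficient, and division
  by x, for nonzero x only, passes to the next one.\<close>

lemma powser_coeffs_zero:
  fixes a :: "nat \<Rightarrow> real"
  assumes "\<And>x. (\<lambda>n. a n * x ^ n) sums 0"
  shows "a n = 0"
proof -
  have zero: "a n = 0" if "\<forall>x. x \<noteq> 0 \<longrightarrow> (\<lambda>k. a (n + k) * x ^ k) sums 0" for n
  proof -
    have "((\<lambda>_. 0) \<longlongrightarrow> a (n + 0)) (at (0::real))"
      by (rule powser_limit_0_strong[of 1 "\<lambda>k. a (n + k)"]) (use that in auto)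
    then show ?thesis by (simp add: tendsto_const_iff)
  qed
  have "\<forall>x. x \<noteq> 0 \<longrightarrow> (\<lambda>k. a (n + k) * x ^ k) sums 0" for n
  proof (induction n)
    case (Suc n)
    show ?case
    proof (intro allI impI)
      fix x :: real assume x: "x \<noteq> 0"
      have "(\<lambda>k. a (n + k) * x ^ k) sums 0" using Suc x by blast
      then have "(\<lambda>k. a (n + Suc k) * x ^ Suc k) sums 0"
        using sums_Suc_iff[of "\<lambda>k. a (n + k) * x ^ k" 0] zero[OF Suc] by simp
      from sums_mult[OF this, of "1 / x"] show "(\<lambda>k. a (Suc n + k) * x ^ k) sums 0"
        using x by (simp add: field_simps)
    qed
  qed (use assms in simp)
  then show ?thesis by (rule zero)
qed

text \<open>The moment generating function is the same for all unit vectors, so its coefficients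
  agree. This is the rotation invariance of the volume for functions of a single inner
  product.\<close>

lemma sphere_int_ridge_cong:
  fixes b c :: "'a::euclidean_space"
  assumes "norm b = 1" "norm c = 1"
  shows "sphere_int (\<lambda>x. (x \<bullet> b) ^ j) = sphere_int (\<lambda>x. (x \<bullet> c) ^ j)"
proof -
  have "gauss_moment b j / fact j - gauss_moment c j / fact j = 0"
  proof (rule powser_coeffs_zero)
    fix s :: real
    show "(\<lambda>j. (gauss_moment b j / fact j -
        gauss_moment c j / fact j) * s ^ j) sums 0"
      using sums_diff[OF gaussian_ridge_sums[OF assms(1), of s] gaussian_ridge_sums[OF assms(2), of s]]
      by (simp add: left_diff_distrib)
  qed
  then show ?thesis
    using radial_moment_pos[OF DIM_positive[where 'a = 'a], of j] by (simp add: gaussian_ridge_homogeneous(2))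
qed

lemma gaussian_ridge_moment:
  fixes b :: "'a::euclidean_space"
  assumes "norm b = 1"
  shows "gauss_moment b j =
     (if even j then gaussian_mass TYPE('a) * fact j / (4 ^ (j div 2) * fact (j div 2)) else 0)"
proof -
  define c where "c j = (if even j then gaussian_mass TYPE('a) / (4 ^ (j div 2) * fact (j div 2)) else 0)" for j
  have "gauss_moment b j / fact j - c j = 0"
  proof (rule powser_coeffs_zero)
    fix s :: real
    have "(\<lambda>i. gaussian_mass TYPE('a) * ((s\<^sup>2 / 4) ^ i / fact i)) sums (gaussian_mass TYPE('a) * exp (s\<^sup>2 / 4))"
      using exp_converges[of "s\<^sup>2 / 4"] by (intro sums_mult) (simp add: field_simps)
    from sums_if[OF sums_zero this]
    have "(\<lambda>j. if even j then gaussian_mass TYPE('a) * ((s\<^sup>2 / 4) ^ (j div 2) / fact (j div 2)) else 0) sums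
        (gaussian_mass TYPE('a) * exp (s\<^sup>2 / 4))" by simp
    also have "(\<lambda>j. if even j then gaussian_mass TYPE('a) * ((s\<^sup>2 / 4) ^ (j div 2) / fact (j div 2)) else 0) = (\<lambda>j. c j * s ^ j)"
      by (rule ext) (auto simp: c_def power_divide power_mult[symmetric] elim!: evenE)
    finally have h: "(\<lambda>j. c j * s ^ j) sums (gaussian_mass TYPE('a) * exp (s\<^sup>2 / 4))" .
    show "(\<lambda>j. (gauss_moment b j / fact j - c j) * s ^ j) sums 0"
      using sums_diff[OF gaussian_ridge_sums[OF assms(1), of s] h]
      by (simp only: left_diff_distrib mult.commute[of "gaussian_mass TYPE('a)"] diff_self)
  qed
  then show ?thesis by (auto simp: c_def field_simps)
qed

section \<open>Moments on the 3-sphere and Chebyshev orthogonality\<close>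

lemma norm_qone: "norm qone = 1"
  by (simp add: qone_def norm_prod_def)

abbreviation (input) sphere3_moment :: "nat \<Rightarrow> real" where
  "sphere3_moment j \<equiv> sphere_int (\<lambda>x::quat. (x \<bullet> qone) ^ j)"

lemma sphere3_moment:
  "sphere3_moment (2 * i) = 2 * gaussian_mass TYPE(quat) * fact (2 * i) / (4 ^ i * fact i * fact (i + 1))"
  "odd j \<Longrightarrow> sphere3_moment j = 0"
proof -
  have d: "DIM(quat) = 4" by simp
  have rad: "radial_moment 4 (2 * i) = fact (i + 1) / 2" by (rule radial_moment_even) auto
  have "sphere3_moment (2 * i) * (fact (i + 1) / 2) =
      gaussian_mass TYPE(quat) * fact (2 * i) / (4 ^ i * fact i)"
    using gaussian_ridge_homogeneous(2)[of qone "2 * i"] gaussian_ridge_moment[OF norm_qone, of "2 * i"]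
    unfolding d rad by (simp del: fact_Suc)
  then show "sphere3_moment (2 * i) = 2 * gaussian_mass TYPE(quat) * fact (2 * i) / (4 ^ i * fact i * fact (i + 1))"
    by (simp add: field_simps del: fact_Suc)
  show "odd j \<Longrightarrow> sphere3_moment j = 0"
    using gaussian_ridge_homogeneous(2)[of qone j] gaussian_ridge_moment[OF norm_qone, of j] radial_moment_pos[of 4 j]
    unfolding d by simp
qed

text \<open>Precisely the statement that (1 - x^2) r' - 3 x r has integral 0 for r = x^(j+1). In
  this form the semicircle law of a coordinate on the 3-sphere is used.\<close>

lemma sphere3_moment_rec:
  "(real j + 4) * sphere3_moment (j + 2) = (real j + 1) * sphere3_moment j"
proof (cases "even j")
  case False
  then show ?thesis by (simp add: sphere3_moment(2) del: power_Suc add_2_eq_Suc')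
next
  case True
  then obtain i where i: "j = 2 * i" by auto
  have e: "j + 2 = 2 * (i + 1)" by (simp add: i)
  have f: "fact (2 * (i + 1)) = (2 * real i + 2) * (2 * real i + 1) * fact (2 * i)"
    "fact (i + 1 + 1) = (real i + 2) * ((real i + 1) * fact i)" "fact (i + 1) = (real i + 1) * fact i"
    by (simp_all add: algebra_simps)
  have "(2 * x + 4) * (2 * g * ((2 * x + 2) * (2 * x + 1) * h) / (4 * p * ((x + 1) * k) * ((x + 2) * ((x + 1) * k))))
     = (2 * x + 1) * (2 * g * h / (p * k * ((x + 1) * k)))" if "x \<ge> 0" "p > 0" "k > 0" for x g h p k :: real
    using that by (simp add: divide_simps) (simp add: algebra_simps)
  note * = this[of "real i" "4 ^ i" "fact i"]
  have "(4::real) ^ (i + 1) = 4 * 4 ^ i" "real (2 * i) = 2 * real i" by simp_all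
  then show ?thesis
    unfolding e unfolding i sphere3_moment(1) f by (simp only:) (rule *; simp)
qed

lemma sphere3_chebU:
  "sphere_int (\<lambda>x::quat. poly (chebU m * chebU n) (x \<bullet> qone)) = (if m = n then sphere_int (\<lambda>_::quat. 1) else 0)"
proof -
  define K where "K p = sphere_int (\<lambda>x::quat. poly p (x \<bullet> qone))" for p
  have add: "K (p + q) = K p + K q" for p q
    unfolding K_def by (simp, rule sphere_int_add) (auto intro!: continuous_intros)
  have smult: "K (smult c p) = c * K p" for c p
    unfolding K_def by (simp add: sphere_int_cmult)
  have diff: "K (p - q) = K p - K q" for p q
    using add[of p "smult (- 1) q"] smult[of "- 1" q] by simp
  define L where "L r = [:1, 0, - 1:] * pderiv r - [:0, 3:] * r" for r :: "real poly"
  \<comment> \<open>Exactness is linear in r, so monomials suffice. A constant r leaves a multiple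
    of the first moment, which is odd.\<close>
  have Lm: "K (L (monom c j)) = 0" for c j
  proof (cases j)
    case 0
    have "L (monom c j) = smult (- 3 * c) (monom 1 1)"
      by (rule iffD1[OF poly_eq_poly_eq_iff], rule ext) (simp add: L_def 0 poly_monom pderiv_monom)
    moreover have "K (monom 1 1) = 0" using sphere3_moment(2)[of 1] by (simp add: K_def poly_monom)
    ultimately show ?thesis by (simp only: smult mult_zero_right)
  next
    case (Suc i)
    have "L (monom c j) = smult (c * real (Suc i)) (monom 1 i) - smult (c * (real i + 4)) (monom 1 (i + 2))"
      by (rule iffD1[OF poly_eq_poly_eq_iff], rule ext)
         (simp add: L_def Suc poly_monom pderiv_monom algebra_simps power2_eq_square)
    then have "K (L (monom c j)) = c * real (Suc i) * K (monom 1 i) - c * (real i + 4) * K (monom 1 (i + 2))"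
      by (simp only: diff smult)
    also have "\<dots> = c * (real (Suc i) * K (monom 1 i) - (real i + 4) * K (monom 1 (i + 2)))"
      by (simp add: algebra_simps)
    also have "\<dots> = 0"
      using sphere3_moment_rec[of i] by (simp add: K_def poly_monom del: add_2_eq_Suc')
    finally show ?thesis .
  qed
  have Ladd: "L (r + r') = L r + L r'" for r r'
    unfolding L_def pderiv_add by (simp add: distrib_left)
  have K0: "K 0 = 0" using smult[of 0 0] by simp
  have Lsum: "K (L (\<Sum>i\<in>A. monom (f i) i)) = 0" for A :: "nat set" and f
  proof (induction A rule: infinite_finite_induct)
    case (insert a A)
    then show ?case by (simp add: Ladd add Lm)
  qed (simp_all add: L_def K0)
  have "K ([:1, 0, - 1:] * pderiv r - [:0, 3:] * r) = 0" for r
    using Lsum[of "coeff r" "{..degree r}"] unfolding poly_as_sum_of_monoms L_def .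
  from chebU_orthogonal[of K, OF add smult this, of m n] show ?thesis by (simp add: K_def)
qed

lemma gaussian_snd:
  fixes F :: "'b::euclidean_space \<Rightarrow> real"
  assumes "integrable lborel (\<lambda>y. F y * gauss y)"
  shows "(LINT z|lborel. F (snd z) * gauss (z :: 'a::euclidean_space \<times> 'b)) =
     gaussian_mass TYPE('a) * (LINT y|lborel. F y * gauss y)"
proof -
  have "(norm z)\<^sup>2 = (norm (fst z))\<^sup>2 + (norm (snd z))\<^sup>2" for z :: "'a \<times> 'b"
    by (simp add: norm_prod_def)
  then have "(LINT z|lborel. F (snd z) * gauss (z :: 'a \<times> 'b)) =
    integral\<^sup>L (lborel \<Otimes>\<^sub>M lborel) (\<lambda>(x :: 'a, y). gauss x * (F y * gauss y))"
    unfolding lborel_prod by (intro Bochner_Integration.integral_cong) (auto simp: exp_add[symmetric] mult_ac)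
  also have "\<dots> = gaussian_mass TYPE('a) * (LINT y|lborel. F y * gauss y)"
    unfolding gaussian_mass_def
    by (rule integral_pair_mult(2)[OF sigma_finite_lborel sigma_finite_lborel gaussian_mass(1) assms])
  finally show ?thesis .
qed

lemma hcheb_scale: "hcheb m (c * u) (c\<^sup>2 * v) = c ^ m * hcheb m u v"
proof (induction m rule: induct_nat_012)
  case (ge2 m)
  show ?case unfolding hcheb.simps ge2 by (simp add: algebra_simps power2_eq_square)
qed auto

text \<open>The integrand depends on the last component only. Passing to Gaussian integrals splits
  off the other components, and passing back leads to the 3-sphere, where the norm is 1 and
  Chebyshev orthogonality applies. The degree 2 (m + j) and both dimensions are even, so the two
  radial moments are factorials.\<close>

lemma sphere_int_hcheb:
  "sphere_int (\<lambda>q::'n::finite qspace. hcheb m (qRe (snd q)) ((norm (snd q))\<^sup>2) * hcheb l (qRe (snd q)) ((norm (snd q))\<^sup>2)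
      * ((norm (snd q))\<^sup>2) ^ j)
    = (if m = l then 2 * pi ^ (2 * CARD('n) + 2) * fact (m + j + 1) / fact (m + j + 2 * CARD('n) + 1) else 0)"
proof -
  define F where "F m l j = (\<lambda>w::quat. hcheb m (qRe w) ((norm w)\<^sup>2) * hcheb l (qRe w) ((norm w)\<^sup>2) * ((norm w)\<^sup>2) ^ j)" for m l j
  define A where "A m l j = sphere_int (\<lambda>q::'n qspace. F m l j (snd q))" for m l j
  define c where "c = gaussian_mass TYPE(quat ^ 'n) * sphere_int (\<lambda>_::quat. 1)"
  have re: "qRe w = w \<bullet> qone" for w by (cases w) (simp add: qRe_def qone_def)
  have cont: "continuous_on S (F m l j)" for S m l j
    unfolding F_def re by (intro continuous_intros)
  have hom: "F m l j (t *\<^sub>R w) = t ^ (m + l + 2 * j) * F m l j w" for m l j t w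
  proof -
    have "(norm (t *\<^sub>R w))\<^sup>2 = t\<^sup>2 * (norm w)\<^sup>2" by (simp add: power_mult_distrib)
    moreover have "qRe (t *\<^sub>R w) = t * qRe w" by (simp add: re)
    moreover have "(t\<^sup>2) ^ j = (t ^ j)\<^sup>2" by (simp add: power_mult[symmetric] mult.commute)
    ultimately show ?thesis
      by (simp add: F_def hcheb_scale power_mult_distrib power_add power_mult mult_ac)
  qed
  have sgn: "norm x *\<^sub>R sgn x = x" for x :: "'c::real_normed_vector"
    by (cases "x = 0") (simp_all add: sgn_div_norm)
  have hom1: "F m l j w = norm w ^ (m + l + 2 * j) * F m l j (sgn w)" for m l j w
    using hom[of m l j "norm w" "sgn w"] by (simp only: sgn)
  have hom2: "F m l j (snd q) = norm q ^ (m + l + 2 * j) * F m l j (snd (sgn q))" for m l j and q :: "'n qspace"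
  proof -
    have "norm q *\<^sub>R snd (sgn q) = snd (norm q *\<^sub>R sgn q)" by (simp only: snd_scaleR)
    then show ?thesis using hom[of m l j "norm q" "snd (sgn q)"] by (simp only: sgn)
  qed
  have I3: "sphere_int (F m l j) = (if m = l then sphere_int (\<lambda>_::quat. 1) else 0)" for m l j
  proof -
    have "sphere_int (F m l j) = sphere_int (\<lambda>x::quat. poly (chebU m * chebU l) (x \<bullet> qone))"
      by (rule sphere_int_cong) (simp add: F_def poly_chebU re)
    then show ?thesis unfolding sphere3_chebU .
  qed
  have key: "A m l j * radial_moment (4 * CARD('n) + 4) (m + l + 2 * j) = (if m = l then c * radial_moment 4 (m + l + 2 * j) else 0)" for m l j
  proof -
    note g1 = gaussian_homogeneous[OF cont hom1, of m l j]
    have c2: "continuous_on UNIV (\<lambda>q::'n qspace. F m l j (snd q))"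
      by (rule continuous_on_compose2[OF cont continuous_on_snd[OF continuous_on_id]]) auto
    note g2 = gaussian_homogeneous(2)[OF c2 hom2]
    have d: "DIM('n qspace) = 4 * CARD('n) + 4" "DIM(quat) = 4" by simp_all
    have "A m l j * radial_moment (4 * CARD('n) + 4) (m + l + 2 * j)
       = (LINT z|lborel. F m l j (snd z) * gauss (z :: 'n qspace))"
      unfolding g2 A_def d ..
    also have "\<dots> = gaussian_mass TYPE(quat ^ 'n) * (LINT y|lborel. F m l j y * gauss y)"
      by (rule gaussian_snd[OF g1(1)])
    finally show ?thesis unfolding g1(2) I3 c_def d by simp
  qed
  have A: "A m m j = c * fact (m + j + 1) / fact (m + j + 2 * CARD('n) + 1)" for m j
  proof -
    have "radial_moment (4 * CARD('n) + 4) (m + m + 2 * j) = fact (m + j + 2 * CARD('n) + 1) / 2"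
      "radial_moment 4 (m + m + 2 * j) = fact (m + j + 1) / 2"
      by (rule radial_moment_even; simp)+
    note rad = this
    have "A m m j * fact (m + j + 2 * CARD('n) + 1) = c * fact (m + j + 1)"
      using key[of m m j] unfolding rad by simp
    then show ?thesis by (simp add: eq_divide_eq del: fact_Suc)
  qed
  \<comment> \<open>The common constant \<open>c\<close> is found from the case where the integrand
    is 1, that is, from the total volume.\<close>
  have "A 0 0 0 = sphere_int (\<lambda>_::'n qspace. 1)"
    unfolding A_def F_def by simp
  also have "\<dots> = (4 * real CARD('n) + 4) * (pi ^ (2 * CARD('n) + 2) / fact (2 * CARD('n) + 2))"
    using unit_ball_vol_even[of "2 * CARD('n) + 2"] by (simp add: sphere_int_one mult.commute del: fact_Suc)
  also have "\<dots> = 2 * pi ^ (2 * CARD('n) + 2) / fact (2 * CARD('n) + 1)"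
  proof -
    have "fact (2 * CARD('n) + 2) = (2 * real CARD('n) + 2) * fact (2 * CARD('n) + 1)"
      by (simp add: algebra_simps)
    moreover have *: "(4 * x + 4) * (p / ((2 * x + 2) * f)) = 2 * p / f" if "x \<ge> 0" for x p f :: real
    proof -
      have "4 * x + 4 = 2 * (2 * x + 2)" "2 * x + 2 \<noteq> 0" using that by auto
      then show ?thesis by (simp del: distrib_left_numeral)
    qed
    ultimately show ?thesis by (simp only: of_nat_0_le_iff)
  qed
  finally have "c = 2 * pi ^ (2 * CARD('n) + 2)"
    using A[of 0 0] by (simp add: field_simps del: fact_Suc power_Suc)
  moreover have "A m l j = 0" if "m \<noteq> l"
    using key[of m l j] that radial_moment_pos[of "4 * CARD('n) + 4" "m + l + 2 * j"] by simp
  ultimately show ?thesis using A[of m j] unfolding A_def F_def by auto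
qed

section \<open>Zonal eigenfunctions\<close>

lemma uniform_limit_sphere_int:
  fixes f :: "nat \<Rightarrow> 'a::euclidean_space \<Rightarrow> real"
  assumes lim: "uniform_limit (sphere 0 1) f g sequentially"
    and cont: "\<And>n. continuous_sphere (f n)" "continuous_sphere g"
  shows "(\<lambda>n. sphere_int (f n)) \<longlonglongrightarrow> sphere_int g"
proof (rule LIMSEQ_I)
  fix e :: real assume "e > 0"
  define V where "V = sphere_int (\<lambda>_::'a. 1)"
  have V: "V > 0" by (simp add: V_def sphere_int_one)
  have "\<forall>\<^sub>F n in sequentially. \<forall>x\<in>sphere 0 1. dist (f n x) (g x) < e / (2 * V)"
    using uniform_limitD[OF lim, of "e / (2 * V)"] \<open>e > 0\<close> V by simp
  then obtain N where N: "\<And>n x. n \<ge> N \<Longrightarrow> x \<in> sphere 0 1 \<Longrightarrow> \<bar>f n x - g x\<bar> < e / (2 * V)"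
    unfolding eventually_sequentially dist_real_def by blast
  have "norm (sphere_int (f n) - sphere_int g) < e" if "n \<ge> N" for n
  proof -
    have c: "continuous_sphere (\<lambda>x. f n x - g x)" by (intro continuous_intros cont)
    have const: "sphere_int (\<lambda>_::'a. c) = c * V" for c
      using sphere_int_cmult[of c "\<lambda>_::'a. 1"] by (simp add: V_def)
    define d where "d = e / (2 * V)"
    have d: "f n x - g x \<le> d \<and> - d \<le> f n x - g x" if "x \<in> sphere 0 1" for x
      using N[OF \<open>n \<ge> N\<close> that] unfolding d_def by linarith
    have "sphere_int (\<lambda>x. f n x - g x) \<le> sphere_int (\<lambda>_::'a. d)"
      by (rule sphere_int_mono[OF c]) (use d in auto)
    moreover have "sphere_int (\<lambda>_::'a. - d) \<le> sphere_int (\<lambda>x. f n x - g x)"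
      by (rule sphere_int_mono[OF _ c]) (use d in auto)
    ultimately have "\<bar>sphere_int (\<lambda>x. f n x - g x)\<bar> \<le> d * V" unfolding const by linarith
    then have "\<bar>sphere_int (\<lambda>x. f n x - g x)\<bar> \<le> e / 2" using V by (simp add: d_def)
    then show ?thesis using \<open>e > 0\<close> unfolding sphere_int_diff[OF cont] by simp
  qed
  then show "\<exists>N. \<forall>n\<ge>N. norm (sphere_int (f n) - sphere_int g) < e" by blast
qed

lemma sphere_int_sum:
  assumes "finite I" "\<And>i. i \<in> I \<Longrightarrow> continuous_sphere (f i)"
  shows "sphere_int (\<lambda>x. \<Sum>i\<in>I. f i x) = (\<Sum>i\<in>I. sphere_int (f i))"
  using assms
proof (induction I rule: finite_induct)
  case empty
  show ?case using sphere_int_cmult[of 0 "\<lambda>_. 0"] by simp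
next
  case (insert i I)
  then show ?case by (simp add: sphere_int_add continuous_on_sum)
qed

text \<open>Meant to be applied twice, to the sum over k and then to the sum over m: continuity and
  bound of the first sum are the hypotheses on the terms of the second.\<close>

lemma sphere_int_suminf:
  fixes f :: "nat \<Rightarrow> 'a::euclidean_space \<Rightarrow> real"
  assumes cont: "\<And>n. continuous_sphere (f n)" "continuous_sphere g"
    and bound: "\<And>n x. x \<in> sphere 0 1 \<Longrightarrow> \<bar>f n x\<bar> \<le> b n" and b: "summable b"
  shows "continuous_sphere (\<lambda>x. \<Sum>n. f n x)"
    and "(\<lambda>n. sphere_int (\<lambda>x. f n x * g x)) sums sphere_int (\<lambda>x. (\<Sum>n. f n x) * g x)"
    and "\<And>x. x \<in> sphere 0 1 \<Longrightarrow> \<bar>\<Sum>n. f n x\<bar> \<le> suminf b"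
    and "\<And>x. x \<in> sphere 0 1 \<Longrightarrow> summable (\<lambda>n. f n x)"
proof -
  have lim: "uniform_limit (sphere 0 1) (\<lambda>n x. \<Sum>i<n. f i x) (\<lambda>x. \<Sum>n. f n x) sequentially"
    by (rule Weierstrass_m_test[OF _ b]) (use bound in auto)
  show c: "continuous_sphere (\<lambda>x. \<Sum>n. f n x)"
    by (rule uniform_limit_theorem[OF always_eventually lim]) (auto intro!: continuous_on_sum cont)
  have "bounded ((\<lambda>x. \<Sum>n. f n x) ` sphere 0 1)" "bounded (g ` sphere 0 1)"
    by (auto intro!: compact_imp_bounded compact_continuous_image c cont)
  from uniform_lim_mult[OF lim uniform_limit_const this]
  have "uniform_limit (sphere 0 1) (\<lambda>n x. (\<Sum>i<n. f i x) * g x) (\<lambda>x. (\<Sum>n. f n x) * g x) sequentially" .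
  then have "(\<lambda>n. sphere_int (\<lambda>x. (\<Sum>i<n. f i x) * g x)) \<longlonglongrightarrow> sphere_int (\<lambda>x. (\<Sum>n. f n x) * g x)"
    by (rule uniform_limit_sphere_int) (intro continuous_on_mult continuous_on_sum c cont)+
  moreover have "sphere_int (\<lambda>x. (\<Sum>i<n. f i x) * g x) = (\<Sum>i<n. sphere_int (\<lambda>x. f i x * g x))" for n
    unfolding sum_distrib_right by (rule sphere_int_sum) (auto intro!: continuous_intros cont)
  ultimately show "(\<lambda>n. sphere_int (\<lambda>x. f n x * g x)) sums sphere_int (\<lambda>x. (\<Sum>n. f n x) * g x)"
    unfolding sums_def by simp
  fix x :: 'a assume x: "x \<in> sphere 0 1"
  show "summable (\<lambda>n. f n x)" by (rule summable_comparison_test[OF _ b]) (use bound x in auto)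
  show "\<bar>\<Sum>n. f n x\<bar> \<le> suminf b"
    using norm_suminf_le[of "\<lambda>n. f n x" b] bound[OF x] b by simp
qed

text \<open>Powers of \<open>\<psi>\<close> concentrate on the set where \<open>\<psi>\<close> attains its maximum \<open>1\<close>.\<close>

lemma sphere_int_peak:
  fixes D \<psi> :: "'a::euclidean_space \<Rightarrow> real"
  assumes D: "continuous_sphere D" and \<psi>: "continuous_sphere \<psi>"
    and range: "\<And>x. x \<in> sphere 0 1 \<Longrightarrow> 0 \<le> \<psi> x \<and> \<psi> x \<le> 1"
    and a: "a \<in> sphere 0 1" "\<psi> a = 1"
    and pos: "\<And>x. x \<in> sphere 0 1 \<Longrightarrow> \<psi> x = 1 \<Longrightarrow> D x > 0"
  shows "\<exists>N0. \<forall>N\<ge>N0. sphere_int (\<lambda>x. D x * \<psi> x ^ N) > 0"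
proof -
  let ?S = "sphere 0 1 :: 'a set"
  define K where "K = {x\<in>?S. D x \<le> 0}"
  have "compact K"
  proof -
    have "closedin (top_of_set ?S) (?S \<inter> D -` {..0})"
      by (rule continuous_closedin_preimage[OF D]) simp
    moreover have "?S \<inter> D -` {..0} = K" by (auto simp: K_def)
    ultimately show ?thesis using closedin_compact[OF compact_sphere] by metis
  qed
  obtain \<rho> where \<rho>: "0 \<le> \<rho>" "\<rho> < 1" "\<And>x. x \<in> K \<Longrightarrow> \<psi> x \<le> \<rho>"
  proof (cases "K = {}")
    case True
    then show ?thesis using that[of 0] by simp
  next
    case False
    have "continuous_on K \<psi>" using \<psi> by (rule continuous_on_subset) (auto simp: K_def)
    then obtain y where y: "y \<in> K" "\<forall>x\<in>K. \<psi> x \<le> \<psi> y"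
      using continuous_attains_sup[OF \<open>compact K\<close> False] by blast
    then have "\<psi> y \<noteq> 1" using pos[of y] by (auto simp: K_def)
    then show ?thesis using that[of "\<psi> y"] y range[of y] by (auto simp: K_def)
  qed
  obtain M where M: "M > 0" "\<And>x. x \<in> ?S \<Longrightarrow> \<bar>D x\<bar> \<le> M"
  proof -
    have "bounded (D ` ?S)" by (intro compact_imp_bounded compact_continuous_image D) simp
    then show ?thesis using that unfolding bounded_pos by auto
  qed
  \<comment> \<open>Where D is not positive, the powers of \<psi> are at most \<rho>^N. The value
    \<tau> lies strictly between \<rho> and 1, so the contribution from \<psi> > \<tau> dominates
    for large N.\<close>
  define \<tau> where "\<tau> = (1 + \<rho>) / 2"
  have \<tau>: "\<rho> < \<tau>" "\<tau> < 1" "0 < \<tau>" using \<rho> by (simp_all add: \<tau>_def)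
  \<comment> \<open>A continuous substitute for D times the indicator of the set \<psi> >
    \<tau>.\<close>
  define h where "h x = max (D x) 0 * max (\<psi> x - \<tau>) 0" for x
  have ch: "continuous_on ?S h" unfolding h_def by (intro continuous_intros D \<psi>)
  define E where "E = sphere_int h"
  have "E > 0"
    unfolding E_def by (rule sphere_int_pos[OF ch _ a(1)]) (use pos[OF a] a \<tau> in \<open>auto simp: h_def\<close>)
  define V where "V = sphere_int (\<lambda>_::'a. 1)"
  have low: "\<tau> ^ N * h x - M * \<rho> ^ N \<le> D x * \<psi> x ^ N" if x: "x \<in> ?S" for x N
  proof (cases "D x \<le> 0")
    case True
    then have "\<psi> x ^ N \<le> \<rho> ^ N" using x \<rho> range[OF x] by (intro power_mono) (auto simp: K_def)
    moreover have "- M \<le> D x" using M(2)[OF x] by linarith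
    ultimately have "- D x * \<psi> x ^ N \<le> M * \<rho> ^ N" using True range[OF x] M by (intro mult_mono) auto
    then show ?thesis using True by (simp add: h_def)
  next
    case False
    have "\<tau> ^ N * h x \<le> D x * \<psi> x ^ N"
    proof (cases "\<psi> x \<le> \<tau>")
      case True
      then show ?thesis using False range[OF x] by (simp add: h_def)
    next
      case 2: False
      have "\<tau> ^ N * (\<psi> x - \<tau>) \<le> \<psi> x ^ N * 1"
        using 2 range[OF x] \<tau> by (intro mult_mono power_mono) auto
      then have "D x * (\<tau> ^ N * (\<psi> x - \<tau>)) \<le> D x * \<psi> x ^ N" using False by (intro mult_left_mono) auto
      then show ?thesis using False 2 by (simp add: h_def mult_ac)
    qed
    moreover have "0 \<le> M * \<rho> ^ N" using M \<rho> by simp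
    ultimately show ?thesis by linarith
  qed
  have int: "\<tau> ^ N * E - M * \<rho> ^ N * V \<le> sphere_int (\<lambda>x. D x * \<psi> x ^ N)" for N
  proof -
    have "sphere_int (\<lambda>x. \<tau> ^ N * h x - M * \<rho> ^ N) = sphere_int (\<lambda>x. \<tau> ^ N * h x) - sphere_int (\<lambda>_::'a. M * \<rho> ^ N)"
      by (rule sphere_int_diff) (auto intro!: continuous_intros ch)
    also have "\<dots> = \<tau> ^ N * E - M * \<rho> ^ N * V"
      using sphere_int_cmult[of "M * \<rho> ^ N" "\<lambda>_::'a. 1"] by (simp add: sphere_int_cmult E_def V_def)
    finally have eq: "sphere_int (\<lambda>x. \<tau> ^ N * h x - M * \<rho> ^ N) = \<tau> ^ N * E - M * \<rho> ^ N * V" .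
    show ?thesis unfolding eq[symmetric]
      by (rule sphere_int_mono) (auto intro!: continuous_intros ch D \<psi> low)
  qed
  have "(\<lambda>N. M * V * (\<rho> / \<tau>) ^ N) \<longlonglongrightarrow> M * V * 0"
    using \<tau> \<rho> by (intro tendsto_mult tendsto_const LIMSEQ_realpow_zero) auto
  then have "\<forall>\<^sub>F N in sequentially. M * V * (\<rho> / \<tau>) ^ N < E"
    using \<open>E > 0\<close> by (intro order_tendstoD(2)) auto
  then obtain N0 where N0: "\<And>N. N \<ge> N0 \<Longrightarrow> M * V * (\<rho> / \<tau>) ^ N < E" unfolding eventually_sequentially by blast
  show ?thesis
  proof (intro exI allI impI)
    fix N assume "N \<ge> N0"
    have "0 < \<tau> ^ N * (E - M * V * (\<rho> / \<tau>) ^ N)" using N0[OF \<open>N \<ge> N0\<close>] \<tau> by simp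
    also have "\<dots> = \<tau> ^ N * E - M * \<rho> ^ N * V" using \<tau> by (simp add: power_divide right_diff_distrib)
    also have "\<dots> \<le> sphere_int (\<lambda>x. D x * \<psi> x ^ N)" by (rule int)
    finally show "sphere_int (\<lambda>x. D x * \<psi> x ^ N) > 0" .
  qed
qed

section \<open>Zonal functions, their eigenvalues and their span\<close>

definition zonal :: "nat \<Rightarrow> real poly \<Rightarrow> 'n::finite qspace \<Rightarrow> 'n qspace \<Rightarrow> real" where
  "zonal m p b q = hcheb m (ucoord b q) (vcoord b q) * poly p (2 * vcoord b q - 1)"

lemma zonal_commute: "zonal m p b q = zonal m p q b"
  unfolding zonal_def using ucoord_commute[of b q] vcoord_commute[of b q] by simp

lemma continuous_on_coords [continuous_intros]:
  "continuous_on S (ucoord b)" "continuous_on S (vcoord b)"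
  unfolding ucoord_def[abs_def] vcoord_def[abs_def] by (auto intro!: continuous_intros)

lemma continuous_on_zonal: "continuous_on S (zonal m p b)"
  unfolding zonal_def[abs_def] by (intro continuous_intros)

lemma polynomial_hcheb:
  assumes "real_polynomial_function f" "real_polynomial_function g"
  shows "real_polynomial_function (\<lambda>x. hcheb m (f x) (g x))"
  using assms
  by (induction m rule: induct_nat_012)
    (auto intro!: real_polynomial_function_diff real_polynomial_function.intros(3,4))

lemma real_polynomial_function_poly:
  assumes "real_polynomial_function f"
  shows "real_polynomial_function (\<lambda>x. poly p (f x))"
  using assms by (induction p) (auto intro!: real_polynomial_function.intros(3,4))

lemma smooth_on_sphere_zonal: "smooth_on_sphere (zonal m p b)"
  unfolding zonal_def[abs_def]
  by (intro polynomial_smooth_on_sphere real_polynomial_function.intros(4)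
      polynomial_hcheb real_polynomial_function_poly real_polynomial_function_diff
      real_polynomial_function.intros(2) polynomial_coords)

lemma jet_zonal:
  "jet (\<lambda>u v. hcheb m u v * poly p (2 * v - 1))
     (\<lambda>u v. hcheb_u m u v * poly p (2 * v - 1))
     (\<lambda>u v. hcheb_v m u v * poly p (2 * v - 1) + 2 * hcheb m u v * poly (pderiv p) (2 * v - 1))
     (\<lambda>u v. hcheb_uu m u v * poly p (2 * v - 1))
     (\<lambda>u v. hcheb_uv m u v * poly p (2 * v - 1) + 2 * hcheb_u m u v * poly (pderiv p) (2 * v - 1))
     (\<lambda>u v. hcheb_vv m u v * poly p (2 * v - 1) + 4 * hcheb_v m u v * poly (pderiv p) (2 * v - 1)
        + 4 * hcheb m u v * poly (pderiv (pderiv p)) (2 * v - 1))"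
proof -
  have P: "((\<lambda>s. poly p (2 * V s - 1)) has_real_derivative 2 * poly (pderiv p) (2 * V s - 1) * V') (at s)"
    if "(V has_real_derivative V') (at s)" for V V' s and p :: "real poly"
  proof -
    have "((\<lambda>s. 2 * V s - 1) has_real_derivative 2 * V') (at s)"
      using that by (auto intro!: derivative_eq_intros)
    from DERIV_chain2[OF poly_DERIV this] show ?thesis by (simp add: mult_ac)
  qed
  show ?thesis
    by unfold_locales
      ((rule derivative_eq_intros DERIV_hcheb DERIV_hcheb_u DERIV_hcheb_v P refl | assumption)+, simp add: algebra_simps)+
qed

abbreviation (input) zonal_jacobi :: "nat \<Rightarrow> nat \<Rightarrow> nat \<Rightarrow> 'n::finite qspace \<Rightarrow> 'n qspace \<Rightarrow> real" where
  "zonal_jacobi n m k \<equiv> zonal m (jacobi (2 * n - 1) (m + 1) k)"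

text \<open>Harmonicity removes the second derivatives of the Chebyshev factor, and Euler's identity
  turns the remaining first derivatives into multiples of m. What is left in the other factor is
  Jacobi's equation at x = 2 v - 1, which is the origin of the parameters 2 n - 1 and m + 1; the
  term -4 n m comes from Euler's identity.\<close>

lemma sub_Laplacian_zonal_jacobi:
  fixes b q :: "'n::finite qspace"
  defines "n \<equiv> CARD('n)"
  assumes "norm b = 1" "norm q = 1"
  shows "sub_Laplacian (zonal_jacobi n m k b) q =
     - (4 * real (k * (k + 2 * n + m + 1) + n * m)) * zonal_jacobi n m k b q"
proof -
  define y where "y = jacobi (2 * n - 1) (m + 1) k"
  define u v where "u = ucoord b q" and "v = vcoord b q"
  define P P1 P2 where "P = poly y (2 * v - 1)" and "P1 = poly (pderiv y) (2 * v - 1)"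
    and "P2 = poly (pderiv (pderiv y)) (2 * v - 1)"
  define z zu zv zuu zuv zvv where "z = hcheb m u v" and "zu = hcheb_u m u v" and "zv = hcheb_v m u v"
    and "zuu = hcheb_uu m u v" and "zuv = hcheb_uv m u v" and "zvv = hcheb_vv m u v"
  have n: "n \<ge> 1" by (simp add: n_def Suc_le_eq)
  define a M K where "a = real n" and "M = real m" and "K = real k"
  have "poly (omx * opx * pderiv (pderiv y) + [:real (m + 1) - real (2 * n - 1), - (real (2 * n - 1) + real (m + 1) + 2):] * pderiv y
     + smult (real (k * (k + (2 * n - 1) + (m + 1) + 1))) y) (2 * v - 1) = 0"
    unfolding y_def jacobi_ode by simp
  moreover have r: "real (2 * n - 1) = 2 * a - 1"
    using n by (simp add: a_def of_nat_diff)
  moreover have "real (k * (k + (2 * n - 1) + (m + 1) + 1)) = K * (K + real (2 * n - 1) + (M + 1) + 1)"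
    by (simp only: of_nat_mult of_nat_add of_nat_1 M_def K_def)
  then have "real (k * (k + (2 * n - 1) + (m + 1) + 1)) = K * (K + 2 * a + M + 1)"
    unfolding r by simp
  moreover have "real (m + 1) = M + 1" by (simp add: M_def)
  ultimately have "poly (omx * opx * pderiv (pderiv y) + [:M + 1 - (2 * a - 1), - (2 * a - 1 + (M + 1) + 2):] * pderiv y
     + smult (K * (K + 2 * a + M + 1)) y) (2 * v - 1) = 0" by (simp only:)
  then have ode: "4 * v * (1 - v) * P2 + (M + 2 - 2 * a - (M + 2 * a + 2) * (2 * v - 1)) * P1
     + K * (K + 2 * a + M + 1) * P = 0"
    by (simp add: P_def P1_def P2_def algebra_simps)
  have euler: "u * zu + 2 * v * zv = M * z" unfolding zu_def zv_def z_def M_def by (rule hcheb_euler)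
  have harm: "zuu + 4 * u * zuv + 4 * v * zvv + 8 * zv = 0"
    unfolding zuu_def zuv_def zvv_def zv_def by (rule hcheb_harmonic)
  have "sub_Laplacian (zonal m y b) q =
      zuu * P * (1 - v) + 4 * u * (1 - v) * (zuv * P + 2 * zu * P1) + 4 * v * (1 - v) * (zvv * P + 4 * zv * P1 + 4 * z * P2)
      - 4 * a * u * (zu * P) + (zv * P + 2 * z * P1) * (8 - 8 * (a + 1) * v)"
    using jet.sub_Laplacian_zonal[OF jet_zonal[of m y] assms(2,3)]
    unfolding zonal_def[abs_def] u_def[symmetric] v_def[symmetric] P_def P1_def P2_def z_def zu_def zv_def zuu_def zuv_def zvv_def
      a_def n_def .
  also have "\<dots> = - (4 * (K * (K + 2 * a + M + 1) + a * M)) * (z * P)"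
    using ode euler harm by algebra
  also have "4 * (K * (K + 2 * a + M + 1) + a * M) = 4 * real (k * (k + 2 * n + m + 1) + n * m)"
    by (simp add: a_def M_def K_def algebra_simps)
  finally show ?thesis unfolding y_def[symmetric] by (simp add: zonal_def[abs_def] z_def P_def u_def v_def)
qed

text \<open>For fixed m the Jacobi polynomials span all polynomials in v by descent on the degree.
  Multiplication by u and v then preserves the span of the products, since the Chebyshev recursion
  expresses u times one product by its neighbours in m.\<close>

lemma zonal_annihilator:
  fixes \<Lambda> :: "(real \<times> real \<Rightarrow> real) \<Rightarrow> real"
  assumes add: "\<And>g h. continuous_on UNIV g \<Longrightarrow> continuous_on UNIV h \<Longrightarrow> \<Lambda> (\<lambda>z. g z + h z) = \<Lambda> g + \<Lambda> h"
    and cmult: "\<And>c g. continuous_on UNIV g \<Longrightarrow> \<Lambda> (\<lambda>z. c * g z) = c * \<Lambda> g"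
    and zero: "\<And>m k. \<Lambda> (\<lambda>z. hcheb m (fst z) (snd z) * poly (jacobi a (m + 1) k) (2 * snd z - 1)) = 0"
    and f: "real_polynomial_function f"
  shows "\<Lambda> f = 0"
proof -
  define Z where "Z m p = (\<lambda>z. hcheb m (fst z) (snd z) * poly p (2 * snd z - 1))" for m p
  have cZ: "continuous_on UNIV (Z m p)" for m p
    unfolding Z_def by (intro continuous_intros)
  have \<Lambda>Z: "\<Lambda> (Z m p) = 0" for m p
  proof (induction "degree p" arbitrary: p rule: less_induct)
    case less
    define k where "k = degree p"
    define J where "J = jacobi a (m + 1) k"
    define c where "c = coeff p k / coeff J k"
    have J: "coeff J k \<noteq> 0"
    proof -
      have "(2 * k + a + (m + 1)) choose k > 0" by (rule zero_less_binomial) simp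
      then show ?thesis unfolding J_def coeff_jacobi by simp
    qed
    define r where "r = p - smult c J"
    have eq: "Z m p = (\<lambda>z. Z m r z + c * Z m J z)" by (auto simp: Z_def r_def algebra_simps)
    have ZJ: "\<Lambda> (Z m J) = 0" unfolding Z_def J_def by (rule zero)
    have rk: "coeff r i = 0" if "i \<ge> k" for i
    proof (cases "i = k")
      case True
      then show ?thesis using J by (simp add: r_def c_def)
    next
      case False
      then have "i > k" using that by simp
      moreover have "degree J \<le> k" unfolding J_def by (rule degree_jacobi_le)
      ultimately show ?thesis by (simp add: r_def coeff_eq_0 k_def)
    qed
    have "\<Lambda> (Z m r) = 0"
    proof (cases "r = 0")
      case True
      have "Z m 0 = (\<lambda>z. 0 * Z m 0 z)" by (auto simp: Z_def)
      then show ?thesis using cmult[OF cZ, of 0 m 0] True by simp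
    next
      case False
      then have "degree r < k" using rk by (meson leading_coeff_0_iff not_le)
      then show ?thesis using less by (simp add: k_def)
    qed
    then show ?case unfolding eq using ZJ by (subst add) (auto intro!: cZ continuous_intros simp: cmult[OF cZ])
  qed
  \<comment> \<open>The multipliers g for which \<Lambda> still annihilates every product. The set
    is a vector space closed under multiplication by u and v and contains 1, hence contains every
    polynomial.\<close>
  define A where "A = {g. continuous_on UNIV g \<and> (\<forall>m p. \<Lambda> (\<lambda>z. g z * Z m p z) = 0)}"
  have A_add: "(\<lambda>z. g z + h z) \<in> A" if "g \<in> A" "h \<in> A" for g h
    using that cZ by (auto simp: A_def distrib_right intro!: continuous_intros add[THEN trans])
  have A_cmult: "(\<lambda>z. c * g z) \<in> A" if "g \<in> A" for g c
  proof -
    have "\<Lambda> (\<lambda>z. c * g z * Z m p z) = c * \<Lambda> (\<lambda>z. g z * Z m p z)" for m p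
      unfolding mult.assoc by (rule cmult) (use that cZ in \<open>auto simp: A_def intro!: continuous_intros\<close>)
    then show ?thesis using that by (auto simp: A_def intro!: continuous_intros)
  qed
  have A_snd: "(\<lambda>z. snd z * g z) \<in> A" if "g \<in> A" for g
  proof -
    \<comment> \<open>The polynomial (1 + x) / 2 takes the value v at x = 2 v - 1.\<close>
    have "(\<lambda>z. snd z * g z * Z m p z) = (\<lambda>z. g z * Z m ([:1 / 2, 1 / 2:] * p) z)" for m p
      by (rule ext) (simp add: Z_def field_simps)
    then show ?thesis using that by (auto simp: A_def intro!: continuous_intros)
  qed
  have A_fst: "(\<lambda>z. fst z * g z) \<in> A" if "g \<in> A" for g
  proof -
    have "\<Lambda> (\<lambda>z. fst z * g z * Z m p z) = 0" for m p
    proof (cases m)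
      case 0
      have "(\<lambda>z. fst z * g z * Z m p z) = (\<lambda>z. (1 / 2) * (g z * Z 1 p z))" by (auto simp: Z_def 0)
      then show ?thesis using that cmult[of "\<lambda>z. g z * Z 1 p z" "1 / 2"] cZ
        by (auto simp: A_def intro!: continuous_intros)
    next
      case (Suc l)
      define r where "r = [:1 / 2, 1 / 2:] * p"
      \<comment> \<open>The recursion solved for u times the m-th Chebyshev polynomial; its factor v
        is absorbed into the polynomial \<open>r\<close>.\<close>
      have "(\<lambda>z. fst z * g z * Z m p z) = (\<lambda>z. (1 / 2) * (g z * Z (Suc m) p z) + (1 / 2) * (g z * Z l r z))"
        by (rule ext) (simp add: Z_def Suc r_def field_simps)
      moreover have c: "continuous_on UNIV (\<lambda>z. g z * Z i p z)" for i p
        using that cZ by (auto simp: A_def intro!: continuous_intros)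
      then have "\<Lambda> (\<lambda>z. (1 / 2) * (g z * Z (Suc m) p z) + (1 / 2) * (g z * Z l r z))
          = \<Lambda> (\<lambda>z. (1 / 2) * (g z * Z (Suc m) p z)) + \<Lambda> (\<lambda>z. (1 / 2) * (g z * Z l r z))"
        by (intro add continuous_on_mult_left)
      ultimately show ?thesis using that unfolding cmult[OF c] by (simp add: A_def)
    qed
    then show ?thesis using that by (auto simp: A_def intro!: continuous_intros)
  qed
  have "\<forall>g\<in>A. (\<lambda>z. f z * g z) \<in> A"
    using f
  proof (induction rule: real_polynomial_function.induct)
    case (linear f)
    have "f z = f (1, 0) * fst z + f (0, 1) * snd z" for z
    proof -
      interpret bounded_linear f by fact
      have "z = fst z *\<^sub>R (1, 0) + snd z *\<^sub>R (0, 1)" by (simp add: prod_eq_iff)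
      then have "f z = f (fst z *\<^sub>R (1, 0) + snd z *\<^sub>R (0, 1))" by simp
      then show ?thesis unfolding add scaleR by (simp add: mult.commute)
    qed
    then obtain c d where "\<And>z. f z = c * fst z + d * snd z" by blast
    then have eq: "(\<lambda>z. f z * g z) = (\<lambda>z. c * (fst z * g z) + d * (snd z * g z))" for g
      by (simp add: fun_eq_iff algebra_simps)
    show ?case unfolding eq by (intro ballI A_add A_cmult A_fst A_snd)
  next
    case (const c)
    then show ?case using A_cmult by simp
  next
    case (add f g)
    then show ?case using A_add by (auto simp: distrib_right)
  next
    case (mult f g)
    then show ?case by (auto simp: mult.assoc)
  qed
  moreover have "(\<lambda>_. 1) \<in> A" using \<Lambda>Z by (auto simp: A_def)
  ultimately have "f \<in> A" by fastforce
  then have "\<Lambda> (\<lambda>z. f z * Z 0 1 z) = 0" by (simp add: A_def)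
  then show ?thesis by (simp add: Z_def)
qed

text \<open>Two weights and two poles are allowed, so that the lemma serves both to compare
  \<open>p t\<close> at two points and, with E = 0, to show that kernel and series coincide.\<close>

lemma sphere_int_zonal_eq:
  fixes b c :: "'n::finite qspace"
  assumes D: "continuous_sphere D" and E: "continuous_sphere E"
    and eq: "\<And>m k. sphere_int (\<lambda>x. D x * zonal_jacobi n m k b x) = sphere_int (\<lambda>x. E x * zonal_jacobi n m k c x)"
    and f: "real_polynomial_function f"
  shows "sphere_int (\<lambda>x. D x * f (ucoord b x, vcoord b x)) = sphere_int (\<lambda>x. E x * f (ucoord c x, vcoord c x))"
proof -
  define \<Lambda> where "\<Lambda> g = sphere_int (\<lambda>x. D x * g (ucoord b x, vcoord b x)) - sphere_int (\<lambda>x. E x * g (ucoord c x, vcoord c x))"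
    for g :: "real \<times> real \<Rightarrow> real"
  have "\<Lambda> f = 0"
  proof (rule zonal_annihilator[where a = "2 * n - 1" and \<Lambda> = \<Lambda>])
    fix g h :: "real \<times> real \<Rightarrow> real" assume gh: "continuous_on UNIV g" "continuous_on UNIV h"
    have "continuous_sphere (\<lambda>x. F x * g (ucoord b x, vcoord b x))"
      if "continuous_on UNIV g" "continuous_sphere F" for F g and b :: "'n qspace"
      by (intro continuous_intros that(2) continuous_on_compose2[OF that(1)]) auto
    with gh D E show "\<Lambda> (\<lambda>z. g z + h z) = \<Lambda> g + \<Lambda> h"
      unfolding \<Lambda>_def by (simp add: distrib_left sphere_int_add)
  next
    fix e and g :: "real \<times> real \<Rightarrow> real"
    have "F x * (e * g z) = e * (F x * g z)" for F :: "'n qspace \<Rightarrow> real" and x z by simp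
    then show "\<Lambda> (\<lambda>z. e * g z) = e * \<Lambda> g"
      unfolding \<Lambda>_def by (simp only: sphere_int_cmult right_diff_distrib)
  next
    fix m k
    show "\<Lambda> (\<lambda>z. hcheb m (fst z) (snd z) * poly (jacobi (2 * n - 1) (m + 1) k) (2 * snd z - 1)) = 0"
      using eq[of m k] by (simp add: \<Lambda>_def zonal_def)
  qed (rule f)
  then show ?thesis by (simp add: \<Lambda>_def)
qed

section \<open>The heat kernel\<close>

text \<open>The powers of 1 + x span all polynomials. They are the convenient basis here because at
  x = 2 v - 1 they are 2^j v^j, whose integrals are explicit.\<close>

lemma poly_functional_zero:
  fixes E :: "real poly \<Rightarrow> real"
  assumes add: "\<And>p q. E (p + q) = E p + E q" and smult: "\<And>c p. E (smult c p) = c * E p"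
    and zero: "\<And>j. E (opx ^ j) = 0"
  shows "E p = 0"
proof -
  have "E (opx ^ j * pcompose q opx) = 0" for j q
  proof (induction q arbitrary: j)
    case 0
    show ?case using smult[of 0 0] by simp
  next
    case (pCons c q)
    have const: "[:c:] * F = smult c F" for F by simp
    have eq: "opx ^ j * pcompose (pCons c q) opx = smult c (opx ^ j) + opx ^ Suc j * pcompose q opx"
      by (simp add: pcompose_pCons const algebra_simps del: mult_pCons_left mult_pCons_right)
    show ?case unfolding eq add smult zero pCons by simp
  qed
  from this[of 0 "pcompose p [:- 1, 1:]"] show ?thesis
    by (simp add: pcompose_assoc[symmetric] pcompose_pCons)
qed

lemma vcoord_north_pole_le:
  assumes "q \<in> sphere 0 1"
  shows "0 \<le> vcoord north_pole q" "vcoord north_pole q \<le> 1"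
  using vcoord_le[OF norm_north_pole, of q] assms by (auto simp: vcoord_north_pole power_le_one)

text \<open>The volume pushed forward to x = cos 2r. The density (sin r)^(4n-1) (cos r)^3 dr gives
  (1 - x)^(2n-1) (1 + x) up to a constant, and the two Chebyshev factors contribute (1 + x)^m. Both
  sides are compared on powers of 1 + x.\<close>

lemma sphere_int_zonal_north:
  fixes m l :: nat and p :: "real poly"
  defines "n \<equiv> CARD('n::finite)"
  shows "sphere_int (\<lambda>q::'n qspace. hcheb m (ucoord north_pole q) (vcoord north_pole q) *
      hcheb l (ucoord north_pole q) (vcoord north_pole q) * poly p (2 * vcoord north_pole q - 1)) =
    (if m = l then 2 * pi ^ (2 * n + 2) / (2 ^ (2 * n + m + 1) * fact (2 * n - 1)) *
       poly_integral (omx ^ (2 * n - 1) * opx ^ (m + 1) * p) else 0)"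
proof -
  define F where "F p = (\<lambda>q::'n qspace. hcheb m (ucoord north_pole q) (vcoord north_pole q) *
      hcheb l (ucoord north_pole q) (vcoord north_pole q) * poly p (2 * vcoord north_pole q - 1))" for p
  have cF: "continuous_on S (F p)" for S p unfolding F_def by (intro continuous_intros)
  define c where "c = (if m = l then 2 * pi ^ (2 * n + 2) / (2 ^ (2 * n + m + 1) * fact (2 * n - 1)) else 0 :: real)"
  define E where "E p = sphere_int (F p) - c * poly_integral (omx ^ (2 * n - 1) * opx ^ (m + 1) * p)" for p
  have "n \<ge> 1" by (simp add: n_def Suc_le_eq)
  have "E p = 0"
  proof (rule poly_functional_zero[of E])
    fix p q
    have "F (p + q) = (\<lambda>x. F p x + F q x)" by (simp add: F_def fun_eq_iff algebra_simps)
    then show "E (p + q) = E p + E q"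
      unfolding E_def distrib_left poly_integral_add by (simp add: sphere_int_add[OF cF cF] algebra_simps)
  next
    fix d p
    have "F (smult d p) = (\<lambda>x. d * F p x)" by (simp add: F_def fun_eq_iff algebra_simps)
    then show "E (smult d p) = d * E p"
      unfolding E_def mult_smult_right poly_integral_smult by (simp add: sphere_int_cmult algebra_simps)
  next
    fix j
    have "F (opx ^ j) = (\<lambda>q. 2 ^ j * (hcheb m (qRe (snd q)) ((norm (snd q))\<^sup>2) * hcheb l (qRe (snd q)) ((norm (snd q))\<^sup>2)
      * ((norm (snd q))\<^sup>2) ^ j))"
      by (simp add: F_def fun_eq_iff ucoord_north_pole vcoord_north_pole poly_power power_mult_distrib mult_ac)
    then have 1: "sphere_int (F (opx ^ j)) =
        (if m = l then 2 ^ j * (2 * pi ^ (2 * n + 2) * fact (m + j + 1) / fact (m + j + 2 * n + 1)) else 0)"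
      by (simp add: sphere_int_cmult sphere_int_hcheb n_def del: fact_Suc power_Suc)
    have "2 * n - 1 + (m + 1 + j) + 1 = m + j + 2 * n + 1" "m + 1 + j = m + j + 1" using \<open>n \<ge> 1\<close> by auto
    then have 2: "poly_integral (omx ^ (2 * n - 1) * opx ^ (m + 1) * opx ^ j) =
        2 ^ (m + j + 2 * n + 1) * fact (2 * n - 1) * fact (m + j + 1) / fact (m + j + 2 * n + 1)"
      unfolding mult.assoc power_add[symmetric] poly_integral_beta by (simp only:)
    have 3: "(2::real) ^ (m + j + 2 * n + 1) = 2 ^ (2 * n + m + 1) * 2 ^ j" by (simp add: power_add)
    have "x * (2 * y * f / g) = 2 * y / (z * h) * (z * x * h * f / g)" if "z > 0" "h > 0" for x y f g z h :: real
      using that by simp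
    then show "E (opx ^ j) = 0"
      unfolding E_def 1 2 3 c_def by (simp del: fact_Suc power_Suc)
  qed
  then show ?thesis unfolding E_def F_def c_def by (simp split: if_splits)
qed

lemma zonal_north_pole:
  "zonal m (jacobi a b k) (north_pole :: 'n::finite qspace) north_pole = real (m + 1) * real ((a + k) choose k)"
proof -
  have "ucoord (north_pole :: 'n qspace) north_pole = 1" "vcoord (north_pole :: 'n qspace) north_pole = 1"
    by (simp_all add: ucoord_north_pole vcoord_north_pole, simp_all add: north_pole_def qRe_def qone_def norm_prod_def)
  then show ?thesis by (simp add: zonal_def hcheb_north poly_jacobi_one)
qed

text \<open>The second part explains \<open>alpha\<close>: it is the value at the pole over the
  squared norm, the coefficient with which an eigenfunction enters an expansion of the kernel from
  the pole.\<close>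

lemma zonal_orthogonal:
  fixes m l k j :: nat
  defines "n \<equiv> CARD('n::finite)"
  defines "\<phi> \<equiv> \<lambda>m k. zonal_jacobi n m k (north_pole :: 'n qspace)"
  shows "(m, k) \<noteq> (l, j) \<Longrightarrow> sphere_int (\<lambda>q. \<phi> m k q * \<phi> l j q) = 0"
    and "alpha n k m * sphere_int (\<lambda>q. \<phi> m k q * \<phi> m k q) = \<phi> m k north_pole"
proof -
  define a where "a = 2 * n - 1"
  have n: "n \<ge> 1" by (simp add: n_def Suc_le_eq)
  have e: "\<phi> m k q * \<phi> l j q = hcheb m (ucoord north_pole q) (vcoord north_pole q) *
      hcheb l (ucoord north_pole q) (vcoord north_pole q) *
      poly (jacobi a (m + 1) k * jacobi a (l + 1) j) (2 * vcoord north_pole q - 1)" for m k l j q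
    by (simp add: \<phi>_def zonal_def a_def mult_ac)
  have I: "sphere_int (\<lambda>q. \<phi> m k q * \<phi> l j q) = (if m = l then 2 * pi ^ (2 * n + 2) / (2 ^ (2 * n + m + 1) * fact a) *
       poly_integral (omx ^ a * opx ^ (m + 1) * jacobi a (m + 1) k * jacobi a (m + 1) j) else 0)" for m k l j
    unfolding e n_def sphere_int_zonal_north by (simp add: n_def a_def mult_ac del: mult_pCons_left mult_pCons_right)
  show "(m, k) \<noteq> (l, j) \<Longrightarrow> sphere_int (\<lambda>q. \<phi> m k q * \<phi> l j q) = 0"
    unfolding I using jacobi_orthogonal[of k j a "m + 1"] by auto
  define A B C D where "A = (fact a :: real)" and "B = (fact (a + k) :: real)" and "C = (fact (m + 1 + k) :: real)"
    and "D = (fact (k + a + (m + 1)) :: real)"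
  have pos: "A > 0" "B > 0" "C > 0" "D > 0" by (simp_all add: A_def B_def C_def D_def)
  define s where "s = real (2 * k + a + (m + 1) + 1)"
  have s: "s > 0" by (simp add: s_def)
  define T where "T = (2::real) ^ (2 * n + m + 1)"
  have T: "2 ^ (a + (m + 1) + 1) = T" "T > 0" using n by (simp_all add: T_def a_def)
  define p where "p = pi ^ (2 * n + 2)"
  have p: "p > 0" by (simp add: p_def)
  have N: "sphere_int (\<lambda>q. \<phi> m k q * \<phi> m k q) = 2 * p / (T * A) * (T * B * C / (fact k * D * s))"
    unfolding I jacobi_norm T by (simp add: A_def B_def C_def D_def s_def p_def T_def)
  have "Gamma (real (2 * n)) = A"
    using n Gamma_fact[of a, where 'a = real] by (simp add: A_def a_def of_nat_diff)
  moreover have "real (2 * k + m + 2 * n + 1) = s" using n by (simp add: s_def a_def)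
  moreover have "real ((k + m + 2 * n) choose (2 * n - 1)) = D / (A * C)"
  proof -
    have 1: "k + m + 2 * n = k + a + (m + 1)" using n by (auto simp: a_def)
    have 2: "k + a + (m + 1) - a = m + 1 + k" "a \<le> k + a + (m + 1)" by auto
    show ?thesis
      unfolding 1 a_def[symmetric] A_def C_def D_def using binomial_fact[OF 2(2), where 'a = real] unfolding 2(1) .
  qed
  ultimately have al: "alpha n k m = A / (2 * p) * s * real (m + 1) * (D / (A * C))"
    unfolding alpha_def p_def by simp
  have "\<phi> m k north_pole = real (m + 1) * (B / (fact k * A))"
    unfolding \<phi>_def zonal_north_pole a_def[symmetric] by (subst binomial_fact) (auto simp: A_def B_def)
  moreover have "A / (2 * p) * s * x * (D / (A * C)) * (2 * p / (T * A) * (T * B * C / (f * D * s))) = x * (B / (f * A))"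
    if "f > 0" for x f using that pos s T(2) p by simp
  ultimately show "alpha n k m * sphere_int (\<lambda>q. \<phi> m k q * \<phi> m k q) = \<phi> m k north_pole"
    unfolding N al by simp
qed

section \<open>Estimates for the terms of the series\<close>

lemma power_le_exp:
  fixes x d :: real
  assumes "x \<ge> 0" "d > 0"
  shows "x ^ p \<le> fact p / d ^ p * exp (d * x)"
proof -
  have "(d * x) ^ p / fact p \<le> exp (d * x)"
    using sum_le_suminf[OF summable_exp[of "d * x"], of "{p}"] assms
    by (simp add: exp_def field_simps scaleR_conv_of_real)
  then show ?thesis using assms by (simp add: field_simps power_mult_distrib)
qed

text \<open>A single term of the expansion of (1 + d)^N. The rate d is free: growth in N can be made
  as slow as desired, at the price of d^-k.\<close>

lemma binomial_le_exp:
  fixes d :: real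
  assumes "d > 0" "k \<le> N"
  shows "real (N choose k) \<le> exp (d * N) / d ^ k"
proof -
  have "real (N choose k) * d ^ k \<le> (\<Sum>k\<le>N. real (N choose k) * d ^ k)"
    using assms by (intro member_le_sum) auto
  also have "\<dots> = (1 + d) ^ N" using binomial_ring[of d 1 N] by (simp add: add.commute)
  also have "\<dots> \<le> exp d ^ N" using assms by (intro power_mono) auto
  also have "\<dots> = exp (d * N)" by (simp add: exp_of_nat2_mult)
  finally show ?thesis using assms by (simp add: field_simps)
qed

text \<open>The k-th term is the k-th power of x exp(-4 t k), which is eventually below 1/2.\<close>

lemma summable_power_gaussian:
  fixes x t :: real
  assumes "t > 0" "x \<ge> 0"
  shows "summable (\<lambda>k. x ^ k * exp (- 4 * real (k * k) * t))"
proof (rule summable_comparison_test_ev)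
  have "(\<lambda>k. x * exp (- 4 * t * real k)) \<longlonglongrightarrow> x * 0"
  proof (intro tendsto_mult tendsto_const)
    have "(\<lambda>k. exp (- 4 * t) ^ k) \<longlonglongrightarrow> 0" using assms by (intro LIMSEQ_realpow_zero) auto
    then show "(\<lambda>k. exp (- 4 * t * real k)) \<longlonglongrightarrow> 0" by (simp add: exp_of_nat2_mult[symmetric])
  qed
  then have "\<forall>\<^sub>F k in sequentially. x * exp (- 4 * t * real k) < 1 / 2" by (intro order_tendstoD(2)) auto
  then show "\<forall>\<^sub>F k in sequentially. norm (x ^ k * exp (- 4 * real (k * k) * t)) \<le> (1 / 2) ^ k"
  proof eventually_elim
    case (elim k)
    have "exp (- 4 * real (k * k) * t) = exp (- 4 * t * real k) ^ k"
      by (simp add: exp_of_nat2_mult[symmetric] mult_ac)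
    then have "x ^ k * exp (- 4 * real (k * k) * t) = (x * exp (- 4 * t * real k)) ^ k"
      by (simp add: power_mult_distrib)
    also have "\<dots> \<le> (1 / 2) ^ k" using elim assms by (intro power_mono) auto
    finally show ?case using assms by simp
  qed
  show "summable (\<lambda>k. (1 / 2 :: real) ^ k)" by simp
qed

text \<open>The summand as a function on the whole sphere, so that it can be integrated; this
  includes the points with vanishing last component, which have no cylindric coordinates.\<close>

definition series_term :: "real \<Rightarrow> nat \<Rightarrow> nat \<Rightarrow> 'n::finite qspace \<Rightarrow> real" where
  "series_term t m k q = alpha CARD('n) k m * exp (- 4 * real (k * (k + 2 * CARD('n) + m + 1) + CARD('n) * m) * t) *
     zonal_jacobi CARD('n) m k north_pole q"

abbreviation (input) gauss_weight :: "nat \<Rightarrow> real \<Rightarrow> nat \<Rightarrow> real" where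
  "gauss_weight n t k \<equiv> (exp (4 * real n * t) / (real n * t)) ^ k * exp (- 4 * real (k * k) * t)"

text \<open>The majorant is a product of a function of m and a function of k, as the two successive
  applications of the Weierstrass test require.\<close>

lemma series_term_bound:
  fixes t :: real
  defines "n \<equiv> CARD('n::finite)"
  assumes t: "t > 0"
  obtains C where "C \<ge> 0" "\<And>m k q. q \<in> sphere 0 1 \<Longrightarrow>
    \<bar>series_term t m k (q :: 'n qspace)\<bar>
     \<le> C * exp (- 2 * real n * t) ^ m * (gauss_weight n t k)"
proof -
  \<comment> \<open>With this rate the two factors exp(d N) cost exp(2 n t m), half of the available
    decay exp(-4 n t m).\<close>
  define d where "d = real n * t"
  have n: "n \<ge> 1" by (simp add: n_def Suc_le_eq)
  then have d: "d > 0" using t by (simp add: d_def)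
  define G where "G = Gamma (real (2 * n)) / (2 * pi ^ (2 * n + 2))"
  have G: "G \<ge> 0" using n by (simp add: G_def)
  \<comment> \<open>The number of factors N: two linear factors of \<open>alpha\<close>, 2 n - 1
    from its binomial coefficient, and one from the bound of the Chebyshev factor.\<close>
  define p where "p = 2 * n + 2"
  define C where "C = G * (fact p / d ^ p) * exp (2 * d * (2 * n + 1))"
  show ?thesis
  proof (rule that[of C])
    show "C \<ge> 0" using G d by (simp add: C_def)
    fix m k and q :: "'n qspace"
    assume q: "q \<in> sphere 0 1"
    define e where "e = exp (- 4 * real (k * k) * t)"
    define N where "N = 2 * k + m + 2 * n + 1"
    define u v where "u = ucoord north_pole q" and "v = vcoord north_pole q"
    have v: "0 \<le> v" "v \<le> 1" "u\<^sup>2 \<le> v"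
      using vcoord_north_pole_le[OF q] ucoord_sq_le[of north_pole q] by (auto simp: u_def v_def)
    have "\<bar>zonal_jacobi n m k north_pole q\<bar> \<le> real (m + 1) * real ((2 * k + (2 * n - 1) + (m + 1)) choose k)"
      unfolding zonal_def abs_mult u_def[symmetric] v_def[symmetric]
      by (intro mult_mono abs_hcheb_le abs_poly_jacobi_le v) auto
    also have "\<dots> \<le> real N * real (N choose k)"
    proof -
      have "(2 * k + (2 * n - 1) + (m + 1)) choose k \<le> N choose k"
        using n by (intro binomial_right_mono) (auto simp: N_def)
      then show ?thesis by (intro mult_mono) (auto simp: N_def)
    qed
    finally have z: "\<bar>zonal_jacobi n m k north_pole q\<bar> \<le> real N * real (N choose k)" .
    have al: "0 \<le> alpha n k m" "alpha n k m \<le> G * (real N * real N * real N ^ (2 * n - 1))"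
    proof -
      have eq: "alpha n k m = G * (real N * real (m + 1) * real ((k + m + 2 * n) choose (2 * n - 1)))"
        by (simp add: alpha_def G_def N_def)
      then show "0 \<le> alpha n k m" using G by simp
      have "(k + m + 2 * n) choose (2 * n - 1) \<le> (k + m + 2 * n) ^ (2 * n - 1)" by (rule binomial_le_pow) simp
      also have "\<dots> \<le> N ^ (2 * n - 1)" by (intro power_mono) (auto simp: N_def)
      finally have "real ((k + m + 2 * n) choose (2 * n - 1)) \<le> real N ^ (2 * n - 1)"
        by (simp only: of_nat_power[symmetric] of_nat_le_iff)
      then show "alpha n k m \<le> G * (real N * real N * real N ^ (2 * n - 1))"
        unfolding eq using G by (intro mult_left_mono mult_mono) (auto simp: N_def)
    qed
    have Np: "real N * real N * real N ^ (2 * n - 1) * real N = real N ^ p"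
    proof -
      have "p = Suc (Suc (Suc (2 * n - 1)))" using n by (simp add: p_def)
      then show ?thesis by simp
    qed
    have ex: "exp (- 4 * real (k * (k + 2 * n + m + 1) + n * m) * t) \<le> e * exp (- 4 * d * m)"
    proof -
      define R K where "R = real (k * (k + 2 * n + m + 1) + n * m)" and "K = real (k * k)"
      have "K * t + d * m \<le> R * t"
        using t by (simp add: d_def R_def K_def algebra_simps)
      then have "- 4 * R * t \<le> - 4 * K * t + - 4 * d * m" by simp
      then show ?thesis unfolding e_def R_def[symmetric] K_def[symmetric] exp_add[symmetric] exp_le_cancel_iff .
    qed
    have "\<bar>alpha n k m * exp (- 4 * real (k * (k + 2 * n + m + 1) + n * m) * t) *
       zonal_jacobi n m k north_pole q\<bar>
      \<le> G * (real N * real N * real N ^ (2 * n - 1)) * (e * exp (- 4 * d * m)) * (real N * real (N choose k))"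
      unfolding abs_mult using al z ex G by (intro mult_mono) (auto simp: e_def)
    also have "\<dots> = G * (real N ^ p * real (N choose k)) * (e * exp (- 4 * d * m))"
      unfolding Np[symmetric] by (simp only: mult_ac)
    also have "\<dots> \<le> G * ((fact p / d ^ p * exp (d * N)) * (exp (d * N) / d ^ k)) * (e * exp (- 4 * d * m))"
      using G d by (intro mult_right_mono mult_left_mono mult_mono power_le_exp binomial_le_exp) (auto simp: N_def e_def)
    also have "\<dots> = G * (fact p / d ^ p) * (exp (d * N) * exp (d * N) * exp (- 4 * d * m)) / d ^ k * e"
      by simp
    also have "exp (d * N) * exp (d * N) * exp (- 4 * d * m) = exp (2 * d * (2 * n + 1)) * exp (- 2 * real n * t) ^ m * exp (4 * real n * t) ^ k"
      by (simp add: exp_add[symmetric] exp_of_nat2_mult[symmetric] N_def d_def algebra_simps)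
    also have "G * (fact p / d ^ p) * (exp (2 * d * (2 * n + 1)) * exp (- 2 * real n * t) ^ m * exp (4 * real n * t) ^ k) / d ^ k * e
      = C * exp (- 2 * real n * t) ^ m * (gauss_weight n t k)"
      unfolding C_def d_def[symmetric] power_divide by (simp add: e_def)
    finally show "\<bar>series_term t m k q\<bar>
     \<le> C * exp (- 2 * real n * t) ^ m * (gauss_weight n t k)"
      by (simp only: series_term_def n_def)
  qed
qed

section \<open>Identification of the kernel\<close>

lemma sphere_int_poly_ridge_cong:
  fixes b c :: "'a::euclidean_space"
  assumes "norm b = 1" "norm c = 1"
  shows "sphere_int (\<lambda>x. poly p (x \<bullet> b)) = sphere_int (\<lambda>x. poly p (x \<bullet> c))"
proof -
  have "sphere_int (\<lambda>x. poly p (x \<bullet> b)) = (\<Sum>i\<le>degree p. coeff p i * sphere_int (\<lambda>x. (x \<bullet> b) ^ i))" for b :: 'a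
    unfolding poly_altdef by (subst sphere_int_sum) (auto intro!: continuous_intros simp: sphere_int_cmult)
  then show ?thesis using sphere_int_ridge_cong[OF assms] by simp
qed

lemma inner_unit_bounds:
  fixes x b :: "'a::real_inner"
  assumes "norm x = 1" "norm b = 1"
  shows "- 1 \<le> x \<bullet> b" "x \<bullet> b \<le> 1" "x \<bullet> b = 1 \<Longrightarrow> x = b"
proof -
  have "\<bar>x \<bullet> b\<bar> \<le> 1" using Cauchy_Schwarz_ineq2[of x b] assms by simp
  then show "- 1 \<le> x \<bullet> b" "x \<bullet> b \<le> 1" by auto
  assume "x \<bullet> b = 1"
  moreover have "(x - b) \<bullet> (x - b) = x \<bullet> x - 2 * (x \<bullet> b) + b \<bullet> b"
    by (simp add: inner_diff_left inner_diff_right inner_commute[of b x])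
  ultimately have "(x - b) \<bullet> (x - b) = 0"
    using assms by (simp add: dot_square_norm)
  then show "x = b" by simp
qed

context
  fixes p :: "real \<Rightarrow> 'n::finite qspace \<Rightarrow> real" and t :: real
  assumes p: "subelliptic_heat_kernel p" and t: "t > 0"
begin

lemma heat_kernel_continuous: "continuous_sphere (p t)"
  using p t unfolding subelliptic_heat_kernel_def by blast

text \<open>\<open>P t\<close> of an eigenfunction is evaluated at the north pole in two ways. This
  is where the semigroup enters; what follows uses only these integrals and the continuity of
  \<open>p t\<close>.\<close>

lemma heat_kernel_zonal:
  fixes b :: "'n qspace" and m k :: nat
  assumes b: "norm b = 1"
  defines "n \<equiv> CARD('n)"
  shows "sphere_int (\<lambda>q. p t q * zonal_jacobi n m k b q) =
     exp (- 4 * real (k * (k + 2 * n + m + 1) + n * m) * t) * zonal_jacobi n m k b north_pole"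
proof -
  obtain P where P: "heat_semigroup P"
    "\<And>f. continuous_sphere f \<Longrightarrow> P t f north_pole = (LINT q:sphere 0 1|sphere_volume. p t q * f q)"
    using p t unfolding subelliptic_heat_kernel_def by blast
  let ?\<phi> = "zonal_jacobi n m k b"
  have "P t ?\<phi> north_pole = exp (- (4 * real (k * (k + 2 * n + m + 1) + n * m)) * t) * ?\<phi> north_pole"
  proof (rule semigroup_eigenfunction[OF P(1) smooth_on_sphere_zonal])
    fix x :: "'n qspace"
    assume "x \<in> sphere 0 1"
    then have "norm x = 1" by simp
    from sub_Laplacian_zonal_jacobi[OF b this, of m k]
    show "sub_Laplacian ?\<phi> x = - (4 * real (k * (k + 2 * n + m + 1) + n * m)) * ?\<phi> x" unfolding n_def .
  qed (use t norm_north_pole in auto)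
  moreover have "P t ?\<phi> north_pole = sphere_int (\<lambda>q. p t q * ?\<phi> q)"
    unfolding sphere_int_def by (rule P(2)) (rule continuous_on_zonal)
  ultimately show ?thesis by simp
qed

text \<open>Testing against \<open>((1 + q \<bullet> b) / 2)\<^sup>N\<close>, which concentrates at \<open>b\<close>, recovers \<open>p t b\<close>; and
  the integral depends on \<open>b\<close> only through its coordinates because the eigenfunctions are
  symmetric in their two arguments.\<close>

lemma heat_kernel_coords:
  fixes b c :: "'n qspace"
  assumes b: "norm b = 1" and c: "norm c = 1"
    and u: "ucoord north_pole b = ucoord north_pole c" and v: "vcoord north_pole b = vcoord north_pole c"
  shows "p t b \<le> p t c"
proof (rule ccontr)
  assume "\<not> p t b \<le> p t c"
  \<comment> \<open>A level strictly between the two values: the peaks at b give a mean of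
    \<open>p t\<close> above d, those at c a mean below d, although both means are equal.\<close>
  define d where "d = (p t b + p t c) / 2"
  have d: "p t b - d > 0" "d - p t c > 0" using \<open>\<not> _\<close> by (auto simp: d_def)
  define n where "n = CARD('n)"
  define \<psi> where "\<psi> b x = (1 + x \<bullet> b) / 2" for b x :: "'n qspace"
  have c\<psi>: "continuous_on S (\<psi> b)" for S b unfolding \<psi>_def by (intro continuous_intros) auto
  have cp: "continuous_sphere (p t)" by (rule heat_kernel_continuous)
  have r: "0 \<le> \<psi> b x \<and> \<psi> b x \<le> 1" if "norm b = 1" "x \<in> sphere 0 1" for b x
    using inner_unit_bounds(1,2)[of x b] that by (auto simp: \<psi>_def)
  have one: "\<psi> b b = 1" if "norm b = 1" for b using that by (simp add: \<psi>_def dot_square_norm)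
  have max: "x = b" if "norm b = 1" "x \<in> sphere 0 1" "\<psi> b x = 1" for b x
    using inner_unit_bounds(3)[of x b] that by (auto simp: \<psi>_def)
  have peak: "\<exists>N0. \<forall>N\<ge>N0. sphere_int (\<lambda>x. g x * \<psi> b x ^ N) > 0"
    if "continuous_sphere g" "norm b = 1" "g b > 0" for g b
  proof (rule sphere_int_peak[where a = b])
    show "g x > 0" if "x \<in> sphere 0 1" "\<psi> b x = 1" for x
      using max[OF \<open>norm b = 1\<close> that] \<open>g b > 0\<close> by simp
  qed (use that r[OF \<open>norm b = 1\<close>] one in \<open>auto intro: c\<psi>\<close>)
  obtain N1 where N1: "\<forall>N\<ge>N1. sphere_int (\<lambda>x. (p t x - d) * \<psi> b x ^ N) > 0"
    using peak[OF continuous_on_diff[OF cp continuous_on_const] b d(1)] by blast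
  obtain N2 where N2: "\<forall>N\<ge>N2. sphere_int (\<lambda>x. (d - p t x) * \<psi> c x ^ N) > 0"
    using peak[OF continuous_on_diff[OF continuous_on_const cp] c d(2)] by blast
  define N where "N = N1 + N2"
  have cN: "continuous_sphere (\<lambda>x. p t x * \<psi> b x ^ N)" "continuous_sphere (\<lambda>x. d * \<psi> b x ^ N)" for b
    by (intro continuous_intros cp c\<psi>)+
  have split: "sphere_int (\<lambda>x. (p t x - d) * \<psi> b x ^ N) = sphere_int (\<lambda>x. p t x * \<psi> b x ^ N) - d * sphere_int (\<lambda>x. \<psi> b x ^ N)"
    "sphere_int (\<lambda>x. (d - p t x) * \<psi> b x ^ N) = d * sphere_int (\<lambda>x. \<psi> b x ^ N) - sphere_int (\<lambda>x. p t x * \<psi> b x ^ N)" for b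
    unfolding left_diff_distrib sphere_int_diff[OF cN] sphere_int_diff[OF cN(2,1)] sphere_int_cmult by auto
  have I1: "sphere_int (\<lambda>x. \<psi> b x ^ N) = sphere_int (\<lambda>x. \<psi> c x ^ N)"
  proof -
    have "\<psi> b x ^ N = poly ([:1 / 2, 1 / 2:] ^ N) (x \<bullet> b)" for b x by (simp add: \<psi>_def poly_power add_divide_distrib)
    then show ?thesis by (simp only: sphere_int_poly_ridge_cong[OF b c, of "[:1 / 2, 1 / 2:] ^ N"])
  qed
  have "sphere_int (\<lambda>x. p t x * (\<lambda>z. ((1 + fst z) / 2) ^ N) (ucoord b x, vcoord b x))
      = sphere_int (\<lambda>x. p t x * (\<lambda>z. ((1 + fst z) / 2) ^ N) (ucoord c x, vcoord c x))"
  proof (rule sphere_int_zonal_eq[OF cp cp, where n = n])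
    fix m k
    have "zonal_jacobi n m k b north_pole = zonal_jacobi n m k c north_pole"
      unfolding zonal_commute[of _ _ _ north_pole] unfolding zonal_def u v ..
    then show "sphere_int (\<lambda>x. p t x * zonal_jacobi n m k b x) = sphere_int (\<lambda>x. p t x * zonal_jacobi n m k c x)"
      using heat_kernel_zonal[OF b, of m k] heat_kernel_zonal[OF c, of m k] by (simp add: n_def)
  next
    have "real_polynomial_function (\<lambda>z::real \<times> real. 1 / 2 * (1 + fst z))"
      by (intro real_polynomial_function.intros bounded_linear_fst)
    then have "real_polynomial_function (\<lambda>z::real \<times> real. (1 + fst z) / 2)" by simp
    then show "real_polynomial_function (\<lambda>z::real \<times> real. ((1 + fst z) / 2) ^ N)"
      by (rule real_polynomial_function_power)
  qed
  then have I2: "sphere_int (\<lambda>x. p t x * \<psi> b x ^ N) = sphere_int (\<lambda>x. p t x * \<psi> c x ^ N)"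
    by (simp add: \<psi>_def ucoord_def)
  have "sphere_int (\<lambda>x. (p t x - d) * \<psi> b x ^ N) > 0" "sphere_int (\<lambda>x. (d - p t x) * \<psi> c x ^ N) > 0"
    using N1 N2 by (auto simp: N_def)
  then show False unfolding split I1 I2 by linarith
qed


text \<open>The difference \<open>D\<close> of kernel and series is orthogonal to all polynomials in
  the coordinates about the pole. Such polynomials concentrate on the level set of q, not at q, so
  it matters that \<open>D\<close> is constant on level sets.\<close>

lemma heat_kernel_series:
  assumes q: "norm q = 1"
  shows "summable (\<lambda>k. series_term t m k q)" and "(\<lambda>m. \<Sum>k. series_term t m k q) sums p t q"
proof -
  define n where "n = CARD('n)"
  have n: "n \<ge> 1" by (simp add: n_def Suc_le_eq)
  define \<phi> where "\<phi> m k = zonal_jacobi n m k (north_pole :: 'n qspace)" for m k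
  define e where "e m k = exp (- 4 * real (k * (k + 2 * n + m + 1) + n * m) * t)" for m k
  have T: "series_term t m k q = alpha n k m * e m k * \<phi> m k q" for m k q
    by (simp add: series_term_def \<phi>_def e_def n_def)
  obtain C where C: "C \<ge> 0" "\<And>m k q. q \<in> sphere 0 1 \<Longrightarrow> \<bar>series_term t m k (q :: 'n qspace)\<bar>
     \<le> C * exp (- 2 * real n * t) ^ m * (gauss_weight n t k)"
    by (rule series_term_bound[OF t, where 'n = 'n, folded n_def]) (rule that)
  define \<beta> where "\<beta> k = gauss_weight n t k" for k
  define \<gamma> where "\<gamma> m = C * exp (- 2 * real n * t) ^ m" for m
  have \<beta>: "summable \<beta>" unfolding \<beta>_def using t n by (intro summable_power_gaussian) auto
  have \<gamma>: "summable \<gamma>" unfolding \<gamma>_def using t n by (intro summable_mult summable_geometric) auto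
  have c\<phi>: "continuous_on S (\<phi> m k)" for S m k unfolding \<phi>_def by (rule continuous_on_zonal)
  have cT: "continuous_on S (series_term t m k :: 'n qspace \<Rightarrow> real)" for S m k
  proof -
    have "series_term t m k = (\<lambda>q. alpha n k m * e m k * \<phi> m k q)" by (simp add: T fun_eq_iff)
    then show ?thesis by (simp only:) (intro continuous_intros c\<phi>)
  qed
  have b1: "\<bar>series_term t m k x\<bar> \<le> \<gamma> m * \<beta> k" if "x \<in> sphere 0 1" for m k and x :: "'n qspace"
    using C(2)[OF that] by (simp add: \<beta>_def \<gamma>_def)
  have s1: "summable (\<lambda>k. \<gamma> m * \<beta> k)" for m using \<beta> by (rule summable_mult)
  define F where "F m x = (\<Sum>k. series_term t m k x)" for m and x :: "'n qspace"
  note L1 = sphere_int_suminf[OF cT _ b1 s1, folded F_def]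
  have cF: "continuous_sphere (F m)" for m
    by (rule L1(1)[of "\<lambda>_. 0"]) auto
  have bF: "\<bar>F m x\<bar> \<le> \<gamma> m * suminf \<beta>" if "x \<in> sphere 0 1" for m x
    using L1(3)[of "\<lambda>_. 0" x m] that suminf_mult[OF \<beta>, of "\<gamma> m"] by simp
  have s2: "summable (\<lambda>m. \<gamma> m * suminf \<beta>)" using \<gamma> by (rule summable_mult2)
  define s where "s x = (\<Sum>m. F m x)" for x
  note L2 = sphere_int_suminf[OF cF _ bF s2, folded s_def]
  have cs: "continuous_sphere s" by (rule L2(1)[of "\<lambda>_. 0"]) auto
  show "summable (\<lambda>k. series_term t m k q)" by (rule L1(4)[of "\<lambda>_. 0"]) (use q in auto)
  have sq: "(\<lambda>m. F m q) sums s q"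
    unfolding s_def by (rule summable_sums, rule L2(4)[of "\<lambda>_. 0"]) (use q in auto)
  have inner: "sphere_int (\<lambda>x. s x * \<phi> l j x) = e l j * \<phi> l j north_pole" for l j
  proof -
    have I: "sphere_int (\<lambda>x. series_term t m k x * \<phi> l j x) = (if k = j then (if m = l then e l j * \<phi> l j north_pole else 0) else 0)" for m k
    proof -
      have "sphere_int (\<lambda>x. series_term t m k x * \<phi> l j x) = alpha n k m * e m k * sphere_int (\<lambda>x. \<phi> m k x * \<phi> l j x)"
        unfolding T mult.assoc by (simp only: sphere_int_cmult)
      also have "\<dots> = (if k = j then (if m = l then e l j * \<phi> l j north_pole else 0) else 0)"
      proof (cases "(m, k) = (l, j)")
        case True
        then show ?thesis using zonal_orthogonal(2)[where 'n = 'n, of j l] unfolding \<phi>_def n_def by (simp add: mult_ac)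
      next
        case False
        then show ?thesis using zonal_orthogonal(1)[where 'n = 'n, OF False] unfolding \<phi>_def n_def by auto
      qed
      finally show ?thesis .
    qed
    have "(\<lambda>k. sphere_int (\<lambda>x. series_term t m k x * \<phi> l j x)) sums sphere_int (\<lambda>x. F m x * \<phi> l j x)" for m
      by (rule L1(2)[OF c\<phi>])
    then have "(\<lambda>k. if k = j then (if m = l then e l j * \<phi> l j north_pole else 0) else 0) sums sphere_int (\<lambda>x. F m x * \<phi> l j x)" for m
      unfolding I .
    from sums_unique2[OF this sums_single] have F: "sphere_int (\<lambda>x. F m x * \<phi> l j x) = (if m = l then e l j * \<phi> l j north_pole else 0)" for m
      by simp
    have "(\<lambda>m. sphere_int (\<lambda>x. F m x * \<phi> l j x)) sums sphere_int (\<lambda>x. s x * \<phi> l j x)"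
      by (rule L2(2)[OF c\<phi>])
    from sums_unique2[OF this[unfolded F] sums_single] show ?thesis by simp
  qed
  define D where "D x = p t x - s x" for x
  have cD: "continuous_sphere D" unfolding D_def by (intro continuous_intros heat_kernel_continuous cs)
  have D0: "sphere_int (\<lambda>x. D x * \<phi> m k x) = 0" for m k
  proof -
    have "sphere_int (\<lambda>x. D x * \<phi> m k x) = sphere_int (\<lambda>x. p t x * \<phi> m k x) - sphere_int (\<lambda>x. s x * \<phi> m k x)"
      unfolding D_def left_diff_distrib by (rule sphere_int_diff) (intro continuous_intros heat_kernel_continuous cs c\<phi>)+
    also have "\<dots> = 0" unfolding inner using heat_kernel_zonal[OF norm_north_pole, of m k] by (simp add: \<phi>_def e_def n_def)
    finally show ?thesis .
  qed
  define u v where "u = ucoord (north_pole :: 'n qspace)" and "v = vcoord (north_pole :: 'n qspace)"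
  have level: "D x = D q" if "x \<in> sphere 0 1" "u x = u q" "v x = v q" for x
  proof -
    have "p t x = p t q"
      using heat_kernel_coords[of x q] heat_kernel_coords[of q x] that q unfolding u_def v_def by force
    moreover have "series_term t m k x = series_term t m k q" for m k
      using that unfolding series_term_def zonal_def u_def v_def by simp
    ultimately show ?thesis by (simp add: D_def s_def F_def)
  qed
  \<comment> \<open>As u ranges over [-1, 1] and v over [0, 1], the sum of squares is at most 4 + 1
    = 5. Hence \<psi> lies in [0, 1] and equals 1 exactly on the level set of q.\<close>
  define \<psi> where "\<psi> z = 1 - ((fst z - u q)\<^sup>2 + (snd z - v q)\<^sup>2) / 5" for z :: "real \<times> real"
  have poly\<psi>: "real_polynomial_function \<psi>"
  proof -
    have "real_polynomial_function (\<lambda>z::real \<times> real. 1 - 1 / 5 * ((fst z - u q)\<^sup>2 + (snd z - v q)\<^sup>2))"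
      by (intro real_polynomial_function_diff real_polynomial_function.intros(2-4) real_polynomial_function_power
          real_polynomial_function.intros(1) bounded_linear_fst bounded_linear_snd)
    then show ?thesis by (simp add: \<psi>_def[abs_def])
  qed
  have zero: "sphere_int (\<lambda>x. D x * \<psi> (u x, v x) ^ N) = 0" for N
    using sphere_int_zonal_eq[OF cD continuous_on_const[of _ 0], where n = n and b = north_pole and c = north_pole
        and f = "\<lambda>z. \<psi> z ^ N"] D0 real_polynomial_function_power[OF poly\<psi>, of N] sphere_int_cmult[of 0 "\<lambda>_. 0"]
    by (simp add: \<phi>_def u_def v_def)
  have c\<psi>: "continuous_sphere (\<lambda>x. \<psi> (u x, v x))"
    unfolding \<psi>_def u_def v_def by (auto intro!: continuous_intros)
  have qS: "q \<in> sphere 0 1" using q by simp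
  have range: "0 \<le> \<psi> (u x, v x) \<and> \<psi> (u x, v x) \<le> 1" if "x \<in> sphere 0 1" for x
  proof -
    have uv: "\<bar>u x\<bar> \<le> 1" "0 \<le> v x" "v x \<le> 1" if "x \<in> sphere 0 1" for x :: "'n qspace"
      using inner_unit_bounds(1,2)[OF _ norm_north_pole, of x] vcoord_north_pole_le[OF that] that
      by (auto simp: u_def v_def ucoord_def)
    have "\<bar>u x - u q\<bar> \<le> 2" "\<bar>v x - v q\<bar> \<le> 1" using uv[OF that] uv[OF qS] by linarith+
    then have "(u x - u q)\<^sup>2 \<le> 2\<^sup>2" "(v x - v q)\<^sup>2 \<le> 1\<^sup>2" using abs_le_square_iff[of "u x - u q" 2] abs_le_square_iff[of "v x - v q" 1] by auto
    then show ?thesis by (simp add: \<psi>_def)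
  qed
  have max: "u x = u q \<and> v x = v q" if "\<psi> (u x, v x) = 1" for x
    using that by (auto simp: \<psi>_def sum_power2_eq_zero_iff)
  have \<psi>q: "\<psi> (u q, v q) = 1" by (simp add: \<psi>_def)
  have "D q = 0"
  proof (rule ccontr)
    assume "D q \<noteq> 0"
    \<comment> \<open>The factor \<open>D q\<close> makes the product positive on the level set
      whatever the sign of \<open>D q\<close>.\<close>
    have "continuous_sphere (\<lambda>x. D q * D x)" by (intro continuous_intros cD)
    moreover have "D q * D x > 0" if "x \<in> sphere 0 1" "\<psi> (u x, v x) = 1" for x
      using level[OF that(1)] max[OF that(2)] \<open>D q \<noteq> 0\<close> by (auto simp: zero_less_mult_iff)
    ultimately have "\<exists>N0. \<forall>N\<ge>N0. sphere_int (\<lambda>x. D q * D x * \<psi> (u x, v x) ^ N) > 0"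
      using sphere_int_peak[OF _ c\<psi> range qS \<psi>q, of "\<lambda>x. D q * D x"] by blast
    then obtain N where "sphere_int (\<lambda>x. D q * D x * \<psi> (u x, v x) ^ N) > 0" by blast
    then show False unfolding mult.assoc sphere_int_cmult zero by simp
  qed
  then show "(\<lambda>m. \<Sum>k. series_term t m k q) sums p t q" using sq by (simp add: D_def F_def)
qed

end

theorem proposition2p4:
  fixes p :: "real \<Rightarrow> 'n::finite qspace \<Rightarrow> real"
    and q :: "'n qspace"
    and n :: nat
    and t r \<eta> :: real
  assumes "n = CARD('n)"
    and "subelliptic_heat_kernel p"
    and "t > 0"
    and "has_cylindric_coords q r \<eta>"
  shows "(\<forall>m. summable (\<lambda>k. heat_term n t r \<eta> m k)) \<and>
         (\<lambda>m. \<Sum>k. heat_term n t r \<eta> m k) sums p t q"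
proof -
  have q: "norm q = 1" "norm (snd q) = cos r" "qRe (snd q) = cos r * cos \<eta>"
    using assms(4) by (auto simp: has_cylindric_coords_def)
  have "heat_term n t r \<eta> m k = series_term t m k q" for m k
  proof -
    \<comment> \<open>Homogeneity separates the power of cos r from the angular factor, including
      the angles 0 and \<pi>, where the quotient is a limit.\<close>
    have "hcheb m (cos r * cos \<eta>) ((cos r)\<^sup>2) = sin_quotient m \<eta> * cos r ^ m"
      using hcheb_scale[of m "cos r" "cos \<eta>" 1] by (simp add: sin_quotient_hcheb)
    moreover have "cos (2 * r) = 2 * (cos r)\<^sup>2 - 1" by (rule cos_double_cos)
    ultimately show ?thesis
      by (simp add: heat_term_def series_term_def zonal_def ucoord_north_pole vcoord_north_pole q assms(1))
  qed
  then show ?thesis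
    using heat_kernel_series[OF assms(2,3) q(1)] by simp
qed

end
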